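(* Let $d\in\mathbb{N}$, $1<p<\infty$, $0<q\le\infty$, and $b>-1/q$. For any $\varepsilon>0$, there is a function $f\in\mathbf{B}^{0,b}_{p,q}(\mathbb{R}^d)$ such that $f\notin B^{0,b+1/\max\{2,p,q\}+\varepsilon}_{p,q}(\mathbb{R}^d)$.
   Context: Convention: $1/\infty=0$. $\mathbf{B}^{0,b}_{p,q}(\mathbb{R}^d)$ is the set of $f\in L_p(\mathbb{R}^d)$ with finite quasi-norm $\|f\|_{L_p(\mathbb{R}^d)}+\left(\int_0^1((1-\log t)^b\omega_k(f,t)_p)^q\frac{dt}{t}\right)^{1/q}$ (supremum over $0<t<1$ if $q=\infty$), where $k\in\mathbb{N}$ is fixed (different $k$ give equivalent quasi-norms), $\omega_k(f,t)_p=\sup_{|h|\le t}\|\Delta_h^kf\|_{L_p(\mathbb{R}^d)}$, $\Delta^1_hf(x)=f(x+h)-f(x)$, $\Delta_h^{k+1}=\Delta_h^1\Delta_h^k$. Let $\varphi_0\in\mathcal{S}(\mathbb{R}^d)$ with $\operatorname{supp}\varphi_0\subset\{|x|\le2\}$, $\varphi_0(x)=1$ if $|x|\le1$, and $\varphi_j(x)=\varphi_0(2^{-j}x)-\varphi_0(2^{-j+1}x)$ for $j\in\mathbb{N}$. $B^{s,b}_{p,q}(\mathbb{R}^d)$ ($s,b\in\mathbb{R}$) is the set of tempered distributions $f$ with $\|f\|_{B^{s,b}_{p,q}(\mathbb{R}^d)}=\left(\sum_{j=0}^\infty(2^{js}(1+j)^b\|(\varphi_j\widehat f)^\vee\|_{L_p(\mathbb{R}^d)})^q\right)^{1/q}<\infty$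 (supremum if $q=\infty$); it does not depend on $\varphi_0$, up to equivalent quasi-norms. *)

theory Defs
  imports "HOL-Analysis.Analysis"
begin

section \<open>Powers of extended nonnegative reals and the space L_p\<close>

text \<open>Only meaningful for an exponent \<open>r > 0\<close>.\<close>

definition ennreal_powr :: "ennreal \<Rightarrow> real \<Rightarrow> ennreal" where
  "ennreal_powr x r = (if x = \<infinity> then \<infinity> else ennreal (enn2real x powr r))"

definition Lp_norm :: "real \<Rightarrow> ('a::euclidean_space \<Rightarrow> complex) \<Rightarrow> ennreal" where
  "Lp_norm p f = ennreal_powr (\<integral>\<^sup>+x. ennreal (cmod (f x) powr p) \<partial>lborel) (1 / p)"

definition Lp_space :: "real \<Rightarrow> ('a::euclidean_space \<Rightarrow> complex) set" where
  "Lp_space p = {f. f \<in> borel_measurable lborel \<and> Lp_norm p f < \<infinity>}"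


section \<open>Besov spaces defined by differences\<close>

primrec iter_diff :: "nat \<Rightarrow> 'a::euclidean_space \<Rightarrow> ('a \<Rightarrow> complex) \<Rightarrow> 'a \<Rightarrow> complex" where
  "iter_diff 0 h f = f"
| "iter_diff (Suc k) h f = (\<lambda>x. iter_diff k h f (x + h) - iter_diff k h f x)"

definition modulus_smoothness ::
    "nat \<Rightarrow> real \<Rightarrow> ('a::euclidean_space \<Rightarrow> complex) \<Rightarrow> real \<Rightarrow> ennreal" where
  "modulus_smoothness k p f t = (SUP h\<in>{h. norm h \<le> t}. Lp_norm p (iter_diff k h f))"

text \<open>The exponent \<open>q\<close> ranges over \<open>(0,\<infinity>]\<close>.\<close>

definition diff_Besov_seminorm ::
    "nat \<Rightarrow> real \<Rightarrow> ennreal \<Rightarrow> real \<Rightarrow> ('a::euclidean_space \<Rightarrow> complex) \<Rightarrow> ennreal" where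
  "diff_Besov_seminorm k p q b f =
     (if q = \<infinity>
      then (SUP t\<in>{0<..<1}. ennreal ((1 - ln t) powr b) * modulus_smoothness k p f t)
      else ennreal_powr
             (\<integral>\<^sup>+t\<in>{0<..<1}.
                ennreal_powr (ennreal ((1 - ln t) powr b) * modulus_smoothness k p f t)
                  (enn2real q) * ennreal (1 / t) \<partial>lborel)
             (1 / enn2real q))"

definition diff_Besov_space ::
    "nat \<Rightarrow> real \<Rightarrow> ennreal \<Rightarrow> real \<Rightarrow> ('a::euclidean_space \<Rightarrow> complex) set" where
  "diff_Besov_space k p q b =
     {f \<in> Lp_space p. Lp_norm p f + diff_Besov_seminorm k p q b f < \<infinity>}"


section \<open>Schwartz functions and tempered distributions\<close>

text \<open>Iterated directional derivatives; lists over \<open>Basis\<close> play the role of multi-indices.\<close>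

primrec iter_deriv :: "'a::euclidean_space list \<Rightarrow> ('a \<Rightarrow> complex) \<Rightarrow> 'a \<Rightarrow> complex" where
  "iter_deriv [] f = f"
| "iter_deriv (v # vs) f = (\<lambda>x. frechet_derivative (iter_deriv vs f) (at x) v)"

definition Schwartz :: "('a::euclidean_space \<Rightarrow> complex) set" where
  "Schwartz = {f. \<forall>vs. set vs \<subseteq> Basis \<longrightarrow>
      (\<forall>x. iter_deriv vs f differentiable (at x)) \<and>
      (\<forall>N::nat. bounded (range (\<lambda>x. (1 + norm x) ^ N *\<^sub>R iter_deriv vs f x)))}"

definition Schwartz_seminorm :: "nat \<Rightarrow> ('a::euclidean_space \<Rightarrow> complex) \<Rightarrow> real" where
  "Schwartz_seminorm N f =
     (SUP (x, vs) \<in> UNIV \<times> {vs. set vs \<subseteq> Basis \<and> length vs \<le> N}.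
        (1 + norm x) ^ N * cmod (iter_deriv vs f x))"

text \<open>
  Distributions are functionals on all functions, but only their values on \<open>Schwartz\<close> matter:
  functionals that agree there represent the same tempered distribution.  Continuity is
  expressed by the usual estimate against a Schwartz seminorm.
\<close>

type_synonym 'a distribution = "('a \<Rightarrow> complex) \<Rightarrow> complex"

definition tempered_distribution :: "'a::euclidean_space distribution \<Rightarrow> bool" where
  "tempered_distribution T \<longleftrightarrow>
     (\<forall>\<phi>\<in>Schwartz. \<forall>\<psi>\<in>Schwartz. T (\<lambda>x. \<phi> x + \<psi> x) = T \<phi> + T \<psi>) \<and>
     (\<forall>c. \<forall>\<phi>\<in>Schwartz. T (\<lambda>x. c * \<phi> x) = c * T \<phi>) \<and>
     (\<exists>N C. \<forall>\<phi>\<in>Schwartz. cmod (T \<phi>) \<le> C * Schwartz_seminorm N \<phi>)"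

definition distribution_of :: "('a::euclidean_space \<Rightarrow> complex) \<Rightarrow> 'a distribution" where
  "distribution_of g = (\<lambda>\<phi>. LINT x|lborel. g x * \<phi> x)"

definition represented_by :: "'a::euclidean_space distribution \<Rightarrow> ('a \<Rightarrow> complex) \<Rightarrow> bool" where
  "represented_by T g \<longleftrightarrow>
     g \<in> borel_measurable lborel \<and>
     (\<forall>\<phi>\<in>Schwartz. integrable lborel (\<lambda>x. g x * \<phi> x) \<and> T \<phi> = distribution_of g \<phi>)"

text \<open>
  The representing function is unique almost everywhere, so the infimum is the norm of that
  function, and it is \<open>\<infinity>\<close> if there is none.
\<close>

definition dist_Lp_norm :: "real \<Rightarrow> 'a::euclidean_space distribution \<Rightarrow> ennreal" where
  "dist_Lp_norm p T = (INF g\<in>{g. represented_by T g}. Lp_norm p g)"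


section \<open>Fourier transform\<close>

definition fourier :: "('a::euclidean_space \<Rightarrow> complex) \<Rightarrow> 'a \<Rightarrow> complex" where
  "fourier \<phi> = (\<lambda>\<xi>. of_real ((2 * pi) powr (- real DIM('a) / 2)) *
                    (LINT x|lborel. cis (- (x \<bullet> \<xi>)) * \<phi> x))"

definition inv_fourier :: "('a::euclidean_space \<Rightarrow> complex) \<Rightarrow> 'a \<Rightarrow> complex" where
  "inv_fourier \<phi> = (\<lambda>x. of_real ((2 * pi) powr (- real DIM('a) / 2)) *
                        (LINT \<xi>|lborel. cis (x \<bullet> \<xi>) * \<phi> \<xi>))"

definition dist_fourier :: "'a::euclidean_space distribution \<Rightarrow> 'a distribution" where
  "dist_fourier T = (\<lambda>\<phi>. T (fourier \<phi>))"

definition dist_inv_fourier :: "'a::euclidean_space distribution \<Rightarrow> 'a distribution" where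
  "dist_inv_fourier T = (\<lambda>\<phi>. T (inv_fourier \<phi>))"

definition dist_mult ::
    "('a::euclidean_space \<Rightarrow> complex) \<Rightarrow> 'a distribution \<Rightarrow> 'a distribution" where
  "dist_mult m T = (\<lambda>\<phi>. T (\<lambda>x. m x * \<phi> x))"


section \<open>Besov spaces defined by Fourier decompositions\<close>

definition LP_generator :: "('a::euclidean_space \<Rightarrow> complex) \<Rightarrow> bool" where
  "LP_generator \<phi>0 \<longleftrightarrow>
     \<phi>0 \<in> Schwartz \<and>
     closure {x. \<phi>0 x \<noteq> 0} \<subseteq> {x. norm x \<le> 2} \<and>
     (\<forall>x. norm x \<le> 1 \<longrightarrow> \<phi>0 x = 1)"

definition LP_function ::
    "('a::euclidean_space \<Rightarrow> complex) \<Rightarrow> nat \<Rightarrow> 'a \<Rightarrow> complex" where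
  "LP_function \<phi>0 j =
     (if j = 0 then \<phi>0
      else (\<lambda>x. \<phi>0 (2 powr (- real j) *\<^sub>R x) - \<phi>0 (2 powr (- real j + 1) *\<^sub>R x)))"

definition LP_block ::
    "('a::euclidean_space \<Rightarrow> complex) \<Rightarrow> nat \<Rightarrow> 'a distribution \<Rightarrow> 'a distribution" where
  "LP_block \<phi>0 j T = dist_inv_fourier (dist_mult (LP_function \<phi>0 j) (dist_fourier T))"

definition Besov_norm ::
    "('a::euclidean_space \<Rightarrow> complex) \<Rightarrow> real \<Rightarrow> ennreal \<Rightarrow> real \<Rightarrow> real \<Rightarrow>
     'a distribution \<Rightarrow> ennreal" where
  "Besov_norm \<phi>0 p q s b T =
     (let a = (\<lambda>j. ennreal (2 powr (real j * s) * (1 + real j) powr b) *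
                    dist_Lp_norm p (LP_block \<phi>0 j T))
      in if q = \<infinity> then (SUP j. a j)
         else ennreal_powr (\<Sum>j. ennreal_powr (a j) (enn2real q)) (1 / enn2real q))"

definition Besov_space ::
    "('a::euclidean_space \<Rightarrow> complex) \<Rightarrow> real \<Rightarrow> ennreal \<Rightarrow> real \<Rightarrow> real \<Rightarrow>
     'a distribution set" where
  "Besov_space \<phi>0 p q s b = {T. tempered_distribution T \<and> Besov_norm \<phi>0 p q s b T < \<infinity>}"

end

theory Submission
  imports Defs "HOL-Probability.Probability" "HOL-Real_Asymp.Real_Asymp"
begin

text \<open>
  Take \<open>f = \<Sum>m. F m\<close>, where \<open>F m\<close> is a multiple of a sum of Gaussian wave packets at the
  frequencies \<open>2 ^ j\<close> in a fixed direction, \<open>j\<close> ranging over a set \<open>J m\<close> of indices with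
  \<open>2 ^ m \<le> j < 2 ^ (m + 1)\<close>, normalised so that \<open>F m\<close> has \<open>L_p\<close> norm about \<open>2 powr (- \<beta> * m)\<close> with
  \<open>\<beta> = b + 1 / q + \<epsilon> / 2\<close>.  Then the modulus of smoothness of \<open>f\<close> at \<open>t\<close> is \<open>O((1 - ln t) powr (- \<beta>))\<close>,
  which is just enough for the difference seminorm with weight \<open>b\<close>.

  For \<open>r = max 2 p\<close>, a sum of \<open>N\<close> unit wave packets can be given \<open>L_p\<close> norm of order \<open>N powr (1 / r)\<close>:
  if \<open>p \<le> 2\<close>, place them at the origin, where almost orthogonality in \<open>L_2\<close> of a Gaussian weight gives
  \<open>N powr (1 / 2)\<close>; if \<open>p > 2\<close>, translate them to be almost disjoint, which gives \<open>N powr (1 / p)\<close>.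
  Each Littlewood--Paley block of \<open>f\<close>, however, sees a single packet only.  Choosing
  \<open>J m\<close> full if \<open>q \<le> r\<close> and a singleton if \<open>q > r\<close> makes the norm of the
  Littlewood--Paley sum infinite.  The blocks are bounded below by duality, testing against conjugate
  wave packets; the Gaussian decay makes the off-diagonal pairings negligible.
\<close>

section \<open>Gaussians\<close>

text \<open>The weight is logarithmic, so scales are grouped doubly exponentially: all
  \<open>j\<close> with \<open>2 ^ m \<le> j < 2 ^ (m + 1)\<close> carry the weight
  \<open>2 powr (b * m)\<close> up to a constant, and differences with step \<open>t\<close> resolve
  \<open>F m\<close> once \<open>2 ^ m\<close> is well below \<open>1 - ln t\<close>. Differences
  thus measure the norm of a whole group, whereas the Littlewood--Paley sum counts its members one
  by one. A group of \<open>N\<close> packets of total norm about 1 has members of norm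
  \<open>N powr (- 1 / r)\<close>, whose \<open>l_q\<close> sum is
  \<open>N powr (1 / q - 1 / r)\<close>. With \<open>N = 2 ^ m\<close> this gain is exactly the
  change from \<open>1 / q\<close> to \<open>1 / r\<close> in the exponent; for \<open>q > r\<close>
  it would be a loss, a single packet is better, and the maximum in the theorem becomes
  \<open>q\<close>. The hypothesis on \<open>b\<close> enters as \<open>\<beta> > 0\<close>, which
  makes the groups summable in \<open>L_p\<close>.

  Gaussians give closed formulas on both sides of the Fourier transform, at the price of tails
  reaching every block. Pairing \<open>f\<close> with a kernel term by term needs summable bounds
  for \<open>F m\<close> against that kernel; Lipschitz regularity of the symbols already gives
  enough decay.\<close>

definition gauss :: "real \<Rightarrow> 'a::euclidean_space \<Rightarrow> real" where
  "gauss s x = exp (- s * (norm x)\<^sup>2)"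

lemma gauss_pos: "gauss s x > 0" by (simp add: gauss_def)

lemma gauss_nonneg: "gauss s x \<ge> 0" by (simp add: gauss_def)

lemma gauss_le_1: "s \<ge> 0 \<Longrightarrow> gauss s x \<le> 1" by (simp add: gauss_def)

lemma gauss_measurable [measurable]: "gauss s \<in> borel_measurable borel"
  unfolding gauss_def by measurable

lemma cis_measurable [measurable]: "cis \<in> borel_measurable borel"
  by (intro borel_measurable_continuous_onI continuous_intros)

lemma gauss_conv_prod:
  "gauss s (x::'a::euclidean_space) = (\<Prod>b\<in>Basis. exp (- s * (x \<bullet> b)\<^sup>2))"
proof -
  have "(norm x)\<^sup>2 = (\<Sum>b\<in>Basis. (x \<bullet> b)\<^sup>2)"
    unfolding power2_norm_eq_inner by (subst euclidean_inner) (simp add: power2_eq_square)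
  then show ?thesis
    by (simp add: gauss_def exp_sum[symmetric] sum_distrib_left sum_negf)
qed

lemma
  fixes f :: "'a::euclidean_space \<Rightarrow> real \<Rightarrow> complex"
  assumes "\<And>b. b \<in> Basis \<Longrightarrow> integrable lborel (f b)"
  shows integrable_lborel_prod: "integrable lborel (\<lambda>x. \<Prod>b\<in>Basis. f b (x \<bullet> b))"
    and integral_lborel_prod: "(LINT x|lborel. (\<Prod>b\<in>Basis. f b (x \<bullet> b))) = (\<Prod>b\<in>Basis. (LINT x|lborel. f b x))"
proof -
  interpret product_sigma_finite "\<lambda>_::'a. lborel :: real measure" ..
  have [measurable]: "f b \<in> borel_measurable borel" if "b \<in> Basis" for b
    using assms[OF that] by auto
  have *: "(\<Prod>b\<in>Basis. f b ((\<Sum>c\<in>Basis. x c *\<^sub>R c) \<bullet> b)) = (\<Prod>b\<in>Basis. f b (x b))" for x :: "'a \<Rightarrow> real"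
    by (intro prod.cong refl) (simp add: inner_sum_left_Basis)
  show "integrable lborel (\<lambda>x. \<Prod>b\<in>Basis. f b (x \<bullet> b))"
    by (subst lborel_eq, subst integrable_distr_eq)
       (auto simp: * intro!: product_integrable_prod assms)
  show "(LINT x|lborel. (\<Prod>b\<in>Basis. f b (x \<bullet> b))) = (\<Prod>b\<in>Basis. (LINT x|lborel. f b x))"
    by (subst lborel_eq, subst integral_distr)
       (auto simp: * intro!: product_integral_prod assms)
qed

lemma integrable_exp_square:
  assumes "s > 0"
  shows "integrable lborel (\<lambda>x::real. exp (- s * x\<^sup>2))"
proof -
  \<comment> \<open>The standard deviation for which the normal density is a multiple of
    \<open>exp (- s * x\<^sup>2)\<close>.\<close>
  define \<sigma> where "\<sigma> = 1 / sqrt (2 * s)"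
  have "\<sigma> > 0" "2 * \<sigma>\<^sup>2 = 1 / s" using assms by (auto simp: \<sigma>_def power_divide)
  then have "(\<lambda>x. exp (- s * x\<^sup>2)) = (\<lambda>x. sqrt (2 * pi * \<sigma>\<^sup>2) * normal_density 0 \<sigma> x)"
    using assms by (auto simp: normal_density_def fun_eq_iff field_simps)
  then show ?thesis using \<open>\<sigma> > 0\<close> by simp
qed

lemma integrable_gauss:
  assumes "s > 0"
  shows "integrable lborel (gauss s :: 'a::euclidean_space \<Rightarrow> real)"
proof -
  have "integrable lborel (\<lambda>x::'a. \<Prod>b\<in>Basis. complex_of_real (exp (- s * (x \<bullet> b)\<^sup>2)))"
    using integrable_exp_square[OF assms]
    by (intro integrable_lborel_prod[where f="\<lambda>_ x. complex_of_real (exp (- s * x\<^sup>2))"])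
       (auto simp del: of_real_exp)
  then have "integrable lborel (\<lambda>x::'a. complex_of_real (gauss s x))"
    unfolding gauss_conv_prod by (simp del: of_real_exp)
  then show ?thesis using complex_of_real_integrable_eq by fast
qed

text \<open>Up to the factor \<open>sqrt (2 * pi)\<close> the left side is the characteristic
  function of the standard normal distribution.\<close>

lemma integral_cis_exp_square:
  "(LINT x|lborel. cis (x * t) * complex_of_real (exp (- (1/2) * x\<^sup>2)))
     = of_real (sqrt (2 * pi) * exp (- (1/2) * t\<^sup>2))"
proof -
  have "(LINT x|lborel. cis (x * t) * complex_of_real (exp (- (1/2) * x\<^sup>2)))
      = (LINT x|lborel. of_real (sqrt (2 * pi)) * (std_normal_density x *\<^sub>R iexp (t * x)))"
    by (intro Bochner_Integration.integral_cong refl)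
       (auto simp: std_normal_density_def cis_conv_exp scaleR_conv_of_real mult_ac)
  also have "\<dots> = of_real (sqrt (2 * pi)) * char std_normal_distribution t"
    unfolding char_def by (subst integral_density) (auto simp del: mult_scaleR_right)
  finally show ?thesis by (simp add: char_std_normal_distribution)
qed

lemma cis_sum: "finite A \<Longrightarrow> cis (sum f A) = (\<Prod>a\<in>A. cis (f a))"
  by (induction A rule: finite_induct) (auto simp: cis_mult[symmetric])

lemma integral_cis_gauss:
  fixes v :: "'a::euclidean_space"
  shows "(LINT x|lborel. cis (x \<bullet> v) * of_real (gauss (1/2) x))
           = of_real ((2 * pi) powr (real DIM('a) / 2) * gauss (1/2) v)"
proof -
  have eq: "cis (x \<bullet> v) * of_real (gauss (1/2) x)
     = (\<Prod>b\<in>Basis. cis ((x \<bullet> b) * (v \<bullet> b)) * complex_of_real (exp (- (1/2) * (x \<bullet> b)\<^sup>2)))" for x :: 'a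
    unfolding gauss_conv_prod prod.distrib of_real_prod
    by (subst euclidean_inner) (simp add: cis_sum)
  have int: "integrable lborel (\<lambda>x. cis (x * t) * complex_of_real (exp (- (1/2) * x\<^sup>2)))" for t
    using integrable_exp_square[of "1/2"]
    by (rule Bochner_Integration.integrable_bound) (auto simp: norm_mult)
  have "(LINT x|lborel. cis (x \<bullet> v) * of_real (gauss (1/2) x))
     = (\<Prod>b\<in>(Basis::'a set). of_real (sqrt (2 * pi) * exp (- (1/2) * (v \<bullet> b)\<^sup>2)))"
    unfolding eq
    by (subst integral_lborel_prod[OF int]) (simp only: integral_cis_exp_square)
  also have "\<dots> = of_real (sqrt (2 * pi) ^ DIM('a) * gauss (1/2) v)"
    unfolding gauss_conv_prod prod.distrib of_real_prod of_real_mult by simp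
  also have "sqrt (2 * pi) ^ DIM('a) = (2 * pi) powr (real DIM('a) / 2)"
    by (simp add: powr_half_sqrt[symmetric] powr_powr powr_realpow[symmetric])
  finally show ?thesis .
qed

section \<open>Translation invariance of integrals\<close>

lemma integrable_lborel_shift:
  fixes f :: "'a::euclidean_space \<Rightarrow> 'b::{banach, second_countable_topology}"
  assumes "integrable lborel f"
  shows "integrable lborel (\<lambda>x. f (x + c))"
proof -
  have "integrable (distr lborel borel ((+) c)) f" by (simp add: lborel_distr_plus assms)
  then show ?thesis by (subst (asm) integrable_distr_eq) (use assms in \<open>auto simp: add.commute\<close>)
qed

lemma integral_lborel_shift:
  fixes f :: "'a::euclidean_space \<Rightarrow> 'b::{banach, second_countable_topology}"
  assumes [measurable]: "f \<in> borel_measurable borel"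
  shows "(LINT x|lborel. f (x + c)) = (LINT x|lborel. f x)"
proof -
  have "(LINT x|lborel. f x) = (LINT x|distr lborel borel ((+) c). f x)"
    by (simp add: lborel_distr_plus)
  also have "\<dots> = (LINT x|lborel. f (c + x))" by (subst integral_distr) auto
  finally show ?thesis by (simp add: add.commute)
qed

lemma nn_integral_lborel_shift:
  fixes f :: "'a::euclidean_space \<Rightarrow> ennreal"
  assumes [measurable]: "f \<in> borel_measurable borel"
  shows "(\<integral>\<^sup>+x. f (x + c) \<partial>lborel) = (\<integral>\<^sup>+x. f x \<partial>lborel)"
proof -
  have "(\<integral>\<^sup>+x. f x \<partial>lborel) = (\<integral>\<^sup>+x. f x \<partial>distr lborel borel ((+) c))"
    by (simp add: lborel_distr_plus)
  also have "\<dots> = (\<integral>\<^sup>+x. f (c + x) \<partial>lborel)" by (subst nn_integral_distr) auto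
  finally show ?thesis by (simp add: add.commute)
qed


section \<open>Minkowski and duality estimates\<close>

text \<open>Jensen's inequality for \<open>x powr p\<close> at the points \<open>u m / A m\<close>
  with weights \<open>A m / S\<close>. If \<open>A m\<close> bounds the norm of \<open>u m\<close>,
  the right side integrates to at most \<open>S powr p\<close>, so this is the pointwise form of
  Minkowski's inequality.\<close>

lemma powr_sum_le_weighted:
  fixes u A :: "'i \<Rightarrow> real"
  assumes "finite M" "M \<noteq> {}" and p: "p \<ge> 1"
    and A: "\<And>m. m \<in> M \<Longrightarrow> A m > 0" and u: "\<And>m. m \<in> M \<Longrightarrow> u m \<ge> 0"
  defines "S \<equiv> sum A M"
  shows "(\<Sum>m\<in>M. u m) powr p \<le> (\<Sum>m\<in>M. S powr p * (A m / S) * A m powr (-p) * u m powr p)"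
proof -
  have S: "S > 0" unfolding S_def using assms(1,2) A by (intro sum_pos) auto
  have conv: "convex_on {0..} (\<lambda>x::real. x powr p)"
  proof (rule convex_onI)
    fix t x y :: real assume t: "0 < t" "t < 1" and xy: "x \<in> {0..}" "y \<in> {0..}"
    show "((1 - t) *\<^sub>R x + t *\<^sub>R y) powr p \<le> (1 - t) * x powr p + t * y powr p"
    proof (cases "x = 0 \<or> y = 0")
      case True
      \<comment> \<open>With an endpoint at 0, convexity reduces to this bound for the remaining
        factor \<open>t\<close> or \<open>1 - t\<close>.\<close>
      have "s powr p \<le> s" if "0 < s" "s < 1" for s :: real
        using powr_mono'[of 1 p s] p that by simp
      from this[of t] this[of "1 - t"] show ?thesis
        using True t xy by (auto simp: powr_mult mult_right_mono)
    next
      case False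
      then show ?thesis using powr_convex[OF p] xy t
        unfolding convex_on_def by (auto simp: less_le)
    qed
  qed simp
  have "(\<Sum>m\<in>M. u m) = S * (\<Sum>m\<in>M. (A m / S) *\<^sub>R (u m / A m))"
    unfolding sum_distrib_left using S A by (intro sum.cong) (force simp: field_simps)+
  also have "\<dots> powr p = S powr p * (\<Sum>m\<in>M. (A m / S) *\<^sub>R (u m / A m)) powr p"
    by (rule powr_mult)
  also have "\<dots> \<le> S powr p * (\<Sum>m\<in>M. (A m / S) * (u m / A m) powr p)"
  proof (intro mult_left_mono)
    have "(\<Sum>m\<in>M. A m / S) = 1"
      using S by (simp add: S_def sum_divide_distrib[symmetric])
    then show "(\<Sum>m\<in>M. (A m / S) *\<^sub>R (u m / A m)) powr p \<le> (\<Sum>m\<in>M. (A m / S) * (u m / A m) powr p)"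
      using convex_on_sum[OF assms(1,2) conv, of "\<lambda>m. A m / S" "\<lambda>m. u m / A m"] S A u
      by (auto simp: less_imp_le)
  qed auto
  also have "\<dots> = (\<Sum>m\<in>M. S powr p * (A m / S) * A m powr (-p) * u m powr p)"
    unfolding sum_distrib_left using A u
    by (intro sum.cong refl) (auto simp: powr_divide powr_minus field_simps less_imp_le)
  finally show ?thesis .
qed

lemma nn_Minkowski_sum:
  fixes u :: "'i \<Rightarrow> 'a \<Rightarrow> real" and A :: "'i \<Rightarrow> real"
  assumes "finite M" and p: "p \<ge> 1"
    and A: "\<And>m. m \<in> M \<Longrightarrow> A m > 0" and u: "\<And>m x. m \<in> M \<Longrightarrow> u m x \<ge> 0"
    and meas: "\<And>m. m \<in> M \<Longrightarrow> u m \<in> borel_measurable N"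
    and int: "\<And>m. m \<in> M \<Longrightarrow> (\<integral>\<^sup>+x. ennreal (u m x powr p) \<partial>N) \<le> ennreal (A m powr p)"
  shows "(\<integral>\<^sup>+x. ennreal ((\<Sum>m\<in>M. u m x) powr p) \<partial>N) \<le> ennreal (sum A M powr p)"
proof (cases "M = {}")
  case False
  define S where "S = sum A M"
  have S: "S > 0" unfolding S_def using assms False by (intro sum_pos) auto
  define c where "c m = S powr p * (A m / S) * A m powr (-p)" for m
  have c: "c m \<ge> 0" if "m \<in> M" for m
    unfolding c_def using A[OF that] S by simp
  have "(\<integral>\<^sup>+x. ennreal ((\<Sum>m\<in>M. u m x) powr p) \<partial>N)
      \<le> (\<integral>\<^sup>+x. (\<Sum>m\<in>M. ennreal (c m) * ennreal (u m x powr p)) \<partial>N)"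
  proof (intro nn_integral_mono)
    fix x
    have "(\<Sum>m\<in>M. u m x) powr p \<le> (\<Sum>m\<in>M. c m * u m x powr p)"
      using powr_sum_le_weighted[OF assms(1) False p, of A "\<lambda>m. u m x"] A u
      unfolding c_def S_def by blast
    then have "ennreal ((\<Sum>m\<in>M. u m x) powr p) \<le> ennreal (\<Sum>m\<in>M. c m * u m x powr p)"
      by (rule ennreal_leI)
    also have "\<dots> = (\<Sum>m\<in>M. ennreal (c m) * ennreal (u m x powr p))"
      using c by (subst sum_ennreal[symmetric]) (auto simp: ennreal_mult intro!: sum.cong)
    finally show "ennreal ((\<Sum>m\<in>M. u m x) powr p) \<le> (\<Sum>m\<in>M. ennreal (c m) * ennreal (u m x powr p))" .
  qed
  also have "\<dots> = (\<Sum>m\<in>M. ennreal (c m) * (\<integral>\<^sup>+x. ennreal (u m x powr p) \<partial>N))"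
    using meas by (subst nn_integral_sum) (auto simp: nn_integral_cmult)
  also have "\<dots> \<le> (\<Sum>m\<in>M. ennreal (c m) * ennreal (A m powr p))"
    using int by (intro sum_mono mult_left_mono) auto
  also have "\<dots> = ennreal (\<Sum>m\<in>M. c m * A m powr p)"
    using c by (subst sum_ennreal[symmetric]) (auto simp: ennreal_mult intro!: sum.cong)
  also have "(\<Sum>m\<in>M. c m * A m powr p) = (\<Sum>m\<in>M. S powr p * (A m / S))"
    using A by (intro sum.cong refl) (force simp: c_def powr_minus)
  also have "\<dots> = S powr p"
    using S by (simp add: S_def sum_divide_distrib[symmetric] sum_distrib_left[symmetric])
  finally show ?thesis by (simp add: S_def)
qed simp

text \<open>Replaces an extended series by a supremum of partial sums, to which monotone convergence
  applies. If the series diverges, some partial sum already reaches \<open>v\<close>.\<close>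

lemma le_SUP_partial_sums_powr:
  fixes u :: "nat \<Rightarrow> real"
  assumes u: "\<And>m. u m \<ge> 0" and v: "v \<ge> 0" "ennreal v \<le> (\<Sum>m. ennreal (u m))" and p: "p > 0"
  shows "ennreal (v powr p) \<le> (SUP n. ennreal ((\<Sum>m<n. u m) powr p))"
proof (cases "summable u")
  case True
  then have "v \<le> suminf u"
    using v u by (simp add: suminf_ennreal2 suminf_nonneg)
  have "(\<lambda>n. ennreal ((\<Sum>m<n. u m) powr p)) \<longlonglongrightarrow> ennreal (suminf u powr p)"
    using p by (intro tendsto_ennrealI tendsto_powr' summable_LIMSEQ True tendsto_const)
       (auto intro!: always_eventually sum_nonneg u)
  then have "ennreal (suminf u powr p) \<le> (SUP n. ennreal ((\<Sum>m<n. u m) powr p))"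
    by (rule LIMSEQ_le_const2) (auto intro!: SUP_upper)
  then show ?thesis
    using \<open>v \<le> suminf u\<close> v p by (meson ennreal_leI order_trans powr_mono2 less_imp_le)
next
  case False
  have "\<exists>n. (\<Sum>m<n. u m) \<ge> v"
    using summableI_nonneg_bounded[of u v] u False by (metis linear)
  then obtain n where "(\<Sum>m<n. u m) \<ge> v" ..
  then have "ennreal (v powr p) \<le> ennreal ((\<Sum>m<n. u m) powr p)"
    using v p by (intro ennreal_leI powr_mono2) auto
  then show ?thesis by (meson SUP_upper2 UNIV_I)
qed

text \<open>Monotone convergence applied to the finite inequality. Any \<open>v\<close> dominated by
  the series is allowed, so that one statement serves for \<open>cmod (f x)\<close> and for
  \<open>cmod (f (x + h) - f x)\<close>; finiteness of the supremum also gives convergence almost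
  everywhere.\<close>

lemma nn_Minkowski_suminf:
  fixes u :: "nat \<Rightarrow> 'a \<Rightarrow> real" and A :: "nat \<Rightarrow> real"
  assumes p: "p \<ge> 1" and S: "\<And>n. sum A {..<n} \<le> S"
    and A: "\<And>m. A m > 0" and u: "\<And>m x. u m x \<ge> 0"
    and meas [measurable]: "\<And>m. u m \<in> borel_measurable N"
    and int: "\<And>m. (\<integral>\<^sup>+x. ennreal (u m x powr p) \<partial>N) \<le> ennreal (A m powr p)"
  shows nn_Minkowski_suminf_le:
        "\<And>v. (\<And>x. v x \<ge> 0) \<Longrightarrow> AE x in N. ennreal (v x) \<le> (\<Sum>m. ennreal (u m x)) \<Longrightarrow>
           (\<integral>\<^sup>+x. ennreal (v x powr p) \<partial>N) \<le> ennreal (S powr p)"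
    and nn_Minkowski_AE_summable: "AE x in N. summable (\<lambda>m. u m x)"
proof -
  define w where "w x = (SUP n. ennreal ((\<Sum>m<n. u m x) powr p))" for x
  have [measurable]: "w \<in> borel_measurable N" unfolding w_def by measurable
  have "(\<integral>\<^sup>+x. w x \<partial>N) = (SUP n. \<integral>\<^sup>+x. ennreal ((\<Sum>m<n. u m x) powr p) \<partial>N)"
    unfolding w_def
  proof (rule nn_integral_monotone_convergence_SUP)
    show "incseq (\<lambda>n x. ennreal ((\<Sum>m<n. u m x) powr p))"
      using u p by (intro incseq_SucI le_funI ennreal_leI powr_mono2) (auto intro!: sum_nonneg)
  qed measurable
  also have "\<dots> \<le> ennreal (S powr p)"
  proof (rule SUP_least)
    fix n
    have "(\<integral>\<^sup>+x. ennreal ((\<Sum>m<n. u m x) powr p) \<partial>N) \<le> ennreal (sum A {..<n} powr p)"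
      using assms by (intro nn_Minkowski_sum) auto
    also have "\<dots> \<le> ennreal (S powr p)"
      using S[of n] A p by (intro ennreal_leI powr_mono2 sum_nonneg) (auto simp: less_imp_le)
    finally show "(\<integral>\<^sup>+x. ennreal ((\<Sum>m<n. u m x) powr p) \<partial>N) \<le> ennreal (S powr p)" .
  qed
  finally have w: "(\<integral>\<^sup>+x. w x \<partial>N) \<le> ennreal (S powr p)" .
  show "(\<integral>\<^sup>+x. ennreal (v x powr p) \<partial>N) \<le> ennreal (S powr p)"
    if "\<And>x. v x \<ge> 0" "AE x in N. ennreal (v x) \<le> (\<Sum>m. ennreal (u m x))" for v
  proof -
    have "(\<integral>\<^sup>+x. ennreal (v x powr p) \<partial>N) \<le> (\<integral>\<^sup>+x. w x \<partial>N)"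
      using that(2) unfolding w_def
      by (intro nn_integral_mono_AE)
         (auto elim!: eventually_mono intro!: le_SUP_partial_sums_powr u that(1) less_le_trans[OF _ p])
    with w show ?thesis by simp
  qed
  have "(\<integral>\<^sup>+x. w x \<partial>N) \<noteq> \<infinity>" using w by (auto simp: top_unique)
  then have "AE x in N. w x \<noteq> \<infinity>" by (intro nn_integral_PInf_AE) auto
  then show "AE x in N. summable (\<lambda>m. u m x)"
  proof (rule eventually_mono)
    fix x assume "w x \<noteq> \<infinity>"
    then obtain B where B: "w x = ennreal B" "B \<ge> 0" by (cases "w x") auto
    have "(\<Sum>m<n. u m x) \<le> B powr (1 / p)" for n
    proof -
      have "ennreal ((\<Sum>m<n. u m x) powr p) \<le> w x" unfolding w_def by (intro SUP_upper) auto
      then have "(\<Sum>m<n. u m x) powr p \<le> B" using B by simp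
      then have "((\<Sum>m<n. u m x) powr p) powr (1 / p) \<le> B powr (1/p)"
        using p by (intro powr_mono2) auto
      then show ?thesis using p u by (simp add: powr_powr sum_nonneg)
    qed
    then show "summable (\<lambda>m. u m x)" using u by (intro summableI_nonneg_bounded)
  qed
qed

lemma Lp_norm_le:
  assumes "p > 0" "S \<ge> 0" "(\<integral>\<^sup>+x. ennreal (cmod (f x) powr p) \<partial>lborel) \<le> ennreal (S powr p)"
  shows "Lp_norm p f \<le> ennreal S"
proof -
  let ?I = "\<integral>\<^sup>+x. ennreal (cmod (f x) powr p) \<partial>lborel"
  have fin: "?I \<noteq> \<infinity>" using assms(3) by (auto simp: top_unique)
  have "enn2real ?I \<le> S powr p" using assms(3) by (simp add: enn2real_leI)
  then have "enn2real ?I powr (1 / p) \<le> (S powr p) powr (1 / p)"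
    using assms by (intro powr_mono2) auto
  then show ?thesis using assms fin
    by (auto simp: Lp_norm_def ennreal_powr_def powr_powr intro!: ennreal_leI)
qed

text \<open>Duality by truncation in place of Hoelder's inequality:
  \<open>cmod (g x * \<eta> x)\<close> is at most \<open>l * cmod (\<eta> x)\<close> where
  \<open>cmod (g x) \<le> l\<close>, and at most \<open>l powr (1 - p) * cmod (g x) powr p\<close>
  elsewhere. A norm below \<open>l\<close> makes the integral at most \<open>l * (1 + E)\<close>,
  which explains the denominator.\<close>

lemma Lp_norm_ge:
  fixes g \<eta> :: "'a::euclidean_space \<Rightarrow> complex"
  assumes p: "p > 1" and [measurable]: "g \<in> borel_measurable borel"
    and \<eta>: "\<And>x. cmod (\<eta> x) \<le> 1" "integrable lborel \<eta>"
    and int: "integrable lborel (\<lambda>x. g x * \<eta> x)"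
    and \<kappa>: "\<kappa> \<ge> 0" "\<kappa> \<le> cmod (LINT x|lborel. g x * \<eta> x)"
  shows "ennreal (\<kappa> / (1 + (LINT x|lborel. cmod (\<eta> x)))) \<le> Lp_norm p g"
proof (rule ccontr)
  define E where "E = (LINT x|lborel. cmod (\<eta> x))"
  have E: "E \<ge> 0" unfolding E_def by simp
  assume "\<not> ?thesis"
  then have less: "Lp_norm p g < ennreal (\<kappa> / (1 + E))" by (simp add: E_def)
  define X where "X = enn2real (\<integral>\<^sup>+x. ennreal (cmod (g x) powr p) \<partial>lborel)"
  have fin: "(\<integral>\<^sup>+x. ennreal (cmod (g x) powr p) \<partial>lborel) \<noteq> \<infinity>"
    using less by (auto simp: Lp_norm_def ennreal_powr_def split: if_splits)
  then have N: "Lp_norm p g = ennreal (X powr (1 / p))"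
    by (simp add: Lp_norm_def ennreal_powr_def X_def)
  with less have "X powr (1 / p) < \<kappa> / (1 + E)" by (simp add: ennreal_less_iff)
  \<comment> \<open>A level strictly above the norm is positive even if \<open>g\<close> vanishes
    almost everywhere.\<close>
  then obtain l where l: "X powr (1 / p) < l" "l < \<kappa> / (1 + E)" using dense by blast
  have l0: "l > 0" using l(1) by (meson le_less_trans powr_ge_zero)
  have X0: "X \<ge> 0" by (simp add: X_def)
  have "X = (X powr (1 / p)) powr p" using p X0 by (simp add: powr_powr)
  also have "\<dots> \<le> l powr p" using l p by (intro powr_mono2) auto
  finally have Xl: "X \<le> l powr p" .
  have intg: "integrable lborel (\<lambda>x. cmod (g x) powr p)"
    using fin by (intro integrableI_nonneg) (auto simp: less_top)
  have Xeq: "X = (LINT x|lborel. cmod (g x) powr p)"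
    unfolding X_def by (subst integral_eq_nn_integral) auto
  have pw: "cmod (g x * \<eta> x) \<le> l * cmod (\<eta> x) + l powr (1 - p) * cmod (g x) powr p" for x
  proof -
    have "cmod (g x) * cmod (\<eta> x) \<le> l * cmod (\<eta> x) + l powr (1 - p) * cmod (g x) powr p"
    proof (cases "cmod (g x) \<le> l")
      case True
      then show ?thesis
        by (intro order_trans[OF mult_right_mono[of "cmod (g x)" l]]) auto
    next
      case False
      have "cmod (g x) = l powr (1 - p) * l powr (p - 1) * cmod (g x)"
        using l0 by (simp add: powr_add[symmetric])
      also have "\<dots> \<le> l powr (1 - p) * cmod (g x) powr (p - 1) * cmod (g x)"
        using False l0 p by (intro mult_right_mono mult_left_mono powr_mono2) auto
      also have "\<dots> = l powr (1 - p) * cmod (g x) powr p"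
        using False l0 by (simp add: powr_diff)
      finally have "cmod (g x) \<le> l powr (1 - p) * cmod (g x) powr p" .
      moreover have "cmod (g x) * cmod (\<eta> x) \<le> cmod (g x)"
        using \<eta>(1)[of x] by (simp add: mult_left_le)
      moreover have "0 \<le> l * cmod (\<eta> x)" using l0 by simp
      ultimately show ?thesis by linarith
    qed
    then show ?thesis by (simp add: norm_mult)
  qed
  have "\<kappa> \<le> (LINT x|lborel. cmod (g x * \<eta> x))"
    using \<kappa>(2) integral_norm_bound[of lborel "\<lambda>x. g x * \<eta> x"] by linarith
  also have "\<dots> \<le> (LINT x|lborel. l * cmod (\<eta> x) + l powr (1 - p) * cmod (g x) powr p)"
    using int \<eta>(2) intg pw by (intro integral_mono) auto
  also have "\<dots> = l * E + l powr (1 - p) * X"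
    using \<eta>(2) intg by (simp add: E_def Xeq)
  also have "\<dots> \<le> l * E + l powr (1 - p) * l powr p"
    using Xl by (intro add_left_mono mult_left_mono) auto
  also have "\<dots> = l * (1 + E)" using l0 by (simp add: powr_add[symmetric] algebra_simps)
  also have "\<dots> < \<kappa>" using l(2) E by (simp add: field_simps)
  finally show False by simp
qed

section \<open>Iterated differences in \<open>L_p\<close>\<close>

lemma iter_diff_measurable [measurable]:
  "f \<in> borel_measurable borel \<Longrightarrow> iter_diff k h f \<in> borel_measurable borel"
  by (induction k) auto

lemma diff_Lp_le:
  fixes f :: "'a::euclidean_space \<Rightarrow> complex"
  assumes [measurable]: "f \<in> borel_measurable borel" and p: "p \<ge> 1" and W: "W > 0"
    and int: "(\<integral>\<^sup>+x. ennreal (cmod (f x) powr p) \<partial>lborel) \<le> ennreal (W powr p)"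
  shows "(\<integral>\<^sup>+x. ennreal (cmod (f (x + h) - f x) powr p) \<partial>lborel) \<le> ennreal ((2 * W) powr p)"
proof -
  define u where "u i x = cmod (f (if i = (0::nat) then x else x + h))" for i x
  have [measurable]: "u i \<in> borel_measurable borel" for i
    unfolding u_def by (cases "i = 0") auto
  have ui: "(\<integral>\<^sup>+x. ennreal (u i x powr p) \<partial>lborel) \<le> ennreal (W powr p)" for i
  proof (cases "i = 0")
    case False
    have "(\<integral>\<^sup>+x. ennreal (u i x powr p) \<partial>lborel) = (\<integral>\<^sup>+x. ennreal (cmod (f x) powr p) \<partial>lborel)"
      using False unfolding u_def by (subst nn_integral_lborel_shift[symmetric, where c = h]) auto
    then show ?thesis using int by simp
  qed (use int in \<open>simp add: u_def\<close>)
  have "(\<integral>\<^sup>+x. ennreal (cmod (f (x + h) - f x) powr p) \<partial>lborel)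
      \<le> (\<integral>\<^sup>+x. ennreal ((\<Sum>i\<in>{0,1}. u i x) powr p) \<partial>lborel)"
    using p unfolding u_def
    by (intro nn_integral_mono ennreal_leI powr_mono2)
       (auto simp: add.commute intro!: order_trans[OF norm_triangle_ineq4])
  also have "\<dots> \<le> ennreal ((\<Sum>i\<in>{0,1::nat}. W) powr p)"
    using W p ui by (intro nn_Minkowski_sum) (auto simp: u_def)
  finally show ?thesis by simp
qed

text \<open>Every further difference at most doubles the norm, so smoothness is exploited in the
  first difference only and all orders \<open>k \<ge> 1\<close> follow.\<close>

lemma iter_diff_Lp_le:
  fixes f :: "'a::euclidean_space \<Rightarrow> complex"
  assumes [measurable]: "f \<in> borel_measurable borel" and p: "p \<ge> 1" and W: "W > 0"
    and int: "(\<integral>\<^sup>+x. ennreal (cmod (f (x + h) - f x) powr p) \<partial>lborel) \<le> ennreal (W powr p)"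
  shows "(\<integral>\<^sup>+x. ennreal (cmod (iter_diff (Suc k) h f x) powr p) \<partial>lborel) \<le> ennreal ((2 ^ k * W) powr p)"
proof (induction k)
  case 0
  then show ?case using int by simp
next
  case (Suc k)
  have "2 ^ k * W > 0" using W by simp
  from diff_Lp_le[OF iter_diff_measurable p this Suc, of h]
  show ?case by (simp add: mult.assoc iter_diff.simps(2)[of "Suc k"] del: iter_diff.simps)
qed


section \<open>Modulated Gaussians\<close>

text \<open>Parallelogram law for \<open>x - a\<close> and \<open>x - b\<close>. The factor in front
  is what later makes packets of different frequency almost orthogonal to the tests.\<close>

lemma gauss_mult:
  fixes x :: "'a::euclidean_space"
  shows "gauss (1/2) (x - a) * gauss (1/2) (x - b) = exp (- (norm (a - b))\<^sup>2 / 4) * gauss 1 (x - (a + b) /\<^sub>R 2)"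
proof -
  have "(norm (x - a))\<^sup>2 / 2 + (norm (x - b))\<^sup>2 / 2 = (norm (a - b))\<^sup>2 / 4 + (norm (x - (a + b) /\<^sub>R 2))\<^sup>2"
    unfolding power2_norm_eq_inner
    by (simp add: inner_diff_left inner_diff_right inner_add_left inner_add_right inner_commute field_simps)
  then show ?thesis unfolding gauss_def mult_exp_exp by simp
qed

lemma norm_cis_diff_one_le: "cmod (cis t - 1) \<le> \<bar>t\<bar>"
  using iexp_approx1[of t 0] by (simp add: cis_conv_exp)

lemma gauss_shift_le:
  fixes x h :: "'a::euclidean_space"
  assumes "norm h \<le> 1"
  shows "gauss (1/2) (x + h) \<le> exp (1/2) * gauss (1/4) x"
proof -
  have "norm x \<le> norm (x + h) + norm h"
    by (metis add_diff_cancel norm_triangle_ineq4)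
  then have "(norm x)\<^sup>2 \<le> (norm (x + h) + norm h)\<^sup>2" by (intro power_mono) auto
  also have "\<dots> \<le> 2 * (norm (x + h))\<^sup>2 + 2 * (norm h)\<^sup>2"
    using sum_squares_bound[of "norm (x+h)" "norm h"] by (simp add: power2_sum)
  also have "\<dots> \<le> 2 * (norm (x + h))\<^sup>2 + 2"
    using assms by (simp add: power_le_one)
  finally show ?thesis unfolding gauss_def mult_exp_exp by simp
qed

lemma abs_exp_diff_le:
  fixes a b :: real
  shows "\<bar>exp a - exp b\<bar> \<le> \<bar>a - b\<bar> * max (exp a) (exp b)"
proof -
  have *: "exp y - exp z \<le> (y - z) * exp y" for y z :: real
  proof -
    have "exp y * (1 + (z - y)) \<le> exp y * exp (z - y)"
      by (intro mult_left_mono exp_ge_add_one_self) auto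
    then show ?thesis by (simp add: mult_exp_exp algebra_simps)
  qed
  show ?thesis
  proof (cases "a \<ge> b")
    case True
    then have "exp a \<ge> exp b" by simp
    then show ?thesis using *[of a b] True by simp
  next
    case False
    then have "exp b \<ge> exp a" by simp
    then show ?thesis using *[of b a] False by (simp add: max_def)
  qed
qed

lemma norm_mult_gauss_le:
  fixes x :: "'a::euclidean_space"
  shows "(norm x + 1/2) * gauss (1/8) x \<le> 3"
proof -
  \<comment> \<open>The minimum of \<open>3 / 8 * r\<^sup>2 - r\<close> is at
    \<open>r = 4 / 3\<close> with value \<open>- 2 / 3\<close>, well above the required
    \<open>- 5 / 2\<close>.\<close>
  have "0 \<le> 3 / 8 * (norm x - 4/3)\<^sup>2" by simp
  then have "norm x + 1/2 \<le> 3 * (1 + (norm x)\<^sup>2 / 8)"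
    by (simp add: power2_diff power_divide algebra_simps)
  also have "\<dots> \<le> 3 * exp ((norm x)\<^sup>2 / 8)"
    by (intro mult_left_mono exp_ge_add_one_self) auto
  finally have "(norm x + 1/2) * gauss (1/8) x \<le> (3 * exp ((norm x)\<^sup>2 / 8)) * gauss (1/8) x"
    by (intro mult_right_mono gauss_nonneg)
  also have "\<dots> = 3" by (simp add: gauss_def mult_exp_exp)
  finally show ?thesis .
qed

text \<open>The exponent is halved twice: from 1/2 to 1/4 to compare \<open>x + h\<close> with
  \<open>x\<close>, and then to 1/8 to absorb the factor \<open>norm x + 1/2\<close> from the
  difference of the exponents.\<close>

lemma gauss_diff_le:
  fixes x h :: "'a::euclidean_space"
  assumes h: "norm h \<le> 1"
  shows "\<bar>gauss (1/2) (x + h) - gauss (1/2) x\<bar> \<le> 3 * exp (1/2) * norm h * gauss (1/8) x"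
proof -
  let ?A = "- (1/2) * (norm (x + h))\<^sup>2" and ?B = "- (1/2) * (norm x)\<^sup>2"
  have "\<bar>?A - ?B\<bar> = \<bar>x \<bullet> h + (norm h)\<^sup>2 / 2\<bar>"
  proof -
    have "?A - ?B = - (x \<bullet> h + (norm h)\<^sup>2 / 2)"
      unfolding power2_norm_eq_inner by (simp add: inner_add_left inner_add_right inner_commute field_simps)
    then show ?thesis by simp
  qed
  also have "\<dots> \<le> norm x * norm h + (norm h)\<^sup>2 / 2"
    using Cauchy_Schwarz_ineq2[of x h] by (intro order_trans[OF abs_triangle_ineq]) auto
  also have "\<dots> \<le> norm h * (norm x + 1/2)"
    using mult_left_le[OF h, of "norm h"] by (simp add: power2_eq_square algebra_simps)
  finally have AB: "\<bar>?A - ?B\<bar> \<le> norm h * (norm x + 1/2)" .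
  have M: "max (exp ?A) (exp ?B) \<le> exp (1/2) * gauss (1/4) x"
    using gauss_shift_le[OF h, of x] gauss_shift_le[of 0 x] by (simp add: gauss_def)
  have "\<bar>gauss (1/2) (x + h) - gauss (1/2) x\<bar> \<le> (norm h * (norm x + 1/2)) * (exp (1/2) * gauss (1/4) x)"
    unfolding gauss_def[of "1/2"]
    by (rule order_trans[OF abs_exp_diff_le mult_mono[OF AB M]]) (auto simp: max_def)
  also have "\<dots> = exp (1/2) * norm h * ((norm x + 1/2) * gauss (1/8) x) * gauss (1/8) x"
    by (simp add: gauss_def mult_exp_exp)
  also have "\<dots> \<le> exp (1/2) * norm h * 3 * gauss (1/8) x"
    by (intro mult_right_mono mult_left_mono norm_mult_gauss_le) (auto simp: gauss_nonneg)
  finally show ?thesis by (simp add: mult_ac)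
qed

text \<open>A wave packet of frequency \<open>w\<close> at position \<open>c\<close>. With the
  exponent 1/2 its Fourier transform is again a packet, the two roles exchanged up to sign and a
  unimodular constant.\<close>

definition mgauss :: "'a::euclidean_space \<Rightarrow> 'a \<Rightarrow> 'a \<Rightarrow> complex" where
  "mgauss w c x = cis (w \<bullet> x) * of_real (gauss (1/2) (x - c))"

lemma norm_mgauss [simp]: "cmod (mgauss w c x) = gauss (1/2) (x - c)"
  by (simp add: mgauss_def norm_mult gauss_nonneg)

lemma mgauss_measurable [measurable]: "mgauss w c \<in> borel_measurable borel"
  unfolding mgauss_def by measurable

lemma integrable_gauss_shift [simp]:
  "s > 0 \<Longrightarrow> integrable lborel (\<lambda>x::'a::euclidean_space. gauss s (x - c))"
  using integrable_lborel_shift[OF integrable_gauss, of s "- c"] by simp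

lemma integral_gauss_shift [simp]:
  "(LINT x::'a::euclidean_space|lborel. gauss s (x - c)) = (LINT x::'a|lborel. gauss s x)"
  using integral_lborel_shift[of "gauss s" "- c"] by simp

lemma integrable_mgauss [simp]: "integrable lborel (mgauss w c)"
  by (rule Bochner_Integration.integrable_bound[OF integrable_gauss_shift[of "1/2" c]]) auto

text \<open>Modulation and envelope are varied separately; \<open>norm w\<close> comes from the
  modulation and becomes the factor \<open>2 ^ j\<close> for dyadic packets.\<close>

lemma mgauss_diff_le:
  assumes h: "norm h \<le> 1"
  shows "cmod (mgauss w c (x + h) - mgauss w c x) \<le> 3 * exp (1/2) * (1 + norm w) * norm h * gauss (1/8) (x - c)"
proof -
  let ?z = "x - c"
  have "mgauss w c (x + h) - mgauss w c x
      = cis (w \<bullet> x) * ((cis (w \<bullet> h) - 1) * of_real (gauss (1/2) (?z + h)) + of_real (gauss (1/2) (?z + h) - gauss (1/2) ?z))"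
    by (simp add: mgauss_def inner_add_right cis_mult[symmetric] algebra_simps)
  then have "cmod (mgauss w c (x + h) - mgauss w c x)
      \<le> cmod (cis (w \<bullet> h) - 1) * gauss (1/2) (?z + h) + \<bar>gauss (1/2) (?z + h) - gauss (1/2) ?z\<bar>"
    by (simp only: norm_mult norm_cis mult_1)
       (rule order_trans[OF norm_triangle_ineq], simp add: norm_mult gauss_nonneg del: of_real_diff)
  also have "\<dots> \<le> (norm w * norm h) * (exp (1/2) * gauss (1/8) ?z) + 3 * exp (1/2) * norm h * gauss (1/8) ?z"
  proof (intro add_mono mult_mono gauss_diff_le h)
    show "cmod (cis (w \<bullet> h) - 1) \<le> norm w * norm h"
      using norm_cis_diff_one_le Cauchy_Schwarz_ineq2 order_trans by blast
    have "gauss (1/4) ?z \<le> gauss (1/8) ?z" by (simp add: gauss_def)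
    then show "gauss (1/2) (?z + h) \<le> exp (1/2) * gauss (1/8) ?z"
      by (intro order_trans[OF gauss_shift_le[OF h]]) auto
  qed (auto simp: gauss_nonneg)
  also have "\<dots> \<le> 3 * exp (1/2) * (1 + norm w) * norm h * gauss (1/8) ?z"
  proof -
    have "0 \<le> 2 * (exp (1/2) * norm w * norm h * gauss (1/8) ?z)" by (simp add: gauss_nonneg)
    then show ?thesis by (simp add: algebra_simps)
  qed
  finally show ?thesis .
qed

text \<open>One computation for both transforms: \<open>v = - \<xi>\<close> gives the Fourier
  transform, frequency \<open>- w\<close> the inverse one. Translating by \<open>c\<close> reduces
  it to the Gaussian, which this normalisation leaves fixed.\<close>

lemma integral_cis_mgauss:
  fixes v w c :: "'a::euclidean_space"
  shows "of_real ((2 * pi) powr (- real DIM('a) / 2)) * (LINT x|lborel. cis (v \<bullet> x) * mgauss w c x)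
           = cis (c \<bullet> (v + w)) * of_real (gauss (1/2) (v + w))"
proof -
  have "(LINT x|lborel. cis (v \<bullet> x) * mgauss w c x)
      = (LINT x|lborel. cis (v \<bullet> (x + c)) * mgauss w c (x + c))"
    by (subst integral_lborel_shift) auto
  also have "\<dots> = (LINT x|lborel. cis (c \<bullet> (v + w)) * (cis (x \<bullet> (v + w)) * of_real (gauss (1/2) x)))"
    by (intro Bochner_Integration.integral_cong refl)
       (simp add: mgauss_def cis_mult inner_add_right inner_add_left inner_commute algebra_simps)
  also have "\<dots> = cis (c \<bullet> (v + w)) * of_real ((2 * pi) powr (real DIM('a) / 2) * gauss (1/2) (v + w))"
    by (simp only: integral_mult_right_zero integral_cis_gauss)
  finally show ?thesis
    by (simp add: powr_minus flip: of_real_mult of_real_inverse)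
qed

lemma fourier_mgauss:
  "fourier (mgauss w c) \<xi> = cis (c \<bullet> (w - \<xi>)) * of_real (gauss (1/2) (\<xi> - w))"
  using integral_cis_mgauss[of "- \<xi>" w c]
  by (simp add: fourier_def inner_commute gauss_def norm_minus_commute)

lemma inv_fourier_mgauss:
  "inv_fourier (mgauss (- w) c) = (\<lambda>\<xi>. cis (c \<bullet> (\<xi> - w)) * of_real (gauss (1/2) (\<xi> - w)))"
  using integral_cis_mgauss[of _ "- w" c]
  by (simp add: inv_fourier_def inner_commute fun_eq_iff)

section \<open>Wave packets are Schwartz functions\<close>

inductive polyfun :: "('a::euclidean_space \<Rightarrow> complex) \<Rightarrow> bool" where
  const: "polyfun (\<lambda>_. a)"
| inner: "polyfun (\<lambda>x. of_real (x \<bullet> v))"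
| add: "polyfun f \<Longrightarrow> polyfun g \<Longrightarrow> polyfun (\<lambda>x. f x + g x)"
| mult: "polyfun f \<Longrightarrow> polyfun g \<Longrightarrow> polyfun (\<lambda>x. f x * g x)"

lemma polyfun_has_derivative:
  "polyfun f \<Longrightarrow> \<exists>D. (\<forall>x. (f has_derivative D x) (at x)) \<and> (\<forall>v. polyfun (\<lambda>x. D x v))"
proof (induction rule: polyfun.induct)
  case (const a)
  then show ?case
    by (intro exI[of _ "\<lambda>_ _. 0"]) (auto intro: polyfun.const)
next
  case (inner v)
  then show ?case
    by (intro exI[of _ "\<lambda>_ w. of_real (w \<bullet> v)"])
       (auto intro!: polyfun.const derivative_eq_intros)
next
  case (add f g)
  then obtain D E where "\<And>x. (f has_derivative D x) (at x)" "\<And>v. polyfun (\<lambda>x. D x v)"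
      "\<And>x. (g has_derivative E x) (at x)" "\<And>v. polyfun (\<lambda>x. E x v)" by blast
  then show ?case
    by (intro exI[of _ "\<lambda>x w. D x w + E x w"])
       (auto intro!: polyfun.add derivative_intros)
next
  case (mult f g)
  then obtain D E where "\<And>x. (f has_derivative D x) (at x)" "\<And>v. polyfun (\<lambda>x. D x v)"
      "\<And>x. (g has_derivative E x) (at x)" "\<And>v. polyfun (\<lambda>x. E x v)" by blast
  with mult.hyps show ?case
    by (intro exI[of _ "\<lambda>x w. f x * E x w + D x w * g x"])
       (auto intro!: polyfun.intros derivative_intros)
qed

lemma polyfun_bounded:
  "polyfun f \<Longrightarrow> \<exists>C N. C \<ge> 0 \<and> (\<forall>x. cmod (f x) \<le> C * (1 + norm x) ^ N)"
proof (induction rule: polyfun.induct)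
  case (const a)
  then show ?case by (intro exI[of _ "cmod a"] exI[of _ 0]) auto
next
  case (inner v)
  have "cmod (of_real (x \<bullet> v)) \<le> norm v * (1 + norm x) ^ 1" for x
    using Cauchy_Schwarz_ineq2[of x v] by (simp add: algebra_simps add_increasing2 add_increasing)
  then show ?case by (intro exI[of _ "norm v"] exI[of _ 1]) auto
next
  case (add f g)
  then obtain C N D M where 1: "C \<ge> 0" "\<And>x. cmod (f x) \<le> C * (1 + norm x) ^ N"
      and 2: "D \<ge> 0" "\<And>x. cmod (g x) \<le> D * (1 + norm x) ^ M" by blast
  have "cmod (f x + g x) \<le> (C + D) * (1 + norm x) ^ (N + M)" for x
  proof -
    have "C * (1 + norm x) ^ N \<le> C * (1 + norm x) ^ (N + M)" "D * (1 + norm x) ^ M \<le> D * (1 + norm x) ^ (N + M)"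
      using 1 2 by (auto intro!: mult_left_mono power_increasing)
    then show ?thesis using 1(2)[of x] 2(2)[of x] norm_triangle_ineq[of "f x" "g x"] by (simp add: algebra_simps)
  qed
  then show ?case using 1 2 by (intro exI[of _ "C + D"] exI[of _ "N + M"]) auto
next
  case (mult f g)
  then obtain C N D M where 1: "C \<ge> 0" "\<And>x. cmod (f x) \<le> C * (1 + norm x) ^ N"
      and 2: "D \<ge> 0" "\<And>x. cmod (g x) \<le> D * (1 + norm x) ^ M" by blast
  have "cmod (f x * g x) \<le> (C * D) * (1 + norm x) ^ (N + M)" for x
    using mult_mono[OF 1(2)[of x] 2(2)[of x]] 1 by (simp add: norm_mult power_add mult_ac)
  then show ?case using 1 2 by (intro exI[of _ "C * D"] exI[of _ "N + M"]) auto
qed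

lemma mgauss_has_derivative:
  "(mgauss w c has_derivative
      (\<lambda>v. (\<i> * of_real (w \<bullet> v) - of_real ((x - c) \<bullet> v)) * mgauss w c x)) (at x)"
proof -
  \<comment> \<open>As the exponential of a quadratic polynomial the packet needs only one chain
    rule.\<close>
  define E where "E x = \<i> * of_real (w \<bullet> x) + of_real (- (1/2) * ((x - c) \<bullet> (x - c)))" for x
  have *: "mgauss w c = (\<lambda>x. exp (E x))"
    unfolding mgauss_def fun_eq_iff cis_conv_exp gauss_def power2_norm_eq_inner E_def exp_add
    by (simp only: exp_of_real) simp
  have E': "(E has_derivative (\<lambda>v. \<i> * of_real (w \<bullet> v) - of_real ((x - c) \<bullet> v))) (at x)"
    unfolding E_def
    by (auto intro!: derivative_eq_intros simp: fun_eq_iff inner_commute)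
  have "(exp has_derivative (\<lambda>y. exp (E x) * y)) (at (E x))"
    using DERIV_exp[of "E x"] unfolding has_field_derivative_def .
  from diff_chain_at[OF E' this] show ?thesis
    unfolding * by (simp add: o_def mult.commute)
qed

text \<open>Differentiating a packet multiplies it by a polynomial, so products of a
  \<open>polyfun\<close> with a fixed packet are closed under differentiation.\<close>

lemma iter_deriv_polyfun_mgauss:
  assumes "polyfun p"
  shows "\<exists>r. polyfun r \<and> iter_deriv vs (\<lambda>x. p x * mgauss w c x) = (\<lambda>x. r x * mgauss w c x)"
proof (induction vs)
  case Nil
  then show ?case using assms by auto
next
  case (Cons v vs)
  then obtain r where r: "polyfun r" "iter_deriv vs (\<lambda>x. p x * mgauss w c x) = (\<lambda>x. r x * mgauss w c x)"
    by blast
  obtain D where D: "\<And>x. (r has_derivative D x) (at x)" "\<And>v. polyfun (\<lambda>x. D x v)"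
    using polyfun_has_derivative[OF r(1)] by blast
  \<comment> \<open>Spelled out with the constructors of \<open>polyfun\<close>, hence the factor
    \<open>-1\<close> instead of a difference.\<close>
  let ?r' = "\<lambda>x. r x * ((\<i> * of_real (w \<bullet> v) + of_real (c \<bullet> v)) + (-1) * of_real (x \<bullet> v)) + D x v"
  have "polyfun ?r'" by (intro polyfun.intros r D)
  moreover have "frechet_derivative (\<lambda>x. r x * mgauss w c x) (at x) v = ?r' x * mgauss w c x" for x
    by (subst frechet_derivative_at[OF has_derivative_mult[OF D(1) mgauss_has_derivative], symmetric])
       (simp add: inner_diff_left algebra_simps)
  ultimately show ?case using r(2) by (intro exI[of _ ?r']) auto
qed

text \<open>With \<open>r = norm (x - c)\<close>, the power is at most a constant times
  \<open>exp (1 + r)\<close>, and \<open>1 + r - r\<^sup>2 / 2 \<le> 3 / 2\<close>.\<close>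

lemma power_mult_gauss_bounded:
  fixes c :: "'a::euclidean_space"
  shows "\<exists>B. \<forall>x. (1 + norm x) ^ N * gauss (1/2) (x - c) \<le> B"
proof -
  let ?K = "1 + norm c"
  have "(1 + norm x) ^ N * gauss (1/2) (x - c) \<le> ?K ^ N * (fact N * exp (3 / 2))" for x
  proof -
    let ?r = "norm (x - c)"
    have "1 + norm x \<le> ?K * (1 + ?r)"
    proof -
      have "?K * (1 + ?r) = 1 + norm c + ?r + norm c * ?r" by (simp add: algebra_simps)
      moreover have "0 \<le> norm c * ?r" by simp
      moreover have "norm x \<le> ?r + norm c" using norm_triangle_ineq[of "x - c" c] by simp
      ultimately show ?thesis by linarith
    qed
    then have "(1 + norm x) ^ N \<le> ?K ^ N * (1 + ?r) ^ N"
      by (metis power_mono power_mult_distrib add_nonneg_nonneg norm_ge_zero zero_le_one)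
    also have "?K ^ N * (1 + ?r) ^ N \<le> ?K ^ N * (fact N * exp (1 + ?r))"
    proof (intro mult_left_mono)
      have "(1 + ?r) ^ N /\<^sub>R fact N \<le> exp (1 + ?r)"
        unfolding exp_def
        using sum_le_suminf[OF summable_exp_generic[of "1 + ?r"], of "{N}"] by auto
      then show "(1 + ?r) ^ N \<le> fact N * exp (1 + ?r)" by (simp add: field_simps)
    qed auto
    finally have "(1 + norm x) ^ N * gauss (1/2) (x - c) \<le> (?K ^ N * (fact N * exp (1 + ?r))) * gauss (1/2) (x - c)"
      by (intro mult_right_mono gauss_nonneg)
    also have "\<dots> = ?K ^ N * (fact N * exp (1 + ?r - ?r\<^sup>2 / 2))"
      by (simp add: gauss_def mult_exp_exp)
    also have "\<dots> \<le> ?K ^ N * (fact N * exp (3 / 2))"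
    proof -
      have "0 \<le> (?r - 1)\<^sup>2 / 2" by simp
      then have "1 + ?r - ?r\<^sup>2 / 2 \<le> 3 / 2" by (simp add: power2_diff field_simps)
      then show ?thesis by (intro mult_left_mono) auto
    qed
    finally show ?thesis .
  qed
  then show ?thesis by blast
qed

lemma mgauss_Schwartz: "mgauss w c \<in> Schwartz"
  unfolding Schwartz_def
proof (intro CollectI allI impI conjI)
  fix vs :: "'a list" and x :: 'a and N :: nat
  obtain r where r: "polyfun r" "iter_deriv vs (mgauss w c) = (\<lambda>x. r x * mgauss w c x)"
    using iter_deriv_polyfun_mgauss[OF polyfun.const[of 1], of vs w c] by auto
  obtain D where D: "\<And>x. (r has_derivative D x) (at x)"
    using polyfun_has_derivative[OF r(1)] by blast
  show "iter_deriv vs (mgauss w c) differentiable at x"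
    unfolding r(2) differentiable_def
    using has_derivative_mult[OF D mgauss_has_derivative] by blast
  obtain C M where C: "C \<ge> 0" "\<And>x. cmod (r x) \<le> C * (1 + norm x) ^ M"
    using polyfun_bounded[OF r(1)] by blast
  obtain B where B: "\<And>x. (1 + norm x) ^ (N + M) * gauss (1/2) (x - c) \<le> B"
    using power_mult_gauss_bounded by blast
  have "norm ((1 + norm x) ^ N *\<^sub>R iter_deriv vs (mgauss w c) x) \<le> C * B" for x
  proof -
    have "norm ((1 + norm x) ^ N *\<^sub>R iter_deriv vs (mgauss w c) x)
        = (1 + norm x) ^ N * (cmod (r x) * gauss (1/2) (x - c))"
      by (simp add: r(2) norm_mult)
    also have "\<dots> \<le> (1 + norm x) ^ N * ((C * (1 + norm x) ^ M) * gauss (1/2) (x - c))"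
      by (intro mult_left_mono mult_right_mono C gauss_nonneg) auto
    also have "\<dots> = C * ((1 + norm x) ^ (N + M) * gauss (1/2) (x - c))"
      by (simp add: power_add)
    also have "\<dots> \<le> C * B" by (intro mult_left_mono B C)
    finally show ?thesis .
  qed
  then show "bounded (range (\<lambda>x. (1 + norm x) ^ N *\<^sub>R iter_deriv vs (mgauss w c) x))"
    unfolding bounded_iff by blast
qed


section \<open>Gaussian wave packets at dyadic frequencies\<close>

lemma sum_half_power_le: "finite J \<Longrightarrow> (\<Sum>j\<in>J. (1/2) ^ j) \<le> (2::real)"
  using sum_le_suminf[of "\<lambda>j. (1/2) ^ j :: real" J] by (simp add: suminf_geometric summable_geometric)

lemma exp_minus_le_inverse: "(x::real) > 0 \<Longrightarrow> exp (- x) \<le> 1 / x"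
  using order_trans[OF _ exp_ge_add_one_self[of x], of x] by (simp add: exp_minus field_simps)

text \<open>The point \<open>2 ^ i\<close> nearest to \<open>s\<close> accounts for at most 1; every other \<open>2 ^ j\<close> has distance at
  least \<open>2 ^ j / 4\<close> from \<open>s\<close>.\<close>

lemma sum_gauss_dyadic_le:
  fixes s :: real
  assumes "finite J"
  shows "(\<Sum>j\<in>J. exp (- (1/2) * (s - 2 ^ j)\<^sup>2)) \<le> 65"
proof (cases "J = {}")
  case False
  define i where "i = arg_min_on (\<lambda>j. \<bar>s - 2 ^ j\<bar>) J"
  have i: "i \<in> J" "\<And>j. j \<in> J \<Longrightarrow> \<bar>s - 2 ^ i\<bar> \<le> \<bar>s - 2 ^ j\<bar>"
    unfolding i_def using assms False by (auto intro: arg_min_if_finite arg_min_least)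
  have le: "exp (- (1/2) * (s - 2 ^ j)\<^sup>2) \<le> 32 * (1/2) ^ j" if "j \<in> J - {i}" for j
  proof -
    have "2 ^ j / 2 \<le> \<bar>2 ^ j - 2 ^ i :: real\<bar>"
    proof (cases "i < j")
      case True
      then have "(2::real) ^ i \<le> 2 ^ (j - 1)" by (intro power_increasing) auto
      also have "\<dots> = 2 ^ j / 2" using True by (simp add: power_diff)
      finally show ?thesis by linarith
    next
      case False
      then have "(2::real) ^ Suc j \<le> 2 ^ i" using that by (intro power_increasing) auto
      then show ?thesis unfolding power_Suc by linarith
    qed
    \<comment> \<open>Since \<open>i\<close> is nearest to \<open>s\<close>, the triangle inequality
      turns distance from \<open>2 ^ i\<close> into distance from \<open>s\<close>.\<close>
    also have "\<dots> \<le> 2 * \<bar>s - 2 ^ j\<bar>" 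
    proof -
      have "\<bar>2 ^ j - 2 ^ i\<bar> \<le> \<bar>s - 2 ^ j\<bar> + \<bar>s - 2 ^ i\<bar>" by arith
      then show ?thesis using i(2)[of j] that by auto
    qed
    finally have "(2 ^ j / 4)\<^sup>2 \<le> \<bar>s - 2 ^ j\<bar>\<^sup>2" by (intro power_mono) auto
    then have "exp (- (1/2) * (s - 2 ^ j)\<^sup>2) \<le> exp (- ((2 ^ j)\<^sup>2 / 32))"
      by (simp add: power_divide)
    also have "\<dots> \<le> 1 / ((2 ^ j)\<^sup>2 / 32)" by (intro exp_minus_le_inverse) simp
    also have "\<dots> = 32 * ((1/2) ^ j * (1/2) ^ j)" by (simp add: power2_eq_square power_divide)
    also have "\<dots> \<le> 32 * ((1/2) ^ j * 1)" by (intro mult_left_mono power_le_one) auto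
    finally show ?thesis by simp
  qed
  have "(\<Sum>j\<in>J. exp (- (1/2) * (s - 2 ^ j)\<^sup>2))
      = exp (- (1/2) * (s - 2 ^ i)\<^sup>2) + (\<Sum>j\<in>J - {i}. exp (- (1/2) * (s - 2 ^ j)\<^sup>2))"
    using assms i by (simp add: sum.remove)
  also have "\<dots> \<le> 1 + (\<Sum>j\<in>J - {i}. 32 * (1/2) ^ j)"
    using le by (intro add_mono sum_mono) auto
  also have "\<dots> = 1 + 32 * (\<Sum>j\<in>J - {i}. (1/2) ^ j)" by (simp add: sum_distrib_left)
  also have "\<dots> \<le> 1 + 32 * 2"
    using assms by (intro add_left_mono mult_left_mono sum_half_power_le) auto
  finally show ?thesis by simp
qed simp

text \<open>Displacing each packet by a multiple of its own frequency lets the one bound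
  \<open>sum_gauss_dyadic_le\<close> control overlap in space for \<open>\<sigma> = 1\<close> and
  correlation in frequency for \<open>\<sigma> = 0\<close>.\<close>

definition gwave :: "real \<Rightarrow> 'a::euclidean_space \<Rightarrow> nat \<Rightarrow> 'a \<Rightarrow> complex" where
  "gwave \<sigma> e j = mgauss (2 ^ j *\<^sub>R e) ((\<sigma> * 2 ^ j) *\<^sub>R e)"

lemma gwave_measurable [measurable]: "gwave \<sigma> e j \<in> borel_measurable borel"
  unfolding gwave_def by measurable

lemma integrable_gwave [simp]: "integrable lborel (gwave \<sigma> e j)"
  unfolding gwave_def by simp

lemma integral_gauss_pos: "s > 0 \<Longrightarrow> (LINT x::'a::euclidean_space|lborel. gauss s x) > 0"
proof -
  assume s: "s > 0"
  have "\<not> (AE x::'a in lborel. gauss s x = 0)"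
  proof
    assume "AE x::'a in lborel. gauss s x = 0"
    then have "AE x::'a in lborel. False"
      by (rule eventually_mono) (metis gauss_pos less_irrefl)
    then show False by (simp add: trivial_limit_def[symmetric] ae_filter_eq_bot_iff)
  qed
  then have "(LINT x::'a|lborel. gauss s x) \<noteq> 0"
    using integral_nonneg_eq_0_iff_AE[OF integrable_gauss[OF s, where 'a='a]] gauss_nonneg by auto
  moreover have "(LINT x::'a|lborel. gauss s x) \<ge> 0" by (simp add: gauss_nonneg)
  ultimately show ?thesis by linarith
qed

lemma gauss_powr: "gauss s x powr p = gauss (p * s) x"
  by (simp add: gauss_def powr_def)

text \<open>Projection to the direction \<open>e\<close> bounds the sum \<open>V\<close> of the
  envelopes by 65 everywhere. Then \<open>V powr p \<le> 65 powr (p - 1) * V\<close>, and the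
  integral of \<open>V\<close> is linear in the number of packets.\<close>

lemma gwave_sum_translated_Lp_le:
  fixes e :: "'a::euclidean_space"
  assumes p: "p \<ge> 1" and e: "norm e = 1" and J: "finite J"
  shows "(\<integral>\<^sup>+x. ennreal (cmod (\<Sum>j\<in>J. gwave 1 e j x) powr p) \<partial>lborel)
     \<le> ennreal (65 powr (p - 1) * (LINT x::'a|lborel. gauss (1/2) x) * real (card J))"
proof -
  define V where "V x = (\<Sum>j\<in>J. gauss (1/2) (x - 2 ^ j *\<^sub>R e))" for x
  have V0: "V x \<ge> 0" for x unfolding V_def by (intro sum_nonneg gauss_nonneg)
  have V65: "V x \<le> 65" for x
  proof -
    have "gauss (1/2) (x - 2 ^ j *\<^sub>R e) \<le> exp (- (1/2) * (x \<bullet> e - 2 ^ j)\<^sup>2)" for j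
    proof -
      have "(x - 2 ^ j *\<^sub>R e) \<bullet> e = x \<bullet> e - 2 ^ j"
        using e by (simp add: inner_diff_left dot_square_norm)
      then have "\<bar>x \<bullet> e - 2 ^ j\<bar> \<le> norm (x - 2 ^ j *\<^sub>R e)"
        using Cauchy_Schwarz_ineq2[of "x - 2 ^ j *\<^sub>R e" e] e by simp
      then have "\<bar>x \<bullet> e - 2 ^ j\<bar>\<^sup>2 \<le> (norm (x - 2 ^ j *\<^sub>R e))\<^sup>2" by (intro power_mono) auto
      then show ?thesis by (simp add: gauss_def)
    qed
    then have "V x \<le> (\<Sum>j\<in>J. exp (- (1/2) * (x \<bullet> e - 2 ^ j)\<^sup>2))"
      unfolding V_def by (intro sum_mono)
    with sum_gauss_dyadic_le[OF J, of "x \<bullet> e"] show ?thesis by linarith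
  qed
  have intV: "integrable lborel V" unfolding V_def by simp
  have "cmod (\<Sum>j\<in>J. gwave 1 e j x) powr p \<le> 65 powr (p - 1) * V x" for x
  proof -
    have "cmod (\<Sum>j\<in>J. gwave 1 e j x) \<le> V x"
      unfolding V_def by (rule order_trans[OF norm_sum]) (simp add: gwave_def)
    then have "cmod (\<Sum>j\<in>J. gwave 1 e j x) powr p \<le> V x powr p"
      using p by (intro powr_mono2) auto
    also have "\<dots> = V x powr (p - 1) * V x" using V0[of x] by (cases "V x = 0") (auto simp: powr_diff)
    also have "\<dots> \<le> 65 powr (p - 1) * V x"
      using V0 V65 p by (intro mult_right_mono powr_mono2) auto
    finally show ?thesis .
  qed
  then have "(\<integral>\<^sup>+x. ennreal (cmod (\<Sum>j\<in>J. gwave 1 e j x) powr p) \<partial>lborel)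
      \<le> (\<integral>\<^sup>+x. ennreal (65 powr (p - 1) * V x) \<partial>lborel)"
    by (intro nn_integral_mono ennreal_leI)
  also have "\<dots> = ennreal (LINT x|lborel. 65 powr (p - 1) * V x)"
    using intV V0 by (intro nn_integral_eq_integral) auto
  also have "(LINT x|lborel. 65 powr (p - 1) * V x) = 65 powr (p - 1) * (LINT x::'a|lborel. gauss (1/2) x) * real (card J)"
    unfolding V_def by simp
  finally show ?thesis .
qed

text \<open>After expanding the square, the term with indices \<open>i\<close>, \<open>j\<close> is
  a Gaussian in \<open>2 ^ i - 2 ^ j\<close>. For each \<open>i\<close> the sum over
  \<open>j\<close> is at most 65, so the double sum grows like \<open>card J\<close> and not like
  its square.\<close>

lemma integral_norm_cis_sum_gauss_le:
  fixes e :: "'a::euclidean_space"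
  assumes e: "norm e = 1" and J: "finite J"
  defines "S \<equiv> \<lambda>x::'a. \<Sum>j\<in>J. cis (2 ^ j * (x \<bullet> e))"
  shows "integrable lborel (\<lambda>x. (cmod (S x))\<^sup>2 * gauss (1/2) x)"
    and "(LINT x|lborel. (cmod (S x))\<^sup>2 * gauss (1/2) x)
           \<le> 65 * (2 * pi) powr (real DIM('a) / 2) * real (card J)"
proof -
  let ?G = "(2 * pi) powr (real DIM('a) / 2)"
  let ?f = "\<lambda>i j x. cis (x \<bullet> ((2 ^ i - 2 ^ j) *\<^sub>R e)) * complex_of_real (gauss (1/2) x)"
  have int: "integrable lborel (?f i j)" for i j :: nat
    by (rule Bochner_Integration.integrable_bound[OF integrable_gauss[of "1/2"]])
       (auto simp: norm_mult gauss_nonneg)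
  have val: "(LINT x|lborel. ?f i j x) = of_real (?G * exp (- (1/2) * (2 ^ i - 2 ^ j)\<^sup>2))" for i j :: nat
    unfolding integral_cis_gauss using e by (simp add: gauss_def power_mult_distrib)
  have eq: "complex_of_real ((cmod (S x))\<^sup>2 * gauss (1/2) x) = (\<Sum>i\<in>J. \<Sum>j\<in>J. ?f i j x)" for x
  proof -
    have "complex_of_real ((cmod (S x))\<^sup>2) = S x * cnj (S x)" by (rule complex_norm_square)
    also have "\<dots> = (\<Sum>i\<in>J. \<Sum>j\<in>J. cis (2 ^ i * (x \<bullet> e)) * cis (- (2 ^ j * (x \<bullet> e))))"
      unfolding S_def cnj_sum sum_product by (simp add: cis_cnj)
    also have "\<dots> = (\<Sum>i\<in>J. \<Sum>j\<in>J. cis (x \<bullet> ((2 ^ i - 2 ^ j) *\<^sub>R e)))"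
      by (simp add: cis_mult algebra_simps)
    finally show ?thesis by (simp add: sum_distrib_right)
  qed
  have "integrable lborel (\<lambda>x. complex_of_real ((cmod (S x))\<^sup>2 * gauss (1/2) x))"
    unfolding eq using int by (intro Bochner_Integration.integrable_sum) auto
  from integrable_Re[OF this] show "integrable lborel (\<lambda>x. (cmod (S x))\<^sup>2 * gauss (1/2) x)"
    by (simp only: Re_complex_of_real)
  then have "complex_of_real (LINT x|lborel. (cmod (S x))\<^sup>2 * gauss (1/2) x)
      = (LINT x|lborel. (\<Sum>i\<in>J. \<Sum>j\<in>J. ?f i j x))"
    unfolding eq[symmetric] by (rule integral_of_real[symmetric])
  also have "\<dots> = (\<Sum>i\<in>J. \<Sum>j\<in>J. of_real (?G * exp (- (1/2) * (2 ^ i - 2 ^ j)\<^sup>2)))"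
    unfolding val[symmetric]
    by (subst Bochner_Integration.integral_sum)
       (auto intro!: sum.cong Bochner_Integration.integral_sum Bochner_Integration.integrable_sum int
         simp del: inner_scaleR_right)
  also have "\<dots> = of_real (\<Sum>i\<in>J. ?G * (\<Sum>j\<in>J. exp (- (1/2) * (2 ^ i - 2 ^ j)\<^sup>2)))"
    by (simp add: sum_distrib_left)
  finally have "(LINT x|lborel. (cmod (S x))\<^sup>2 * gauss (1/2) x)
      = (\<Sum>i\<in>J. ?G * (\<Sum>j\<in>J. exp (- (1/2) * (2 ^ i - 2 ^ j)\<^sup>2)))"
    using of_real_eq_iff by blast
  also have "\<dots> \<le> (\<Sum>i\<in>J. ?G * 65)"
    by (intro sum_mono mult_left_mono sum_gauss_dyadic_le J) auto
  finally show "(LINT x|lborel. (cmod (S x))\<^sup>2 * gauss (1/2) x)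
           \<le> 65 * ?G * real (card J)" by (simp add: mult_ac)
qed

text \<open>The passage from \<open>L_2\<close> to \<open>L_p\<close> uses
  \<open>y powr (p / 2) \<le> 1 + y\<close> at \<open>y = (cmod (S x))\<^sup>2 / n\<close> in place
  of Hoelder's inequality. Dividing by \<open>n\<close> beforehand makes both summands contribute a
  bounded amount.\<close>

lemma gwave_sum_centered_Lp_le:
  fixes e :: "'a::euclidean_space"
  assumes p: "1 \<le> p" "p \<le> 2" and e: "norm e = 1" and J: "finite J" "J \<noteq> {}"
  shows "(\<integral>\<^sup>+x. ennreal (cmod (\<Sum>j\<in>J. gwave 0 e j x) powr p) \<partial>lborel)
     \<le> ennreal (((LINT x::'a|lborel. gauss (1/2) x) + 65 * (2 * pi) powr (real DIM('a) / 2)) * real (card J) powr (p / 2))"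
proof -
  define S where "S x = (\<Sum>j\<in>J. cis (2 ^ j * (x \<bullet> e)))" for x
  define n where "n = real (card J)"
  have n: "n > 0" using J by (simp add: n_def card_gt_0_iff)
  note S2 = integral_norm_cis_sum_gauss_le[OF e J(1), folded S_def]
  have "cmod (\<Sum>j\<in>J. gwave 0 e j x) powr p
     \<le> n powr (p / 2) * (gauss (1/2) x + (1 / n) * ((cmod (S x))\<^sup>2 * gauss (1/2) x))" for x
  proof -
    have "(\<Sum>j\<in>J. gwave 0 e j x) = S x * of_real (gauss (1/2) x)"
      by (simp add: gwave_def mgauss_def S_def sum_distrib_right inner_commute)
    then have "cmod (\<Sum>j\<in>J. gwave 0 e j x) powr p = cmod (S x) powr p * gauss (p / 2) x"
      by (simp add: norm_mult gauss_nonneg powr_mult gauss_powr)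
    also have "cmod (S x) powr p = n powr (p / 2) * ((cmod (S x))\<^sup>2 / n) powr (p / 2)"
      using n by (cases "S x = 0") (simp_all add: powr_divide powr_powr flip: powr_numeral)
    finally have 1: "cmod (\<Sum>j\<in>J. gwave 0 e j x) powr p
        = n powr (p / 2) * ((cmod (S x))\<^sup>2 / n) powr (p / 2) * gauss (p / 2) x" .
    have 2: "((cmod (S x))\<^sup>2 / n) powr (p / 2) \<le> 1 + (cmod (S x))\<^sup>2 / n"
    proof (cases "(cmod (S x))\<^sup>2 / n \<le> 1")
      case True
      then have "((cmod (S x))\<^sup>2 / n) powr (p / 2) \<le> 1"
        using n p by (intro powr_le1) auto
      then show ?thesis using n by (simp add: add_increasing2)
    next
      case False
      then have "((cmod (S x))\<^sup>2 / n) powr (p / 2) \<le> ((cmod (S x))\<^sup>2 / n) powr 1"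
        using p by (intro powr_mono) auto
      then show ?thesis using False by simp
    qed
    have 3: "gauss (p / 2) x \<le> gauss (1/2) x"
      using mult_right_mono[OF p(1), of "(norm x)\<^sup>2"] by (simp add: gauss_def)
    have "cmod (\<Sum>j\<in>J. gwave 0 e j x) powr p
        \<le> n powr (p / 2) * (1 + (cmod (S x))\<^sup>2 / n) * gauss (1/2) x"
      unfolding 1 using n by (intro mult_mono mult_left_mono 2 3) (auto simp: gauss_nonneg)
    then show ?thesis by (simp add: algebra_simps)
  qed
  then have "(\<integral>\<^sup>+x. ennreal (cmod (\<Sum>j\<in>J. gwave 0 e j x) powr p) \<partial>lborel)
      \<le> (\<integral>\<^sup>+x. ennreal (n powr (p / 2) * (gauss (1/2) x + (1 / n) * ((cmod (S x))\<^sup>2 * gauss (1/2) x))) \<partial>lborel)"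
    by (intro nn_integral_mono ennreal_leI)
  also have "\<dots> = ennreal (LINT x|lborel. n powr (p / 2) * (gauss (1/2) x + (1 / n) * ((cmod (S x))\<^sup>2 * gauss (1/2) x)))"
    using S2(1) n by (intro nn_integral_eq_integral) (auto simp: integrable_gauss gauss_nonneg)
  also have "(LINT x|lborel. n powr (p / 2) * (gauss (1/2) x + (1 / n) * ((cmod (S x))\<^sup>2 * gauss (1/2) x)))
     = n powr (p / 2) * ((LINT x::'a|lborel. gauss (1/2) x) + (1 / n) * (LINT x|lborel. (cmod (S x))\<^sup>2 * gauss (1/2) x))"
    using S2(1) by (subst integral_mult_right_zero, subst Bochner_Integration.integral_add) (auto simp: integrable_gauss)
  also have "\<dots> \<le> n powr (p / 2) * ((LINT x::'a|lborel. gauss (1/2) x) + (1 / n) * (65 * (2 * pi) powr (real DIM('a) / 2) * n))"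
    using S2(2) n unfolding n_def[symmetric] by (intro mult_left_mono add_left_mono) auto
  finally show ?thesis using n by (simp add: n_def mult_ac ennreal_leI)
qed

text \<open>\<open>1 / r\<close> is the power of the number of packets that bounds the
  \<open>L_p\<close> norm of their sum. For \<open>\<sigma> = 0\<close> it does not vary with
  \<open>p\<close>, and that case is also called at exponent 1.\<close>

definition admissible :: "real \<Rightarrow> real \<Rightarrow> real \<Rightarrow> bool" where
  "admissible \<sigma> p r \<longleftrightarrow> \<sigma> = 0 \<and> p \<le> 2 \<and> r = 2 \<or> \<sigma> = 1 \<and> p \<ge> 2 \<and> r = p"

lemma gwave_sum_Lp_le:
  fixes e :: "'a::euclidean_space"
  assumes p: "p \<ge> 1" and e: "norm e = 1" and adm: "admissible \<sigma> p r"
  obtains C where "C > 0"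
    "\<And>J. finite J \<Longrightarrow> J \<noteq> {} \<Longrightarrow> (\<integral>\<^sup>+x. ennreal (cmod (\<Sum>j\<in>J. gwave \<sigma> e j x) powr p) \<partial>lborel)
        \<le> ennreal ((C * real (card J) powr (1 / r)) powr p)"
proof -
  define g where "g = (LINT x::'a|lborel. gauss (1/2) x)"
  have g: "g > 0" unfolding g_def by (intro integral_gauss_pos) simp
  define K where "K = (if \<sigma> = 0 then g + 65 * (2 * pi) powr (real DIM('a) / 2) else 65 powr (p - 1) * g)"
  have K: "K > 0" unfolding K_def using g by (auto intro: add_pos_nonneg)
  show ?thesis
  proof
    show "K powr (1 / p) > 0" using K by simp
    fix J :: "nat set" assume J: "finite J" "J \<noteq> {}"
    have "(K powr (1 / p) * real (card J) powr (1 / r)) powr p = K * real (card J) powr (p / r)"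
      using K p by (simp add: powr_mult powr_powr)
    then show "(\<integral>\<^sup>+x. ennreal (cmod (\<Sum>j\<in>J. gwave \<sigma> e j x) powr p) \<partial>lborel)
        \<le> ennreal ((K powr (1 / p) * real (card J) powr (1 / r)) powr p)"
      using adm gwave_sum_centered_Lp_le[OF p _ e J] gwave_sum_translated_Lp_le[OF p e J(1)] p J
      unfolding admissible_def K_def g_def by auto
  qed
qed

text \<open>A Bernstein estimate: \<open>2 ^ j\<close> is the size of the frequency, and
  \<open>C\<close> is common to all \<open>j\<close>.\<close>

lemma gwave_diff_Lp_le:
  fixes e :: "'a::euclidean_space"
  assumes p: "p \<ge> 1" and e: "norm e = 1"
  obtains C where "C > 0"
    "\<And>j h. norm h \<le> 1 \<Longrightarrow> (\<integral>\<^sup>+x. ennreal (cmod (gwave \<sigma> e j (x + h) - gwave \<sigma> e j x) powr p) \<partial>lborel)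
        \<le> ennreal ((C * 2 ^ j * norm h) powr p)"
proof
  define g where "g = (LINT x::'a|lborel. gauss (p / 8) x)"
  have g: "g > 0" unfolding g_def using p by (intro integral_gauss_pos) simp
  define C where "C = 6 * exp (1/2 :: real) * g powr (1 / p)"
  show "C > 0" using g by (simp add: C_def)
  fix j and h :: 'a assume h: "norm h \<le> 1"
  let ?c = "(\<sigma> * 2 ^ j) *\<^sub>R e" and ?k = "6 * exp (1/2) * 2 ^ j * norm h"
  have "cmod (gwave \<sigma> e j (x + h) - gwave \<sigma> e j x) \<le> ?k * gauss (1/8) (x - ?c)" for x
  proof -
    have "cmod (gwave \<sigma> e j (x + h) - gwave \<sigma> e j x)
        \<le> 3 * exp (1/2) * (1 + 2 ^ j) * norm h * gauss (1/8) (x - ?c)"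
      using mgauss_diff_le[OF h, of "2 ^ j *\<^sub>R e" ?c x] e by (simp add: gwave_def)
    also have "3 * exp (1/2) * (1 + 2 ^ j) * norm h * gauss (1/8) (x - ?c)
        \<le> 3 * exp (1/2) * (2 * 2 ^ j) * norm h * gauss (1/8) (x - ?c)"
      by (intro mult_right_mono mult_left_mono) (auto simp: gauss_nonneg)
    also have "\<dots> = ?k * gauss (1/8) (x - ?c)" by simp
    finally show ?thesis .
  qed
  then have "(\<integral>\<^sup>+x. ennreal (cmod (gwave \<sigma> e j (x + h) - gwave \<sigma> e j x) powr p) \<partial>lborel)
      \<le> (\<integral>\<^sup>+x. ennreal ((?k * gauss (1/8) (x - ?c)) powr p) \<partial>lborel)"
    using p by (intro nn_integral_mono ennreal_leI powr_mono2) auto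
  also have "\<dots> = (\<integral>\<^sup>+x. ennreal (?k powr p * gauss (p / 8) (x - ?c)) \<partial>lborel)"
    by (simp only: powr_mult gauss_powr) simp
  also have "\<dots> = ennreal (LINT x|lborel. ?k powr p * gauss (p / 8) (x - ?c))"
    using p by (intro nn_integral_eq_integral) (auto simp: gauss_nonneg)
  also have "\<dots> = ennreal (?k powr p * g)"
    using p by (simp add: g_def)
  also have "?k powr p * g = (C * 2 ^ j * norm h) powr p"
    using g p by (simp add: C_def powr_mult powr_powr)
  finally show "(\<integral>\<^sup>+x. ennreal (cmod (gwave \<sigma> e j (x + h) - gwave \<sigma> e j x) powr p) \<partial>lborel)
        \<le> ennreal ((C * 2 ^ j * norm h) powr p)" .
qed


section \<open>Lacunary sums of blocks\<close>

lemma powr_mult_exp_bounded: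
  fixes a :: real
  obtains K where "K > 0" "\<And>u. u \<ge> 1 \<Longrightarrow> exp (- u / 2) \<le> K * u powr (- a)"
proof
  define N where "N = nat \<lceil>a\<rceil>"
  let ?K = "2 ^ N * fact N :: real"
  show "?K > 0" by simp
  fix u :: real assume u: "u \<ge> 1"
  have "u powr a \<le> u powr real N" using u by (intro powr_mono) (auto simp: N_def intro: real_nat_ceiling_ge)
  also have "\<dots> = u ^ N" using u by (simp add: powr_realpow)
  also have "\<dots> = 2 ^ N * (u / 2) ^ N" by (simp add: power_divide)
  also have "\<dots> \<le> 2 ^ N * (fact N * exp (u / 2))"
  proof (intro mult_left_mono)
    have "(u / 2) ^ N /\<^sub>R fact N \<le> exp (u / 2)"
      unfolding exp_def using u sum_le_suminf[OF summable_exp_generic[of "u / 2"], of "{N}"] by auto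
    then show "(u / 2) ^ N \<le> fact N * exp (u / 2)" by (simp add: field_simps)
  qed auto
  finally have "u powr a * (exp (- u / 2) * u powr (- a)) \<le> (?K * exp (u / 2)) * (exp (- u / 2) * u powr (- a))"
    by (intro mult_right_mono) auto
  then show "exp (- u / 2) \<le> ?K * u powr (- a)"
    using u by (simp add: powr_minus exp_minus field_simps)
qed

text \<open>Let \<open>u = 1 - ln t\<close>. The second argument of \<open>min\<close> is
  \<open>exp (2 * 2 ^ m * ln 2 + 1 - u)\<close>, tiny while \<open>2 ^ m\<close> is well below
  \<open>u\<close>. Once \<open>2 ^ m > u\<close>, the terms are bounded by a geometric series
  starting at \<open>u powr (- \<beta>)\<close>; before that, the bound
  \<open>u powr (- (\<beta> + 1)) * 2 ^ m\<close> suffices, since its sum is dominated by the last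
  term, where \<open>2 ^ m\<close> is about \<open>u\<close>.\<close>

lemma lacunary_sum_le:
  fixes \<beta> :: real
  assumes \<beta>: "\<beta> > 0"
  obtains K where "K > 0"
    "\<And>t n. 0 < t \<Longrightarrow> t < 1 \<Longrightarrow>
       (\<Sum>m<n. 2 powr (- \<beta> * real m) * min 1 (2 ^ 2 ^ Suc m * t)) \<le> K * (1 - ln t) powr (- \<beta>)"
proof -
  obtain K0 where K0: "K0 > 0" "\<And>u. u \<ge> 1 \<Longrightarrow> exp (- u / 2) \<le> K0 * u powr (- (\<beta> + 1))"
    using powr_mult_exp_bounded by blast
  define K1 where "K1 = max (4 powr (\<beta> + 1)) (exp 1 * K0)"
  have K1: "K1 > 0" unfolding K1_def by (simp add: less_max_iff_disj)
  define \<rho> where "\<rho> = 2 powr (- \<beta>)"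
  have \<rho>: "0 < \<rho>" "\<rho> < 1" using \<beta> by (auto simp: \<rho>_def powr_minus_divide)
  define K where "K = 2 * K1 + 1 / (1 - \<rho>)"
  show ?thesis
  proof
    show "K > 0" unfolding K_def using K1 \<rho> by (simp add: add_pos_pos)
    fix t :: real and n :: nat assume t: "0 < t" "t < 1"
    define u where "u = 1 - ln t"
    have u: "u \<ge> 1" using t by (simp add: u_def)
    let ?T = "\<lambda>m. 2 powr (- \<beta> * real m) * min 1 (2 ^ 2 ^ Suc m * t)"
    have T0: "?T m \<ge> 0" for m using t by simp
    define M where "M = (LEAST M. u < 2 ^ M)"
    have M: "u < 2 ^ M" unfolding M_def by (rule LeastI_ex) (simp add: real_arch_pow)
    have M': "2 ^ m \<le> u" if "m < M" for m
      using not_less_Least that unfolding M_def by force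
    have "M > 0" using M u by (cases M) auto
    have small: "?T m \<le> K1 * u powr (- (\<beta> + 1)) * 2 ^ m" for m
    proof -
      define s where "s = (2::real) ^ m"
      have s: "s \<ge> 1" "s = 2 powr real m" by (auto simp: s_def powr_realpow)
      have "min 1 (2 ^ 2 ^ Suc m * t) \<le> K1 * (s / u) powr (\<beta> + 1)"
      \<comment> \<open>Below \<open>u / 4\<close> one has \<open>2 * s * ln 2 \<le> u / 2\<close>,
        so half of \<open>u\<close> survives in the exponent; above it, the bound 1 costs only
        \<open>4 powr (\<beta> + 1)\<close>.\<close>
      proof (cases "s \<ge> u / 4")
        case True
        have "1 = 4 powr (\<beta> + 1) * (1 / 4) powr (\<beta> + 1)" by (simp add: powr_divide)
        also have "\<dots> \<le> K1 * (s / u) powr (\<beta> + 1)"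
          using True u \<beta> K1 by (intro mult_mono powr_mono2) (auto simp: K1_def field_simps)
        finally show ?thesis by simp
      next
        case False
        have "t = exp (1 - u)" using t by (simp add: u_def)
        moreover have "(2::real) ^ 2 ^ Suc m = exp (2 * s * ln 2)"
        proof -
          have "(2::real) ^ 2 ^ Suc m = 2 powr real (2 ^ Suc m)" by (rule powr_realpow[symmetric]) simp
          also have "real (2 ^ Suc m) = 2 * s" by (simp add: s_def)
          finally show ?thesis by (simp add: powr_def)
        qed
        ultimately have "2 ^ 2 ^ Suc m * t = exp (2 * s * ln 2 + (1 - u))"
          by (simp only: exp_add)
        also have "\<dots> \<le> exp (1 + - u / 2)"
        proof -
          have "s * ln 2 \<le> s * 1" using s ln_2_less_1 by (intro mult_left_mono) auto
          then show ?thesis using False by simp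
        qed
        also have "\<dots> \<le> exp 1 * (K0 * u powr (- (\<beta> + 1)))"
          unfolding exp_add using K0(2)[OF u] by (intro mult_left_mono) auto
        also have "\<dots> \<le> K1 * (s powr (\<beta> + 1) * u powr (- (\<beta> + 1)))"
        proof -
          have "1 \<le> s powr (\<beta> + 1)" using s \<beta> by (intro ge_one_powr_ge_zero) auto
          then have "(exp 1 * K0) * (1 * u powr (- (\<beta> + 1))) \<le> K1 * (s powr (\<beta> + 1) * u powr (- (\<beta> + 1)))"
            using K0 by (intro mult_mono) (auto simp: K1_def le_max_iff_disj)
          then show ?thesis by (simp add: mult_ac)
        qed
        also have "\<dots> = K1 * (s / u) powr (\<beta> + 1)"
          by (simp only: powr_divide powr_minus_divide) simp
        finally show ?thesis by simp
      qed
      then have "?T m \<le> s powr (- \<beta>) * (K1 * (s / u) powr (\<beta> + 1))"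
        unfolding s(2) powr_powr by (simp add: mult.commute)
      also have "\<dots> = K1 * u powr (- (\<beta> + 1)) * (s powr (- \<beta>) * s powr (\<beta> + 1))"
        by (simp only: powr_divide powr_minus_divide) simp
      also have "s powr (- \<beta>) * s powr (\<beta> + 1) = s" using s(1) by (simp add: powr_add[symmetric])
      finally show ?thesis by (simp add: s_def)
    qed
    have large: "?T (M + i) \<le> u powr (- \<beta>) * \<rho> ^ i" for i
    proof -
      have "?T (M + i) \<le> 2 powr (- \<beta> * real (M + i))" by (simp add: mult_left_le)
      also have "\<dots> = (2 ^ M) powr (- \<beta>) * \<rho> ^ i"
        by (simp add: \<rho>_def powr_realpow[symmetric] powr_powr algebra_simps flip: powr_add)
      also have "\<dots> \<le> u powr (- \<beta>) * \<rho> ^ i"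
        using \<rho> u M \<beta> by (intro mult_right_mono powr_mono2') auto
      finally show ?thesis .
    qed
    have "(\<Sum>m<n. ?T m) \<le> (\<Sum>m<M+n. ?T m)" using T0 by (intro sum_mono2) auto
    also have "\<dots> = (\<Sum>m<M. ?T m) + (\<Sum>i<n. ?T (M + i))"
      by (induction n) (auto simp: add.assoc)
    also have "\<dots> \<le> (\<Sum>m<M. K1 * u powr (- (\<beta> + 1)) * 2 ^ m) + (\<Sum>i<n. u powr (- \<beta>) * \<rho> ^ i)"
      by (intro add_mono sum_mono small large)
    also have "\<dots> = K1 * u powr (- (\<beta> + 1)) * (\<Sum>m<M. 2 ^ m) + u powr (- \<beta>) * (\<Sum>i<n. \<rho> ^ i)"
      by (simp only: sum_distrib_left)
    also have "\<dots> \<le> K1 * u powr (- (\<beta> + 1)) * (2 * u) + u powr (- \<beta>) * (1 / (1 - \<rho>))"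
    proof (intro add_mono mult_left_mono)
      have "(\<Sum>m<M. 2 ^ m) = (2::real) ^ M - 1" by (simp add: sum_gp_strict)
      also have "\<dots> \<le> 2 * 2 ^ (M - 1)" using \<open>M > 0\<close> by (cases M) auto
      also have "\<dots> \<le> 2 * u" using M'[of "M - 1"] \<open>M > 0\<close> by simp
      finally show "(\<Sum>m<M. 2 ^ m) \<le> 2 * u" .
      show "(\<Sum>i<n. \<rho> ^ i) \<le> 1 / (1 - \<rho>)"
        using \<rho> by (simp add: sum_gp_strict divide_right_mono)
    qed (use K1 in auto)
    also have "K1 * u powr (- (\<beta> + 1)) * (2 * u) = 2 * K1 * u powr (- \<beta>)"
    proof -
      have "u powr (- (\<beta> + 1)) * u = u powr (- (\<beta> + 1) + 1)" using u by (subst powr_add) simp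
      then show ?thesis by simp
    qed
    finally show "(\<Sum>m<n. ?T m) \<le> K * (1 - ln t) powr (- \<beta>)"
      by (simp add: K_def u_def algebra_simps)
  qed
qed

text \<open>No convergence is assumed: if the norms are not summable, the right side is
  \<open>\<infinity>\<close> and the default value on the left does no harm.\<close>

lemma cmod_suminf_le: "ennreal (cmod (\<Sum>m. g m)) \<le> (\<Sum>m. ennreal (cmod (g m)))" for g :: "nat \<Rightarrow> complex"
proof (cases "summable (\<lambda>m. cmod (g m))")
  case True
  then show ?thesis by (simp add: suminf_ennreal2 ennreal_leI summable_norm)
next
  case False
  then have "(\<Sum>m. ennreal (cmod (g m))) = \<infinity>"
    by (metis infinity_ennreal_def norm_ge_zero summable_suminf_not_top)
  then show ?thesis by simp
qed

text \<open>Block \<open>m\<close> uses the frequencies \<open>2 ^ j\<close> with \<open>j \<in> J m\<close>; the coefficient \<open>coef m\<close> makes its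
  \<open>L_p\<close> norm comparable to \<open>2 powr (- \<beta> * m)\<close>.\<close>

locale lacunary =
  fixes \<sigma> p r \<beta> :: real and e :: "'a::euclidean_space" and J :: "nat \<Rightarrow> nat set"
  assumes p: "p > 1" and norm_e: "norm e = 1" and adm: "admissible \<sigma> p r" and \<beta>: "\<beta> > 0"
    and J: "\<And>m. J m \<subseteq> {2 ^ m..<2 ^ Suc m}" "\<And>m. J m \<noteq> {}"
begin

definition coef :: "nat \<Rightarrow> real" where
  "coef m = real (card (J m)) powr (- (1 / r)) * 2 powr (- \<beta> * real m)"

definition F :: "nat \<Rightarrow> 'a \<Rightarrow> complex" where
  "F m x = of_real (coef m) * (\<Sum>j\<in>J m. gwave \<sigma> e j x)"

text \<open>Convergence holds almost everywhere by \<open>f_Lp\<close>; the values of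
  \<open>suminf\<close> on the remaining null set affect neither norms nor pairings.\<close>

definition f :: "'a \<Rightarrow> complex" where
  "f x = (\<Sum>m. F m x)"

lemma finite_J [simp]: "finite (J m)"
  using J(1) finite_subset by blast

lemma card_J: "0 < card (J m)" "card (J m) \<le> 2 ^ m"
  using J card_mono[OF _ J(1)[of m]] by (auto simp: card_gt_0_iff)

lemma r_pos: "r > 0" using adm p by (auto simp: admissible_def)

lemma coef_pos: "coef m > 0"
  using J(2)[of m] by (simp add: coef_def)

lemma coef_le: "coef m \<le> 2 powr (- \<beta> * real m)"
proof -
  have "real (card (J m)) powr (- (1 / r)) \<le> 1"
  proof -
    have "1 \<le> real (card (J m)) powr (1 / r)"
      using card_J(1)[of m] r_pos by (intro ge_one_powr_ge_zero) auto
    then show ?thesis using J(2)[of m] by (simp add: powr_minus_divide)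
  qed
  then show ?thesis by (simp add: coef_def mult_left_le_one_le)
qed

lemma F_measurable [measurable]: "F m \<in> borel_measurable borel"
  unfolding F_def by measurable

lemma f_measurable [measurable]: "f \<in> borel_measurable borel"
  unfolding f_def by measurable

lemma F_Lp_le:
  obtains C where "C > 0"
    "\<And>m. (\<integral>\<^sup>+x. ennreal (cmod (F m x) powr p) \<partial>lborel) \<le> ennreal ((C * 2 powr (- \<beta> * real m)) powr p)"
proof -
  obtain C where C: "C > 0" "\<And>J. finite J \<Longrightarrow> J \<noteq> {} \<Longrightarrow>
      (\<integral>\<^sup>+x. ennreal (cmod (\<Sum>j\<in>J. gwave \<sigma> e j x) powr p) \<partial>lborel) \<le> ennreal ((C * real (card J) powr (1 / r)) powr p)"
    using gwave_sum_Lp_le[OF _ norm_e adm] p by auto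
  show ?thesis
  proof (rule that[OF C(1)])
    fix m
    have "(\<integral>\<^sup>+x. ennreal (cmod (F m x) powr p) \<partial>lborel)
        = (\<integral>\<^sup>+x. ennreal (coef m powr p) * ennreal (cmod (\<Sum>j\<in>J m. gwave \<sigma> e j x) powr p) \<partial>lborel)"
      using coef_pos[of m] by (simp add: F_def norm_mult powr_mult ennreal_mult)
    also have "\<dots> = ennreal (coef m powr p) * (\<integral>\<^sup>+x. ennreal (cmod (\<Sum>j\<in>J m. gwave \<sigma> e j x) powr p) \<partial>lborel)"
      by (rule nn_integral_cmult) measurable
    also have "\<dots> \<le> ennreal (coef m powr p) * ennreal ((C * real (card (J m)) powr (1 / r)) powr p)"
      using J by (intro mult_left_mono C) auto
    also have "\<dots> = ennreal ((coef m * (C * real (card (J m)) powr (1 / r))) powr p)"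
      by (simp only: powr_mult[of "coef m"] ennreal_mult powr_ge_zero)
    also have "coef m * (C * real (card (J m)) powr (1 / r)) = C * 2 powr (- \<beta> * real m)"
      using J(2)[of m] by (simp add: coef_def powr_minus field_simps)
    finally show "(\<integral>\<^sup>+x. ennreal (cmod (F m x) powr p) \<partial>lborel) \<le> ennreal ((C * 2 powr (- \<beta> * real m)) powr p)" .
  qed
qed

text \<open>Two bounds are combined: twice the norm of \<open>F m\<close>, and the Bernstein bounds
  of the packets added by Minkowski's inequality, where the frequencies sum to at most
  \<open>2 ^ 2 ^ Suc m\<close>. The second ignores orthogonality, which is harmless because the step
  size matters only through its logarithm. A nonzero \<open>h\<close> keeps the bounds positive, as
  \<open>nn_Minkowski_sum\<close> requires.\<close>

lemma F_diff_Lp_le: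
  obtains C where "C > 0"
    "\<And>m h. 0 < norm h \<Longrightarrow> norm h \<le> 1 \<Longrightarrow>
      (\<integral>\<^sup>+x. ennreal (cmod (F m (x + h) - F m x) powr p) \<partial>lborel)
         \<le> ennreal ((C * (2 powr (- \<beta> * real m) * min 1 (2 ^ 2 ^ Suc m * norm h))) powr p)"
proof -
  obtain C1 where C1: "C1 > 0"
    "\<And>m. (\<integral>\<^sup>+x. ennreal (cmod (F m x) powr p) \<partial>lborel) \<le> ennreal ((C1 * 2 powr (- \<beta> * real m)) powr p)"
    using F_Lp_le by blast
  obtain C2 where C2: "C2 > 0" "\<And>j h. norm h \<le> 1 \<Longrightarrow>
      (\<integral>\<^sup>+x. ennreal (cmod (gwave \<sigma> e j (x + h) - gwave \<sigma> e j x) powr p) \<partial>lborel) \<le> ennreal ((C2 * 2 ^ j * norm h) powr p)"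
    using gwave_diff_Lp_le[OF _ norm_e, of p \<sigma>] p by auto
  show ?thesis
  proof (rule that[of "max (2 * C1) C2"])
    show "max (2 * C1) C2 > 0" using C1 by (simp add: less_max_iff_disj)
    fix m and h :: 'a assume h: "0 < norm h" "norm h \<le> 1"
    let ?a = "2 powr (- \<beta> * real m)" and ?I = "\<integral>\<^sup>+x. ennreal (cmod (F m (x + h) - F m x) powr p) \<partial>lborel"
    have "?I \<le> ennreal ((2 * (C1 * ?a)) powr p)"
      using p C1 by (intro diff_Lp_le) auto
    also have "\<dots> \<le> ennreal ((max (2 * C1) C2 * (?a * 1)) powr p)"
      using p C1 by (intro ennreal_leI powr_mono2) auto
    finally have 1: "?I \<le> ennreal ((max (2 * C1) C2 * (?a * 1)) powr p)" .
    have "?I \<le> (\<integral>\<^sup>+x. ennreal ((\<Sum>j\<in>J m. coef m * cmod (gwave \<sigma> e j (x + h) - gwave \<sigma> e j x)) powr p) \<partial>lborel)"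
    proof (intro nn_integral_mono ennreal_leI powr_mono2)
      fix x
      have "F m (x + h) - F m x = of_real (coef m) * (\<Sum>j\<in>J m. gwave \<sigma> e j (x + h) - gwave \<sigma> e j x)"
        by (simp add: F_def sum_subtractf right_diff_distrib)
      then have "cmod (F m (x + h) - F m x) = coef m * cmod (\<Sum>j\<in>J m. gwave \<sigma> e j (x + h) - gwave \<sigma> e j x)"
        using coef_pos[of m] by (simp add: norm_mult)
      also have "\<dots> \<le> coef m * (\<Sum>j\<in>J m. cmod (gwave \<sigma> e j (x + h) - gwave \<sigma> e j x))"
        using coef_pos[of m] by (intro mult_left_mono norm_sum) auto
      finally show "cmod (F m (x + h) - F m x) \<le> (\<Sum>j\<in>J m. coef m * cmod (gwave \<sigma> e j (x + h) - gwave \<sigma> e j x))"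
        by (simp add: sum_distrib_left)
    qed (use p in auto)
    also have "\<dots> \<le> ennreal ((\<Sum>j\<in>J m. coef m * (C2 * 2 ^ j * norm h)) powr p)"
    proof (rule nn_Minkowski_sum)
      fix j
      have "(\<integral>\<^sup>+x. ennreal ((coef m * cmod (gwave \<sigma> e j (x + h) - gwave \<sigma> e j x)) powr p) \<partial>lborel)
          = ennreal (coef m powr p) * (\<integral>\<^sup>+x. ennreal (cmod (gwave \<sigma> e j (x + h) - gwave \<sigma> e j x) powr p) \<partial>lborel)"
        using coef_pos[of m] by (subst nn_integral_cmult[symmetric]) (auto simp: powr_mult ennreal_mult)
      also have "\<dots> \<le> ennreal (coef m powr p) * ennreal ((C2 * 2 ^ j * norm h) powr p)"
        using h by (intro mult_left_mono C2) auto
      also have "\<dots> = ennreal ((coef m * (C2 * 2 ^ j * norm h)) powr p)"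
        by (simp only: powr_mult[of "coef m"] ennreal_mult powr_ge_zero)
      finally show "(\<integral>\<^sup>+x. ennreal ((coef m * cmod (gwave \<sigma> e j (x + h) - gwave \<sigma> e j x)) powr p) \<partial>lborel)
          \<le> ennreal ((coef m * (C2 * 2 ^ j * norm h)) powr p)" .
    qed (use p h C2(1) coef_pos[of m] in \<open>auto intro!: mult_nonneg_nonneg\<close>)
    also have "\<dots> \<le> ennreal ((max (2 * C1) C2 * (?a * (2 ^ 2 ^ Suc m * norm h))) powr p)"
    proof (intro ennreal_leI powr_mono2)
      have "(\<Sum>j\<in>J m. coef m * (C2 * 2 ^ j * norm h)) = C2 * (coef m * ((\<Sum>j\<in>J m. 2 ^ j) * norm h))"
        by (simp add: sum_distrib_left sum_distrib_right mult_ac)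
      also have "\<dots> \<le> max (2 * C1) C2 * (?a * (2 ^ 2 ^ Suc m * norm h))"
      proof (intro mult_mono coef_le)
        have "(\<Sum>j\<in>J m. 2 ^ j) \<le> (\<Sum>j<2 ^ Suc m. (2::real) ^ j)"
          using J(1)[of m] by (intro sum_mono2) auto
        also have "\<dots> \<le> 2 ^ 2 ^ Suc m" by (simp only: sum_gp_strict) simp
        finally show "(\<Sum>j\<in>J m. 2 ^ j) \<le> (2 ^ 2 ^ Suc m :: real)" .
      qed (use C2 C1 coef_pos[of m] h in \<open>auto intro!: mult_nonneg_nonneg sum_nonneg simp: le_max_iff_disj\<close>)
      finally show "(\<Sum>j\<in>J m. coef m * (C2 * 2 ^ j * norm h)) \<le> max (2 * C1) C2 * (?a * (2 ^ 2 ^ Suc m * norm h))" .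
    qed (use p h C2(1) coef_pos[of m] in \<open>auto intro!: mult_nonneg_nonneg sum_nonneg\<close>)
    finally show "?I \<le> ennreal ((max (2 * C1) C2 * (?a * min 1 (2 ^ 2 ^ Suc m * norm h))) powr p)"
      using 1 by (auto simp: min_def)
  qed
qed

lemma sum_block_le: "(\<Sum>m<n. C * 2 powr (- \<beta> * real m)) \<le> C * (1 / (1 - 2 powr (- \<beta>)))" if "C > 0"
proof -
  have \<rho>: "2 powr (- \<beta>) < 1" using \<beta> by (auto simp: powr_minus_divide)
  have "(\<Sum>m<n. C * 2 powr (- \<beta> * real m)) = C * (\<Sum>m<n. (2 powr (- \<beta>)) ^ m)"
    by (simp add: sum_distrib_left powr_realpow[symmetric] powr_powr)
  also have "\<dots> \<le> C * (1 / (1 - 2 powr (- \<beta>)))"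
    using \<rho> that by (intro mult_left_mono) (auto simp: sum_gp_strict divide_right_mono)
  finally show ?thesis .
qed

lemma f_Lp: "Lp_norm p f < \<infinity>" "AE x in lborel. summable (\<lambda>m. cmod (F m x))"
proof -
  obtain C where C: "C > 0"
    "\<And>m. (\<integral>\<^sup>+x. ennreal (cmod (F m x) powr p) \<partial>lborel) \<le> ennreal ((C * 2 powr (- \<beta> * real m)) powr p)"
    using F_Lp_le by blast
  define S where "S = C * (1 / (1 - 2 powr (- \<beta>)))"
  have S: "(\<Sum>m<n. C * 2 powr (- \<beta> * real m)) \<le> S" for n
    unfolding S_def using sum_block_le[OF C(1)] .
  have "S \<ge> 0" using S[of 0] by simp
  have "(\<integral>\<^sup>+x. ennreal (cmod (f x) powr p) \<partial>lborel) \<le> ennreal (S powr p)"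
    by (rule nn_Minkowski_suminf_le[OF _ S _ _ _ C(2)])
       (use p C(1) in \<open>auto simp: f_def cmod_suminf_le\<close>)
  then have "Lp_norm p f \<le> ennreal S" using p \<open>S \<ge> 0\<close> by (intro Lp_norm_le) auto
  then show "Lp_norm p f < \<infinity>" by (simp add: le_less_trans[OF _ ennreal_less_top])
  show "AE x in lborel. summable (\<lambda>m. cmod (F m x))"
    by (rule nn_Minkowski_AE_summable[OF _ S _ _ _ C(2)]) (use p C(1) in auto)
qed

text \<open>The series of differences is estimated at the exact length \<open>norm h\<close>;
  monotonicity of the logarithmic factor then passes to \<open>t\<close>.\<close>

lemma f_diff_Lp_le:
  obtains K where "K > 0"
    "\<And>t h. 0 < t \<Longrightarrow> t < 1 \<Longrightarrow> norm h \<le> t \<Longrightarrow>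
      (\<integral>\<^sup>+x. ennreal (cmod (f (x + h) - f x) powr p) \<partial>lborel) \<le> ennreal ((K * (1 - ln t) powr (- \<beta>)) powr p)"
proof -
  obtain C where C: "C > 0" "\<And>m h. 0 < norm h \<Longrightarrow> norm h \<le> 1 \<Longrightarrow>
      (\<integral>\<^sup>+x. ennreal (cmod (F m (x + h) - F m x) powr p) \<partial>lborel)
         \<le> ennreal ((C * (2 powr (- \<beta> * real m) * min 1 (2 ^ 2 ^ Suc m * norm h))) powr p)"
    using F_diff_Lp_le by blast
  obtain L where L: "L > 0" "\<And>t n. 0 < t \<Longrightarrow> t < 1 \<Longrightarrow>
       (\<Sum>m<n. 2 powr (- \<beta> * real m) * min 1 (2 ^ 2 ^ Suc m * t)) \<le> L * (1 - ln t) powr (- \<beta>)"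
    using lacunary_sum_le[OF \<beta>] by blast
  show ?thesis
  proof (rule that[of "C * L"])
    show "C * L > 0" using C L by simp
    fix t :: real and h :: 'a assume t: "0 < t" "t < 1" "norm h \<le> t"
    show "(\<integral>\<^sup>+x. ennreal (cmod (f (x + h) - f x) powr p) \<partial>lborel) \<le> ennreal ((C * L * (1 - ln t) powr (- \<beta>)) powr p)"
    proof (cases "h = 0")
      case False
      then have h: "0 < norm h" "norm h < 1" using t by auto
      \<comment> \<open>Null sets are translation invariant, so the series converges at
        \<open>x\<close> and at \<open>x + h\<close> for almost every \<open>x\<close>.\<close>
      have "AE x in lborel. summable (\<lambda>m. cmod (F m (x + h)))"
      proof -
        have "AE x in distr lborel borel ((+) h). summable (\<lambda>m. cmod (F m x))"
          unfolding lborel_distr_plus by (rule f_Lp(2))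
        from AE_distrD[OF _ this] show ?thesis by (simp add: add.commute)
      qed
      with f_Lp(2) have ae: "AE x in lborel. ennreal (cmod (f (x + h) - f x)) \<le> (\<Sum>m. ennreal (cmod (F m (x + h) - F m x)))"
      proof eventually_elim
        case (elim x)
        have "f (x + h) - f x = (\<Sum>m. F m (x + h) - F m x)"
          unfolding f_def
          by (rule suminf_diff[OF summable_norm_cancel[OF elim(2)] summable_norm_cancel[OF elim(1)]])
        then show ?case by (simp only: cmod_suminf_le)
      qed
      have "(\<integral>\<^sup>+x. ennreal (cmod (f (x + h) - f x) powr p) \<partial>lborel) \<le> ennreal ((C * L * (1 - ln (norm h)) powr (- \<beta>)) powr p)"
      proof (rule nn_Minkowski_suminf_le[where u = "\<lambda>m x. cmod (F m (x + h) - F m x)"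
            and A = "\<lambda>m. C * (2 powr (- \<beta> * real m) * min 1 (2 ^ 2 ^ Suc m * norm h))", OF _ _ _ _ _ _ _ ae])
        fix n
        have "(\<Sum>m<n. C * (2 powr (- \<beta> * real m) * min 1 (2 ^ 2 ^ Suc m * norm h)))
            = C * (\<Sum>m<n. 2 powr (- \<beta> * real m) * min 1 (2 ^ 2 ^ Suc m * norm h))"
          by (simp only: sum_distrib_left)
        also have "\<dots> \<le> C * (L * (1 - ln (norm h)) powr (- \<beta>))"
          using C h by (intro mult_left_mono L) auto
        finally show "(\<Sum>m<n. C * (2 powr (- \<beta> * real m) * min 1 (2 ^ 2 ^ Suc m * norm h)))
            \<le> C * L * (1 - ln (norm h)) powr (- \<beta>)" by (simp only: mult.assoc)
      qed (use p h C in \<open>auto simp: less_imp_le\<close>)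
      also have "\<dots> \<le> ennreal ((C * L * (1 - ln t) powr (- \<beta>)) powr p)"
      proof (rule ennreal_leI, rule powr_mono2, use p in simp, use C(1) L(1) in simp, rule mult_left_mono)
        have "ln (norm h) \<le> ln t" using t(1,3) h(1) by (subst ln_le_cancel_iff)
        moreover have "ln t < 0" using t(1,2) by (rule ln_less_zero)
        ultimately show "(1 - ln (norm h)) powr (- \<beta>) \<le> (1 - ln t) powr (- \<beta>)"
          using \<beta> by (intro powr_mono2') auto
      qed (use C(1) L(1) in simp)
      finally show ?thesis .
    qed (use p in auto)
  qed
qed

lemma modulus_smoothness_f_le:
  assumes "k \<ge> 1"
  obtains K where "K > 0"
    "\<And>t. 0 < t \<Longrightarrow> t < 1 \<Longrightarrow> modulus_smoothness k p f t \<le> ennreal (K * (1 - ln t) powr (- \<beta>))"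
proof -
  obtain K where K: "K > 0"
    "\<And>t h. 0 < t \<Longrightarrow> t < 1 \<Longrightarrow> norm h \<le> t \<Longrightarrow>
      (\<integral>\<^sup>+x. ennreal (cmod (f (x + h) - f x) powr p) \<partial>lborel) \<le> ennreal ((K * (1 - ln t) powr (- \<beta>)) powr p)"
    using f_diff_Lp_le by blast
  show ?thesis
  proof (rule that[of "2 ^ (k - 1) * K"])
    show "2 ^ (k - 1) * K > 0" using K by simp
    fix t :: real assume t: "0 < t" "t < 1"
    then have "1 - ln t > 0" by (smt (verit) ln_less_zero)
    then have pos: "K * (1 - ln t) powr (- \<beta>) > 0" using K by simp
    show "modulus_smoothness k p f t \<le> ennreal (2 ^ (k - 1) * K * (1 - ln t) powr (- \<beta>))"
      unfolding modulus_smoothness_def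
    proof (rule SUP_least)
      fix h :: 'a assume "h \<in> {h. norm h \<le> t}"
      then have h: "norm h \<le> t" by simp
      show "Lp_norm p (iter_diff k h f) \<le> ennreal (2 ^ (k - 1) * K * (1 - ln t) powr (- \<beta>))"
        using iter_diff_Lp_le[OF f_measurable _ pos K(2)[OF t h], of "k - 1"] p assms K(1)
        by (intro Lp_norm_le) (auto simp: mult.assoc)
    qed
  qed
qed

end


section \<open>The modulus of smoothness of the lacunary sum\<close>

lemma ennreal_powr_le:
  assumes "x \<le> ennreal c" "c \<ge> 0" "Q > 0"
  shows "ennreal_powr x Q \<le> ennreal (c powr Q)"
proof -
  have "x \<noteq> \<infinity>" using assms(1) by (auto simp: top_unique)
  moreover have "enn2real x \<le> c" using assms by (intro enn2real_leI) auto
  ultimately show ?thesis using assms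
    by (auto simp: ennreal_powr_def intro!: ennreal_leI powr_mono2)
qed

lemma ennreal_powr_less_top: "x < \<infinity> \<Longrightarrow> ennreal_powr x Q < \<infinity>"
  by (auto simp: ennreal_powr_def)

text \<open>The integrand has the antiderivative
  \<open>(1 - ln t) powr (- \<delta>) / \<delta>\<close>, which rises from 0 at 0 to
  \<open>1 / \<delta>\<close> at 1.\<close>

lemma nn_integral_log_powr_finite:
  fixes \<delta> :: real
  assumes \<delta>: "\<delta> > 0"
  shows "(\<integral>\<^sup>+t\<in>{0<..<1}. ennreal ((1 - ln t) powr (- (1 + \<delta>)) * (1 / t)) \<partial>lborel) < \<infinity>"
proof -
  let ?f = "\<lambda>t. (1 - ln t) powr (- (1 + \<delta>)) * (1 / t)"
  let ?F = "\<lambda>t. (1 - ln t) powr (- \<delta>) / \<delta>"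
  have pos: "1 - ln t > 0" if "0 < t" "t < 1" for t :: real
    using ln_less_zero[OF that] by linarith
  have "set_integrable lborel (einterval 0 1) ?f"
  proof (rule interval_integral_FTC_nonneg(1)[where F = ?F and A = 0 and B = "inverse \<delta>"])
    fix t :: real assume t: "(0::ereal) < ereal t" "ereal t < 1"
    then have t': "0 < t" "t < 1" by (simp_all add: zero_ereal_def one_ereal_def)
    show "DERIV ?F t :> ?f t"
      using t' pos[OF t'] \<delta>
      by (auto intro!: derivative_eq_intros simp: powr_diff powr_minus field_simps powr_add)
    show "isCont ?f t"
      using t' pos[OF t'] by (intro continuous_intros) auto
  next
    show "AE x in lborel. (0::ereal) < ereal x \<longrightarrow> ereal x < 1 \<longrightarrow> 0 \<le> ?f x"
      by (intro AE_I2) (simp add: zero_ereal_def)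
  next
    have "(?F \<longlongrightarrow> 0) (at_right 0)" using \<delta> by real_asymp
    then show "((?F \<circ> real_of_ereal) \<longlongrightarrow> 0) (at_right 0)"
      unfolding zero_ereal_def ereal_tendsto_simps .
    have "(?F \<longlongrightarrow> inverse \<delta>) (at_left 1)" using \<delta> by real_asymp
    then show "((?F \<circ> real_of_ereal) \<longlongrightarrow> inverse \<delta>) (at_left 1)"
      unfolding one_ereal_def ereal_tendsto_simps .
  qed simp
  then have "(\<integral>\<^sup>+t. ennreal (norm (indicator (einterval 0 1) t *\<^sub>R ?f t)) \<partial>lborel) < \<infinity>"
    unfolding set_integrable_def integrable_iff_bounded by simp
  also have "(\<integral>\<^sup>+t. ennreal (norm (indicator (einterval 0 1) t *\<^sub>R ?f t)) \<partial>lborel)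
      = (\<integral>\<^sup>+t\<in>{0<..<1}. ennreal (?f t) \<partial>lborel)"
    by (intro nn_integral_cong) (auto simp: einterval_def indicator_def zero_ereal_def one_ereal_def)
  finally show ?thesis .
qed

context lacunary
begin

text \<open>For finite \<open>q\<close> the assumption on \<open>b\<close> says
  \<open>(\<beta> - b) * q > 1\<close>, which makes the logarithmic integral converge at 0. For
  \<open>q = \<infinity>\<close> the term \<open>enn2real (1 / q)\<close> is 0 and only boundedness
  of the weighted modulus is asked.\<close>

lemma f_in_diff_Besov_space:
  assumes k: "k \<ge> 1" and q: "0 < q" and b: "b + enn2real (1 / q) < \<beta>"
  shows "f \<in> diff_Besov_space k p q b"
proof -
  obtain K where K: "K > 0"
    "\<And>t. 0 < t \<Longrightarrow> t < 1 \<Longrightarrow> modulus_smoothness k p f t \<le> ennreal (K * (1 - ln t) powr (- \<beta>))"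
    using modulus_smoothness_f_le[OF k] by blast
  have u: "1 - ln t \<ge> 1" if "0 < t" "t < 1" for t :: real
    using ln_less_zero[OF that] by linarith
  have le: "ennreal ((1 - ln t) powr b) * modulus_smoothness k p f t \<le> ennreal (K * (1 - ln t) powr (b - \<beta>))"
    if t: "0 < t" "t < 1" for t :: real
  proof -
    have "ennreal ((1 - ln t) powr b) * modulus_smoothness k p f t
        \<le> ennreal ((1 - ln t) powr b) * ennreal (K * (1 - ln t) powr (- \<beta>))"
      using K(2)[OF t] by (intro mult_left_mono) auto
    also have "\<dots> = ennreal ((1 - ln t) powr b * (K * (1 - ln t) powr (- \<beta>)))"
      using K(1) by (simp add: ennreal_mult)
    also have "(1 - ln t) powr b * (K * (1 - ln t) powr (- \<beta>)) = K * (1 - ln t) powr (b - \<beta>)"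
      by (simp add: powr_diff powr_minus field_simps)
    finally show ?thesis .
  qed
  have "diff_Besov_seminorm k p q b f < \<infinity>"
  proof (cases "q = \<infinity>")
    case True
    then have "b \<le> \<beta>" using b by simp
    have "diff_Besov_seminorm k p q b f \<le> ennreal K"
      unfolding diff_Besov_seminorm_def using True
    proof (simp, intro SUP_least)
      fix t :: real assume "t \<in> {0<..<1}"
      then have t: "0 < t" "t < 1" by auto
      have "K * (1 - ln t) powr (b - \<beta>) \<le> K"
        using K(1) \<open>b \<le> \<beta>\<close> u[OF t] powr_mono2'[of "b - \<beta>" 1 "1 - ln t"] by (intro mult_left_le) auto
      with le[OF t] show "ennreal ((1 - ln t) powr b) * modulus_smoothness k p f t \<le> ennreal K"
        by (meson ennreal_leI order_trans)
    qed
    then show ?thesis by (simp add: le_less_trans[OF _ ennreal_less_top])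
  next
    case False
    define Q where "Q = enn2real q"
    have Q: "Q > 0" using q False by (simp add: Q_def enn2real_positive_iff less_top)
    have "enn2real (1 / q) = 1 / Q"
      using Q False by (cases q) (auto simp: Q_def divide_ennreal simp flip: ennreal_1)
    then have "1 / Q < \<beta> - b" using b by simp
    then have \<delta>: "(\<beta> - b) * Q - 1 > 0" using Q by (simp add: pos_divide_less_eq)
    \<comment> \<open>The margin by which the exponent of \<open>1 - ln t\<close> passes the
      critical value 1.\<close>
    define \<delta> where "\<delta> = (\<beta> - b) * Q - 1"
    have "(\<integral>\<^sup>+t\<in>{0<..<1}. ennreal_powr (ennreal ((1 - ln t) powr b) * modulus_smoothness k p f t) Q * ennreal (1 / t) \<partial>lborel)
       \<le> (\<integral>\<^sup>+t. ennreal (K powr Q) * (ennreal ((1 - ln t) powr (- (1 + \<delta>)) * (1 / t)) * indicator {0<..<1} t) \<partial>lborel)"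
    proof (intro nn_integral_mono)
      fix t :: real
      show "ennreal_powr (ennreal ((1 - ln t) powr b) * modulus_smoothness k p f t) Q * ennreal (1 / t) * indicator {0<..<1} t
         \<le> ennreal (K powr Q) * (ennreal ((1 - ln t) powr (- (1 + \<delta>)) * (1 / t)) * indicator {0<..<1} t)"
      proof (cases "t \<in> {0<..<1}")
        case True
        then have t: "0 < t" "t < 1" by auto
        have "ennreal_powr (ennreal ((1 - ln t) powr b) * modulus_smoothness k p f t) Q * ennreal (1 / t)
            \<le> ennreal ((K * (1 - ln t) powr (b - \<beta>)) powr Q) * ennreal (1 / t)"
          using K(1) Q by (intro mult_right_mono ennreal_powr_le le t) auto
        also have "(K * (1 - ln t) powr (b - \<beta>)) powr Q = K powr Q * (1 - ln t) powr (- (1 + \<delta>))"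
          by (simp add: powr_mult powr_powr \<delta>_def algebra_simps)
        also have "ennreal (K powr Q * (1 - ln t) powr (- (1 + \<delta>))) * ennreal (1 / t)
            = ennreal (K powr Q) * ennreal ((1 - ln t) powr (- (1 + \<delta>)) * (1 / t))"
          using t by (simp only: ennreal_mult[symmetric] mult_nonneg_nonneg powr_ge_zero mult.assoc zero_le_divide_1_iff less_imp_le)
        finally show ?thesis using True by simp
      qed simp
    qed
    also have "\<dots> = ennreal (K powr Q) * (\<integral>\<^sup>+t\<in>{0<..<1}. ennreal ((1 - ln t) powr (- (1 + \<delta>)) * (1 / t)) \<partial>lborel)"
      by (rule nn_integral_cmult) measurable
    also have "\<dots> < \<infinity>"
      using nn_integral_log_powr_finite[of \<delta>] \<delta> by (simp add: ennreal_mult_less_top \<delta>_def)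
    finally show ?thesis
      using False ennreal_powr_less_top by (simp add: diff_Besov_seminorm_def Q_def)
  qed
  then show ?thesis
    using f_Lp(1) unfolding diff_Besov_space_def Lp_space_def by simp
qed

end


section \<open>Littlewood--Paley functions and decay of Fourier transforms\<close>

lemma Schwartz_differentiable: "\<phi> \<in> Schwartz \<Longrightarrow> \<phi> differentiable (at x)"
  unfolding Schwartz_def by (auto dest: spec[of _ "[]"])

lemma Schwartz_continuous: "\<phi> \<in> Schwartz \<Longrightarrow> continuous_on UNIV \<phi>"
  by (simp add: Schwartz_differentiable differentiable_imp_continuous_within continuous_on_eq_continuous_within)

lemma Schwartz_measurable: "\<phi> \<in> Schwartz \<Longrightarrow> \<phi> \<in> borel_measurable borel"
  by (intro borel_measurable_continuous_onI Schwartz_continuous)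

lemma Schwartz_iter_deriv_bounded:
  assumes "\<phi> \<in> Schwartz" "set vs \<subseteq> Basis"
  obtains B where "B \<ge> 0" "\<And>x. cmod (iter_deriv vs \<phi> x) \<le> B"
proof -
  have "bounded (range (\<lambda>x. (1 + norm x) ^ 0 *\<^sub>R iter_deriv vs \<phi> x))"
    using assms unfolding Schwartz_def by blast
  then obtain B where "\<And>x. cmod (iter_deriv vs \<phi> x) \<le> B"
    unfolding bounded_iff by auto
  moreover from this have "B \<ge> 0" using norm_ge_zero order_trans by blast
  ultimately show ?thesis using that by blast
qed

text \<open>Bounded first partial derivatives and the mean value inequality; this is the smoothness
  that the kernel decay rests on.\<close>

lemma Schwartz_Lipschitz:
  fixes \<phi> :: "'a::euclidean_space \<Rightarrow> complex"
  assumes "\<phi> \<in> Schwartz"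
  obtains L where "L \<ge> 0" "\<And>x y. cmod (\<phi> x - \<phi> y) \<le> L * norm (x - y)"
proof -
  have "\<exists>B. \<forall>b\<in>Basis. B b \<ge> 0 \<and> (\<forall>x. cmod (frechet_derivative \<phi> (at x) b) \<le> B b)"
  proof (intro bchoice ballI)
    fix b :: 'a assume "b \<in> Basis"
    then obtain B where "B \<ge> 0" "\<And>x. cmod (iter_deriv [b] \<phi> x) \<le> B"
      using Schwartz_iter_deriv_bounded[OF assms, of "[b]"] by auto
    then show "\<exists>B. B \<ge> 0 \<and> (\<forall>x. cmod (frechet_derivative \<phi> (at x) b) \<le> B)" by auto
  qed
  then obtain B where B: "\<And>b. b \<in> Basis \<Longrightarrow> B b \<ge> 0"
      "\<And>b x. b \<in> Basis \<Longrightarrow> cmod (frechet_derivative \<phi> (at x) b) \<le> B b" by blast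
  have der: "(\<phi> has_derivative frechet_derivative \<phi> (at x)) (at x)" for x
    using Schwartz_differentiable[OF assms] frechet_derivative_works by blast
  have "cmod (frechet_derivative \<phi> (at x) h) \<le> (\<Sum>b\<in>Basis. B b) * norm h" for x h
  proof -
    interpret bounded_linear "frechet_derivative \<phi> (at x)" using der has_derivative_bounded_linear by blast
    have "frechet_derivative \<phi> (at x) h = frechet_derivative \<phi> (at x) (\<Sum>b\<in>Basis. (h \<bullet> b) *\<^sub>R b)"
      by (simp add: euclidean_representation)
    also have "\<dots> = (\<Sum>b\<in>Basis. (h \<bullet> b) *\<^sub>R frechet_derivative \<phi> (at x) b)"
      by (simp add: sum scaleR)
    also have "cmod \<dots> \<le> (\<Sum>b\<in>Basis. norm h * B b)"
      by (rule order_trans[OF norm_sum]) (auto intro!: sum_mono mult_mono B Basis_le_norm)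
    finally show ?thesis by (simp add: sum_distrib_left mult.commute)
  qed
  then have "cmod (\<phi> x - \<phi> y) \<le> (\<Sum>b\<in>Basis. B b) * norm (x - y)" for x y
    by (intro differentiable_bound[where S = UNIV and f' = "\<lambda>x. frechet_derivative \<phi> (at x)"])
       (auto intro!: onorm_le der simp: mult.commute)
  then show ?thesis using that B by (meson sum_nonneg)
qed

text \<open>The bound \<open>B\<close> is common to all \<open>j\<close>, as the estimates of the
  tails and the limit in \<open>j\<close> require; the Lipschitz constant may depend on
  \<open>j\<close>, since it yields decay of one kernel at a time.\<close>

lemma LP_function_props:
  fixes \<phi>0 :: "'a::euclidean_space \<Rightarrow> complex"
  assumes "LP_generator \<phi>0"
  shows LP_function_measurable: "LP_function \<phi>0 j \<in> borel_measurable borel"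
    and LP_function_bounded: "\<exists>B\<ge>0. \<forall>j x. cmod (LP_function \<phi>0 j x) \<le> B"
    and LP_function_Lipschitz: "\<exists>L\<ge>0. \<forall>x y. cmod (LP_function \<phi>0 j x - LP_function \<phi>0 j y) \<le> L * norm (x - y)"
proof -
  have S: "\<phi>0 \<in> Schwartz" using assms by (simp add: LP_generator_def)
  note [measurable] = Schwartz_measurable[OF S]
  show "LP_function \<phi>0 j \<in> borel_measurable borel"
    unfolding LP_function_def by (cases "j = 0") auto
  obtain B where B: "B \<ge> 0" "\<And>x. cmod (\<phi>0 x) \<le> B"
    using Schwartz_iter_deriv_bounded[OF S, of "[]"] by auto
  have "cmod (LP_function \<phi>0 j x) \<le> 2 * B" for j x
  proof (cases "j = 0")
    case True
    then show ?thesis using B(1) B(2)[of x] by (simp add: LP_function_def)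
  next
    case False
    then show ?thesis unfolding LP_function_def
      by simp (rule order_trans[OF norm_triangle_ineq4], rule order_trans[OF add_mono[OF B(2) B(2)]], simp)
  qed
  then show "\<exists>B\<ge>0. \<forall>j x. cmod (LP_function \<phi>0 j x) \<le> B"
    using B(1) by (intro exI[of _ "2 * B"]) auto
  obtain L where L: "L \<ge> 0" "\<And>x y. cmod (\<phi>0 x - \<phi>0 y) \<le> L * norm (x - y)"
    using Schwartz_Lipschitz[OF S] by blast
  have scale: "cmod (\<phi>0 (a *\<^sub>R x) - \<phi>0 (a *\<^sub>R y)) \<le> L * (a * norm (x - y))" if "a \<ge> 0" for a x y
    using L(2)[of "a *\<^sub>R x" "a *\<^sub>R y"] that by (simp add: scaleR_diff_right[symmetric])
  show "\<exists>L\<ge>0. \<forall>x y. cmod (LP_function \<phi>0 j x - LP_function \<phi>0 j y) \<le> L * norm (x - y)"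
  proof (cases "j = 0")
    case True
    then show ?thesis using L by (auto simp: LP_function_def)
  next
    case False
    define a where "a = 2 powr (- real j)"
    define c where "c = 2 powr (- real j + 1)"
    have "cmod (LP_function \<phi>0 j x - LP_function \<phi>0 j y) \<le> (L * (a + c)) * norm (x - y)" for x y
    proof -
      have "LP_function \<phi>0 j x - LP_function \<phi>0 j y
          = (\<phi>0 (a *\<^sub>R x) - \<phi>0 (a *\<^sub>R y)) - (\<phi>0 (c *\<^sub>R x) - \<phi>0 (c *\<^sub>R y))"
        using False by (simp add: LP_function_def a_def c_def)
      also have "cmod \<dots> \<le> L * (a * norm (x - y)) + L * (c * norm (x - y))"
        by (rule order_trans[OF norm_triangle_ineq4]) (auto intro!: add_mono scale simp: a_def c_def)
      finally show ?thesis by (simp add: algebra_simps)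
    qed
    moreover have "L * (a + c) \<ge> 0" using L(1) by (simp add: a_def c_def)
    ultimately show ?thesis by blast
  qed
qed

text \<open>The sphere \<open>norm x = 2\<close> matters: the function of index \<open>j > 0\<close>
  at the frequency \<open>2 ^ j *\<^sub>R e\<close> involves the generator at
  \<open>2 *\<^sub>R e\<close>. Such a point is a limit of points outside the support.\<close>

lemma LP_generator_eq_0:
  assumes "LP_generator \<phi>0" "norm x \<ge> 2"
  shows "\<phi>0 x = 0"
proof -
  have S: "\<phi>0 \<in> Schwartz" and supp: "closure {x. \<phi>0 x \<noteq> 0} \<subseteq> {x. norm x \<le> 2}"
    using assms(1) by (auto simp: LP_generator_def)
  have "(\<lambda>n. \<phi>0 ((1 + 1 / real (Suc n)) *\<^sub>R x)) \<longlonglongrightarrow> \<phi>0 ((1 + 0) *\<^sub>R x)"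
  proof (rule isCont_tendsto_compose[where g = \<phi>0])
    show "isCont \<phi>0 ((1 + 0) *\<^sub>R x)"
      using Schwartz_continuous[OF S] continuous_on_eq_continuous_at by blast
    show "(\<lambda>n. (1 + 1 / real (Suc n)) *\<^sub>R x) \<longlonglongrightarrow> (1 + 0) *\<^sub>R x"
      by (intro tendsto_intros LIMSEQ_Suc lim_1_over_n)
  qed
  moreover have "\<phi>0 ((1 + 1 / real (Suc n)) *\<^sub>R x) = 0" for n
  proof -
    have "2 < (1 + 1 / real (Suc n)) * 2" by simp
    also have "\<dots> \<le> (1 + 1 / real (Suc n)) * norm x"
      using assms(2) by (intro mult_left_mono) auto
    finally have "\<not> norm ((1 + 1 / real (Suc n)) *\<^sub>R x) \<le> 2" by simp
    moreover have "{x. \<phi>0 x \<noteq> 0} \<subseteq> {x. norm x \<le> 2}"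
      using closure_subset supp by (rule subset_trans)
    ultimately show ?thesis by auto
  qed
  ultimately show ?thesis by (simp add: LIMSEQ_const_iff)
qed

text \<open>After recentring, the arguments of the two generators tend to \<open>e\<close> and
  \<open>2 *\<^sub>R e\<close>, so the symbol tends to
  \<open>\<phi>0 e - \<phi>0 (2 *\<^sub>R e) = 1\<close> pointwise, dominated by \<open>B\<close>.
  Each block thus sees its own packet with asymptotically full mass.\<close>

lemma LP_function_diagonal_limit:
  fixes \<phi>0 :: "'a::euclidean_space \<Rightarrow> complex"
  assumes LP: "LP_generator \<phi>0" and e: "norm e = 1"
  shows "(\<lambda>j. LINT \<xi>|lborel. LP_function \<phi>0 j \<xi> * of_real (gauss 1 (\<xi> - 2 ^ j *\<^sub>R e)))
           \<longlonglongrightarrow> of_real (LINT \<xi>::'a|lborel. gauss 1 \<xi>)"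
proof -
  have S: "\<phi>0 \<in> Schwartz" using LP by (simp add: LP_generator_def)
  note [measurable] = LP_function_measurable[OF LP]
  obtain B where B: "B \<ge> 0" "\<And>j x. cmod (LP_function \<phi>0 j x) \<le> B"
    using LP_function_bounded[OF LP] by blast
  have shift: "(LINT \<xi>|lborel. LP_function \<phi>0 j \<xi> * of_real (gauss 1 (\<xi> - 2 ^ j *\<^sub>R e)))
      = (LINT \<xi>|lborel. LP_function \<phi>0 j (\<xi> + 2 ^ j *\<^sub>R e) * of_real (gauss 1 \<xi>))" for j
    by (subst integral_lborel_shift[symmetric, where c = "2 ^ j *\<^sub>R e"]) auto
  have "(\<lambda>j. LINT \<xi>|lborel. LP_function \<phi>0 j (\<xi> + 2 ^ j *\<^sub>R e) * of_real (gauss 1 \<xi>))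
      \<longlonglongrightarrow> (LINT \<xi>::'a|lborel. complex_of_real (gauss 1 \<xi>))"
  proof (rule integral_dominated_convergence[where w = "\<lambda>\<xi>. B * gauss 1 \<xi>"])
    show "AE \<xi> in lborel. (\<lambda>j. LP_function \<phi>0 j (\<xi> + 2 ^ j *\<^sub>R e) * of_real (gauss 1 \<xi>)) \<longlonglongrightarrow> complex_of_real (gauss 1 \<xi>)"
    proof (intro AE_I2)
      fix \<xi> :: 'a
      have cont: "isCont \<phi>0 x" for x
        using Schwartz_continuous[OF S] continuous_on_eq_continuous_at by blast
      have 0: "(\<lambda>j. (1/2) ^ j :: real) \<longlonglongrightarrow> 0" by (rule LIMSEQ_power_zero) simp
      have lim: "(\<lambda>j. (1/2) ^ j *\<^sub>R \<xi> + e) \<longlonglongrightarrow> 0 *\<^sub>R \<xi> + e"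
          "(\<lambda>j. (2 * (1/2) ^ j) *\<^sub>R \<xi> + 2 *\<^sub>R e) \<longlonglongrightarrow> (2 * 0) *\<^sub>R \<xi> + 2 *\<^sub>R e"
        by (rule tendsto_add[OF tendsto_scaleR[OF 0 tendsto_const] tendsto_const],
            rule tendsto_add[OF tendsto_scaleR[OF tendsto_mult[OF tendsto_const 0] tendsto_const] tendsto_const])
      have "(\<lambda>j. \<phi>0 ((1/2) ^ j *\<^sub>R \<xi> + e) - \<phi>0 ((2 * (1/2) ^ j) *\<^sub>R \<xi> + 2 *\<^sub>R e)) \<longlonglongrightarrow> \<phi>0 e - \<phi>0 (2 *\<^sub>R e)"
        using isCont_tendsto_compose[OF cont lim(1)] isCont_tendsto_compose[OF cont lim(2)]
        by (intro tendsto_diff) auto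
      moreover have "\<phi>0 e = 1" using LP e by (simp add: LP_generator_def)
      moreover have "\<phi>0 (2 *\<^sub>R e) = 0" using LP_generator_eq_0[OF LP] e by simp
      ultimately have "(\<lambda>j. \<phi>0 ((1/2) ^ j *\<^sub>R \<xi> + e) - \<phi>0 ((2 * (1/2) ^ j) *\<^sub>R \<xi> + 2 *\<^sub>R e)) \<longlonglongrightarrow> 1"
        by simp
      \<comment> \<open>Only for \<open>j > 0\<close>, as the function of index 0 is the generator
        itself.\<close>
      moreover have "eventually (\<lambda>j. \<phi>0 ((1/2) ^ j *\<^sub>R \<xi> + e) - \<phi>0 ((2 * (1/2) ^ j) *\<^sub>R \<xi> + 2 *\<^sub>R e)
          = LP_function \<phi>0 j (\<xi> + 2 ^ j *\<^sub>R e)) sequentially"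
        using eventually_gt_at_top[of 0]
      proof eventually_elim
        case (elim j)
        have "2 powr (- real j) = (1/2) ^ j"
          by (simp add: powr_minus powr_realpow power_one_over inverse_eq_divide)
        moreover have "2 powr (1 - real j) = 2 / 2 ^ j"
          by (simp add: powr_diff powr_realpow)
        ultimately show ?case using elim
          by (simp add: LP_function_def scaleR_add_right power_one_over mult.commute)
      qed
      ultimately have "(\<lambda>j. LP_function \<phi>0 j (\<xi> + 2 ^ j *\<^sub>R e)) \<longlonglongrightarrow> 1"
        by (rule Lim_transform_eventually)
      from tendsto_mult_right[OF this, of "complex_of_real (gauss 1 \<xi>)"]
      show "(\<lambda>j. LP_function \<phi>0 j (\<xi> + 2 ^ j *\<^sub>R e) * of_real (gauss 1 \<xi>)) \<longlonglongrightarrow> complex_of_real (gauss 1 \<xi>)"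
        by simp
    qed
    show "AE \<xi> in lborel. cmod (LP_function \<phi>0 j (\<xi> + 2 ^ j *\<^sub>R e) * of_real (gauss 1 \<xi>)) \<le> B * gauss 1 \<xi>" for j
      using B by (intro AE_I2) (auto simp: norm_mult gauss_nonneg intro!: mult_right_mono)
  qed (auto simp: integrable_gauss)
  then show ?thesis by (simp only: shift) (simp add: integral_complex_of_real integrable_gauss)
qed

section \<open>Fourier transforms of integrable functions\<close>

lemma norm_fourier_le:
  fixes u :: "'a::euclidean_space \<Rightarrow> complex"
  assumes "integrable lborel u"
  shows "cmod (fourier u x) \<le> (2 * pi) powr (- real DIM('a) / 2) * (LINT \<xi>|lborel. cmod (u \<xi>))"
proof -
  have "cmod (LINT \<xi>|lborel. cis (- (\<xi> \<bullet> x)) * u \<xi>) \<le> (LINT \<xi>|lborel. cmod (cis (- (\<xi> \<bullet> x)) * u \<xi>))"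
    by (rule integral_norm_bound)
  then show ?thesis by (simp add: fourier_def norm_mult mult_left_mono)
qed

lemma integrable_cis_mult:
  assumes "integrable lborel u" and [measurable]: "g \<in> borel_measurable borel"
  shows "integrable lborel (\<lambda>\<xi>. cis (g \<xi>) * u \<xi>)"
  using assms(1) by (rule Bochner_Integration.integrable_bound) (use assms in \<open>auto simp: norm_mult\<close>)

lemma fourier_measurable:
  fixes u :: "'a::euclidean_space \<Rightarrow> complex"
  assumes [measurable]: "u \<in> borel_measurable borel"
  shows "fourier u \<in> borel_measurable borel"
  unfolding fourier_def by measurable

text \<open>Shifting the frequency variable by \<open>\<pi> / (x \<bullet> e)\<close> in direction \<open>e\<close> flips the sign of the
  exponential, so the transform is controlled by a difference of \<open>u\<close>.\<close>

lemma fourier_decay: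
  fixes u :: "'a::euclidean_space \<Rightarrow> complex"
  assumes int: "integrable lborel u" and e: "norm e = 1"
    and C: "C \<ge> 0" "\<And>h. norm h \<le> 1 \<Longrightarrow> (LINT \<xi>|lborel. cmod (u (\<xi> + h) - u \<xi>)) \<le> C * norm h"
  obtains C' where "C' \<ge> 0" "\<And>x. cmod (fourier u x) * (1 + \<bar>x \<bullet> e\<bar>) \<le> C'"
proof -
  let ?g = "(2 * pi) powr (- real DIM('a) / 2)"
  define B where "B = ?g * (LINT \<xi>|lborel. cmod (u \<xi>))"
  have B: "B \<ge> 0" "\<And>x. cmod (fourier u x) \<le> B"
    unfolding B_def using norm_fourier_le[OF int] by auto
  have [measurable]: "u \<in> borel_measurable borel" using int by auto
  have "cmod (fourier u x) * (1 + \<bar>x \<bullet> e\<bar>) \<le> 5 * B + 4 * ?g * C" for x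
  \<comment> \<open>Since \<open>pi < 4\<close>, beyond 4 the shift has norm at most 1 and the
    hypothesis on differences applies.\<close>
  proof (cases "\<bar>x \<bullet> e\<bar> \<le> 4")
    case True
    then have "cmod (fourier u x) * (1 + \<bar>x \<bullet> e\<bar>) \<le> B * 5"
      using B by (intro mult_mono) auto
    then show ?thesis using C(1) by (simp add: add_increasing2)
  next
    case False
    let ?s = "x \<bullet> e"
    define h where "h = (pi / ?s) *\<^sub>R e"
    have nh: "norm h = pi / \<bar>?s\<bar>" using e by (simp add: h_def)
    have "pi / \<bar>?s\<bar> \<le> 1" using False pi_less_4 by (simp add: divide_le_eq)
    have hx: "h \<bullet> x = pi" using False by (simp add: h_def inner_commute)
    let ?I = "LINT \<xi>|lborel. cis (- (\<xi> \<bullet> x)) * u \<xi>"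
    have "?I = (LINT \<xi>|lborel. cis (- ((\<xi> + h) \<bullet> x)) * u (\<xi> + h))"
      by (subst integral_lborel_shift) auto
    also have "\<dots> = (LINT \<xi>|lborel. - (cis (- (\<xi> \<bullet> x)) * u (\<xi> + h)))"
    proof (intro Bochner_Integration.integral_cong refl)
      fix \<xi>
      have "cis (- ((\<xi> + h) \<bullet> x)) = cis (- (\<xi> \<bullet> x)) * cis (- pi)"
        by (simp add: cis_mult inner_add_left hx)
      also have "cis (- pi) = -1" by (simp add: complex_eq_iff)
      finally show "cis (- ((\<xi> + h) \<bullet> x)) * u (\<xi> + h) = - (cis (- (\<xi> \<bullet> x)) * u (\<xi> + h))" by simp
    qed
    finally have "?I = - (LINT \<xi>|lborel. cis (- (\<xi> \<bullet> x)) * u (\<xi> + h))" by simp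
    then have "2 * ?I = ?I - (LINT \<xi>|lborel. cis (- (\<xi> \<bullet> x)) * u (\<xi> + h))" by simp
    also have "\<dots> = (LINT \<xi>|lborel. cis (- (\<xi> \<bullet> x)) * u \<xi> - cis (- (\<xi> \<bullet> x)) * u (\<xi> + h))"
      by (intro Bochner_Integration.integral_diff[symmetric] integrable_cis_mult int integrable_lborel_shift) auto
    also have "cmod \<dots> \<le> (LINT \<xi>|lborel. cmod (cis (- (\<xi> \<bullet> x)) * u \<xi> - cis (- (\<xi> \<bullet> x)) * u (\<xi> + h)))"
      by (rule integral_norm_bound)
    also have "\<dots> = (LINT \<xi>|lborel. cmod (u (\<xi> + h) - u \<xi>))"
      by (simp add: right_diff_distrib[symmetric] norm_mult norm_minus_commute)
    also have "\<dots> \<le> C * norm h" using \<open>pi / \<bar>?s\<bar> \<le> 1\<close> by (intro C(2)) (simp add: nh)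
    finally have "2 * cmod ?I \<le> C * (pi / \<bar>?s\<bar>)" by (simp add: nh norm_mult)
    then have I: "cmod ?I * \<bar>?s\<bar> \<le> C * pi / 2" using False by (simp add: field_simps)
    have "cmod (fourier u x) * (1 + \<bar>?s\<bar>) = ?g * (cmod ?I * (1 + \<bar>?s\<bar>))"
      by (simp add: fourier_def norm_mult)
    also have "\<dots> \<le> ?g * (2 * (cmod ?I * \<bar>?s\<bar>))"
    proof (intro mult_left_mono)
      have "cmod ?I * (1 + \<bar>?s\<bar>) \<le> cmod ?I * (2 * \<bar>?s\<bar>)" using False by (intro mult_left_mono) auto
      then show "cmod ?I * (1 + \<bar>?s\<bar>) \<le> 2 * (cmod ?I * \<bar>?s\<bar>)" by simp
    qed auto
    also have "\<dots> \<le> ?g * (2 * (C * pi / 2))" by (intro mult_left_mono I) auto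
    also have "\<dots> \<le> ?g * (4 * C)"
      using mult_left_mono[of pi 4 C] pi_less_4 C(1) by (intro mult_left_mono) auto
    finally show ?thesis using B(1) by simp
  qed
  then show ?thesis using that[of "5 * B + 4 * ?g * C"] B(1) C(1) by auto
qed

lemma integral_mult_fourier:
  fixes g u :: "'a::euclidean_space \<Rightarrow> complex"
  assumes g: "integrable lborel g" and u: "integrable lborel u"
  shows "(LINT x|lborel. g x * fourier u x) = (LINT \<xi>|lborel. u \<xi> * fourier g \<xi>)"
proof -
  let ?c = "complex_of_real ((2 * pi) powr (- real DIM('a) / 2))"
  let ?H = "\<lambda>x \<xi>. g x * (cis (- (\<xi> \<bullet> x)) * u \<xi>)"
  have [measurable]: "g \<in> borel_measurable borel" "u \<in> borel_measurable borel" using g u by auto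
  have int: "integrable (lborel \<Otimes>\<^sub>M lborel) (case_prod ?H)"
  proof (rule lborel_pair.Fubini_integrable)
    show "integrable lborel (\<lambda>x. LINT y|lborel. norm (case (x, y) of (x, \<xi>) \<Rightarrow> ?H x \<xi>))"
      using g by (simp add: norm_mult)
    show "AE x in lborel. integrable lborel (\<lambda>y. case (x, y) of (x, \<xi>) \<Rightarrow> ?H x \<xi>)"
      using u by (auto intro!: AE_I2 Bochner_Integration.integrable_mult_right integrable_cis_mult)
  qed measurable
  have "(LINT x|lborel. g x * fourier u x) = ?c * (LINT x|lborel. LINT \<xi>|lborel. ?H x \<xi>)"
    unfolding fourier_def
    by (simp only: integral_mult_right_zero[symmetric] mult.assoc mult.left_commute)
  also have "(LINT x|lborel. LINT \<xi>|lborel. ?H x \<xi>) = (LINT \<xi>|lborel. LINT x|lborel. ?H x \<xi>)"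
    by (rule lborel_pair.Fubini_integral[OF int, symmetric])
  also have "(\<lambda>\<xi>. LINT x|lborel. ?H x \<xi>) = (\<lambda>\<xi>. u \<xi> * (LINT x|lborel. cis (- (x \<bullet> \<xi>)) * g x))"
    unfolding integral_mult_right_zero[symmetric]
    by (intro ext Bochner_Integration.integral_cong refl) (simp add: mult_ac inner_commute)
  also have "?c * (LINT \<xi>|lborel. u \<xi> * (LINT x|lborel. cis (- (x \<bullet> \<xi>)) * g x)) = (LINT \<xi>|lborel. u \<xi> * fourier g \<xi>)"
    by (subst integral_mult_right_zero[symmetric])
       (intro Bochner_Integration.integral_cong refl, simp add: fourier_def mult_ac)
  finally show ?thesis .
qed


section \<open>Pairing wave packets with test functions\<close>

text \<open>For \<open>i < j\<close> the gap is at least \<open>2 ^ j / 2\<close> and its square at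
  least \<open>2 ^ i * 2 ^ j / 4\<close>. The product form lets one factor be summed over
  \<open>i\<close> while the other remains as smallness in \<open>j\<close>.\<close>

lemma exp_dyadic_gap_le:
  assumes "i \<noteq> j"
  shows "exp (- ((2::real) ^ i - 2 ^ j)\<^sup>2 / 4) \<le> 16 * (1/2) ^ i * (1/2) ^ j" (is "?l \<le> _")
proof -
  have *: "(2 ^ i * 2 ^ j / 4 :: real) \<le> (2 ^ i - 2 ^ j)\<^sup>2" if "i < j" for i j :: nat
  proof -
    have le: "2 * (2::real) ^ i \<le> 2 ^ j"
      using power_increasing[of "Suc i" j "2::real"] that by simp
    have "(2 ^ i * 2 ^ j / 4 :: real) = 2 ^ i * (2 ^ j / 4)" by simp
    also have "\<dots> \<le> 2 ^ j * (2 ^ j / 4)"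
      using that by (intro mult_right_mono power_increasing) auto
    also have "\<dots> = (2 ^ j / 2) * (2 ^ j / 2)" by simp
    also have "\<dots> \<le> (2 ^ j - 2 ^ i) * (2 ^ j - 2 ^ i)"
      using le that by (intro mult_mono) auto
    finally show ?thesis by (simp add: power2_eq_square algebra_simps)
  qed
  have "(2 ^ i * 2 ^ j / 4 :: real) \<le> (2 ^ i - 2 ^ j)\<^sup>2"
    using *[of i j] *[of j i] assms by (cases "i < j") (auto simp: power2_commute mult.commute)
  then have "?l \<le> exp (- (2 ^ i * 2 ^ j / 16))" by simp
  also have "\<dots> \<le> 1 / (2 ^ i * 2 ^ j / 16)" by (intro exp_minus_le_inverse) simp
  finally show ?thesis by (simp add: power_one_over field_simps)
qed

text \<open>The frequency is negated because functions are paired bilinearly, without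
  conjugation.\<close>

definition gtest :: "real \<Rightarrow> 'a::euclidean_space \<Rightarrow> nat \<Rightarrow> 'a \<Rightarrow> complex" where
  "gtest \<sigma> e j = mgauss (- (2 ^ j *\<^sub>R e)) ((\<sigma> * 2 ^ j) *\<^sub>R e)"

text \<open>With multiplier and transforms moved to the test function, block \<open>j\<close> of a
  distribution at \<open>gtest\<close> is the distribution at the Fourier transform of this
  symbol.\<close>

definition gsymbol :: "('a::euclidean_space \<Rightarrow> complex) \<Rightarrow> real \<Rightarrow> 'a \<Rightarrow> nat \<Rightarrow> 'a \<Rightarrow> complex" where
  "gsymbol \<phi>0 \<sigma> e j = (\<lambda>\<xi>. LP_function \<phi>0 j \<xi> * inv_fourier (gtest \<sigma> e j) \<xi>)"

lemma LP_block_gtest: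
  "LP_block \<phi>0 j (distribution_of f) (gtest \<sigma> e j) = (LINT x|lborel. f x * fourier (gsymbol \<phi>0 \<sigma> e j) x)"
  by (simp add: LP_block_def dist_inv_fourier_def dist_mult_def dist_fourier_def distribution_of_def gsymbol_def)

lemma inv_fourier_gtest:
  "inv_fourier (gtest \<sigma> e j) \<xi>
     = cis (- ((\<sigma> * 2 ^ j) *\<^sub>R e \<bullet> 2 ^ j *\<^sub>R e)) * mgauss ((\<sigma> * 2 ^ j) *\<^sub>R e) (2 ^ j *\<^sub>R e) \<xi>"
  by (simp add: gtest_def inv_fourier_mgauss mgauss_def cis_mult inner_diff_right flip: mult.assoc)

lemma gsymbol_eq:
  "gsymbol \<phi>0 \<sigma> e j \<xi> = cis (- ((\<sigma> * 2 ^ j) *\<^sub>R e \<bullet> 2 ^ j *\<^sub>R e)) *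
     (LP_function \<phi>0 j \<xi> * mgauss ((\<sigma> * 2 ^ j) *\<^sub>R e) (2 ^ j *\<^sub>R e) \<xi>)"
  by (simp add: gsymbol_def inv_fourier_gtest)

context
  fixes \<phi>0 :: "'a::euclidean_space \<Rightarrow> complex" and e :: 'a
  assumes LP: "LP_generator \<phi>0" and e: "norm e = 1"
begin

lemma gsymbol_measurable [measurable]: "gsymbol \<phi>0 \<sigma> e j \<in> borel_measurable borel"
proof -
  note [measurable] = LP_function_measurable[OF LP]
  show ?thesis unfolding gsymbol_eq[abs_def] by measurable
qed

lemma gsymbol_bound:
  assumes "\<And>j x. cmod (LP_function \<phi>0 j x) \<le> B"
  shows "cmod (gsymbol \<phi>0 \<sigma> e j \<xi>) \<le> B * gauss (1/2) (\<xi> - 2 ^ j *\<^sub>R e)"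
  unfolding gsymbol_eq using assms by (auto simp: norm_mult gauss_nonneg intro!: mult_right_mono)

lemma integrable_gsymbol: "integrable lborel (gsymbol \<phi>0 \<sigma> e j)"
proof -
  obtain B where B: "B \<ge> 0" "\<And>j x. cmod (LP_function \<phi>0 j x) \<le> B"
    using LP_function_bounded[OF LP] by blast
  show ?thesis
  proof (rule Bochner_Integration.integrable_bound)
    show "integrable lborel (\<lambda>\<xi>. B * gauss (1/2) (\<xi> - 2 ^ j *\<^sub>R e))" by simp
    show "AE \<xi> in lborel. norm (gsymbol \<phi>0 \<sigma> e j \<xi>) \<le> norm (B * gauss (1/2) (\<xi> - 2 ^ j *\<^sub>R e))"
      using gsymbol_bound[OF B(2)] B(1) by (intro AE_I2) (simp add: abs_mult gauss_nonneg)
  qed measurable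
qed

text \<open>A qualitative bound for fixed \<open>j\<close>, whose purpose is to justify termwise
  integration. Lipschitz continuity of the symbol in the mean yields one power of
  \<open>x \<bullet> e\<close>.\<close>

lemma gsymbol_decay:
  obtains C where "C \<ge> 0" "\<And>x. cmod (fourier (gsymbol \<phi>0 \<sigma> e j) x) * (1 + \<bar>x \<bullet> e\<bar>) \<le> C"
proof -
  let ?c = "(\<sigma> * 2 ^ j) *\<^sub>R e" and ?w = "2 ^ j *\<^sub>R e"
  obtain B where B: "B \<ge> 0" "\<And>j x. cmod (LP_function \<phi>0 j x) \<le> B"
    using LP_function_bounded[OF LP] by blast
  obtain L where L: "L \<ge> 0" "\<And>x y. cmod (LP_function \<phi>0 j x - LP_function \<phi>0 j y) \<le> L * norm (x - y)"
    using LP_function_Lipschitz[OF LP] by blast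
  define A where "A = B * (3 * exp (1/2) * (1 + norm ?c))"
  have A: "A \<ge> 0" using B(1) by (simp add: A_def)
  define C where "C = A * (LINT x::'a|lborel. gauss (1/8) x) + L * (LINT x::'a|lborel. gauss (1/2) x)"
  have C: "C \<ge> 0" using A L(1) by (simp add: C_def gauss_nonneg)
  have "(LINT \<xi>|lborel. cmod (gsymbol \<phi>0 \<sigma> e j (\<xi> + h) - gsymbol \<phi>0 \<sigma> e j \<xi>)) \<le> C * norm h"
    if h: "norm h \<le> 1" for h :: 'a
  proof -
    have "cmod (gsymbol \<phi>0 \<sigma> e j (\<xi> + h) - gsymbol \<phi>0 \<sigma> e j \<xi>)
       \<le> norm h * (A * gauss (1/8) (\<xi> - ?w) + L * gauss (1/2) (\<xi> - ?w))" for \<xi>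
    proof -
      let ?P = "LP_function \<phi>0 j" and ?m = "mgauss ?c ?w"
      have "gsymbol \<phi>0 \<sigma> e j (\<xi> + h) - gsymbol \<phi>0 \<sigma> e j \<xi>
         = cis (- (?c \<bullet> ?w)) * (?P (\<xi> + h) * (?m (\<xi> + h) - ?m \<xi>) + (?P (\<xi> + h) - ?P \<xi>) * ?m \<xi>)"
        unfolding gsymbol_eq by (simp add: algebra_simps)
      then have "cmod (gsymbol \<phi>0 \<sigma> e j (\<xi> + h) - gsymbol \<phi>0 \<sigma> e j \<xi>)
         = cmod (?P (\<xi> + h) * (?m (\<xi> + h) - ?m \<xi>) + (?P (\<xi> + h) - ?P \<xi>) * ?m \<xi>)"
        by (simp only: norm_mult norm_cis mult_1)
      also have "\<dots> \<le> cmod (?P (\<xi> + h)) * cmod (?m (\<xi> + h) - ?m \<xi>) + cmod (?P (\<xi> + h) - ?P \<xi>) * cmod (?m \<xi>)"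
        by (rule order_trans[OF norm_triangle_ineq]) (simp add: norm_mult)
      also have "\<dots> \<le> B * (3 * exp (1/2) * (1 + norm ?c) * norm h * gauss (1/8) (\<xi> - ?w))
          + (L * norm h) * gauss (1/2) (\<xi> - ?w)"
        using B L(1) L(2)[of "\<xi> + h" \<xi>] mgauss_diff_le[OF h, of ?c ?w \<xi>]
        by (intro add_mono mult_mono) (auto simp: gauss_nonneg)
      finally show ?thesis by (simp add: A_def algebra_simps)
    qed
    then have "(LINT \<xi>|lborel. cmod (gsymbol \<phi>0 \<sigma> e j (\<xi> + h) - gsymbol \<phi>0 \<sigma> e j \<xi>))
       \<le> (LINT \<xi>|lborel. norm h * (A * gauss (1/8) (\<xi> - ?w) + L * gauss (1/2) (\<xi> - ?w)))"
      by (intro integral_mono Bochner_Integration.integrable_norm Bochner_Integration.integrable_diff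
            integrable_lborel_shift integrable_gsymbol) auto
    also have "\<dots> = C * norm h" by (simp add: C_def)
    finally show ?thesis .
  qed
  then show ?thesis using fourier_decay[OF integrable_gsymbol e C] that by blast
qed

lemma gwave_pairing:
  "(LINT x|lborel. gwave \<sigma> e i x * fourier (gsymbol \<phi>0 \<sigma> e j) x)
     = (LINT \<xi>|lborel. gsymbol \<phi>0 \<sigma> e j \<xi> * fourier (gwave \<sigma> e i) \<xi>)"
  by (rule integral_mult_fourier[OF integrable_gwave integrable_gsymbol])

text \<open>The phases coming from the positions of packet and test cancel, so the value is the same
  for all \<open>\<sigma>\<close>.\<close>

lemma gwave_pairing_diagonal:
  "(LINT x|lborel. gwave \<sigma> e j x * fourier (gsymbol \<phi>0 \<sigma> e j) x)
     = (LINT \<xi>|lborel. LP_function \<phi>0 j \<xi> * of_real (gauss 1 (\<xi> - 2 ^ j *\<^sub>R e)))"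
  unfolding gwave_pairing
proof (intro Bochner_Integration.integral_cong refl)
  fix \<xi> :: 'a
  let ?c = "(\<sigma> * 2 ^ j) *\<^sub>R e" and ?w = "2 ^ j *\<^sub>R e"
  have "inv_fourier (gtest \<sigma> e j) \<xi> * fourier (gwave \<sigma> e j) \<xi>
      = (cis (?c \<bullet> (\<xi> - ?w)) * cis (?c \<bullet> (?w - \<xi>))) * of_real (gauss (1/2) (\<xi> - ?w) * gauss (1/2) (\<xi> - ?w))"
    by (simp add: gtest_def inv_fourier_mgauss gwave_def fourier_mgauss)
  also have "cis (?c \<bullet> (\<xi> - ?w)) * cis (?c \<bullet> (?w - \<xi>)) = 1"
    by (simp add: cis_mult inner_diff_right)
  also have "gauss (1/2) (\<xi> - ?w) * gauss (1/2) (\<xi> - ?w) = gauss 1 (\<xi> - ?w)"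
    by (simp add: gauss_def mult_exp_exp)
  finally show "gsymbol \<phi>0 \<sigma> e j \<xi> * fourier (gwave \<sigma> e j) \<xi> = LP_function \<phi>0 j \<xi> * of_real (gauss 1 (\<xi> - ?w))"
    by (simp add: gsymbol_def)
qed

text \<open>On the frequency side positions are mere phases, so the distance between
  \<open>2 ^ i *\<^sub>R e\<close> and \<open>2 ^ j *\<^sub>R e\<close> alone makes the product
  small, whatever \<open>\<sigma>\<close> is.\<close>

lemma gwave_pairing_off_diagonal:
  assumes B: "\<And>j x. cmod (LP_function \<phi>0 j x) \<le> B" "B \<ge> 0" and ij: "i \<noteq> j"
  shows "cmod (LINT x|lborel. gwave \<sigma> e i x * fourier (gsymbol \<phi>0 \<sigma> e j) x)
     \<le> B * (LINT \<xi>::'a|lborel. gauss 1 \<xi>) * (16 * (1/2) ^ i * (1/2) ^ j)"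
proof -
  let ?D = "LINT \<xi>::'a|lborel. gauss 1 \<xi>" and ?E = "exp (- (2 ^ i - 2 ^ j)\<^sup>2 / 4)"
  have D: "?D \<ge> 0" by (simp add: gauss_nonneg)
  let ?a = "(2 ^ j *\<^sub>R e + 2 ^ i *\<^sub>R e) /\<^sub>R 2"
  have "norm (2 ^ j *\<^sub>R e - 2 ^ i *\<^sub>R e) = \<bar>2 ^ j - 2 ^ i\<bar>"
    using e by (simp add: scaleR_diff_left[symmetric])
  then have nw: "(norm (2 ^ j *\<^sub>R e - 2 ^ i *\<^sub>R e))\<^sup>2 = (2 ^ i - 2 ^ j)\<^sup>2"
    by (simp add: power2_commute)
  have "cmod (gsymbol \<phi>0 \<sigma> e j \<xi> * fourier (gwave \<sigma> e i) \<xi>) \<le> (B * ?E) * gauss 1 (\<xi> - ?a)" for \<xi>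
  proof -
    have "cmod (gsymbol \<phi>0 \<sigma> e j \<xi> * fourier (gwave \<sigma> e i) \<xi>)
        \<le> (B * gauss (1/2) (\<xi> - 2 ^ j *\<^sub>R e)) * gauss (1/2) (\<xi> - 2 ^ i *\<^sub>R e)"
      using gsymbol_bound[OF B(1), of \<sigma> j \<xi>]
      by (simp add: gwave_def fourier_mgauss norm_mult gauss_nonneg mult_right_mono)
    also have "\<dots> = B * (gauss (1/2) (\<xi> - 2 ^ j *\<^sub>R e) * gauss (1/2) (\<xi> - 2 ^ i *\<^sub>R e))" by simp
    also have "\<dots> = (B * ?E) * gauss 1 (\<xi> - ?a)"
      by (simp only: gauss_mult nw mult.assoc)
    finally show ?thesis .
  qed
  then have "(LINT \<xi>|lborel. cmod (gsymbol \<phi>0 \<sigma> e j \<xi> * fourier (gwave \<sigma> e i) \<xi>))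
      \<le> (LINT \<xi>|lborel. (B * ?E) * gauss 1 (\<xi> - ?a))"
    by (intro Bochner_Integration.integral_mono') (auto simp: gauss_nonneg B(2))
  also have "\<dots> = B * ?D * ?E" by simp
  also have "\<dots> \<le> B * ?D * (16 * (1/2) ^ i * (1/2) ^ j)"
    using B(2) D by (intro mult_left_mono exp_dyadic_gap_le ij) auto
  finally show ?thesis
    unfolding gwave_pairing using integral_norm_bound[of lborel "\<lambda>\<xi>. gsymbol \<phi>0 \<sigma> e j \<xi> * fourier (gwave \<sigma> e i) \<xi>"]
    by linarith
qed

end


section \<open>Lower bounds for the Littlewood--Paley blocks\<close>

lemma ennreal_powr_ge:
  assumes "ennreal c \<le> x" "c \<ge> 0" "Q > 0"
  shows "ennreal (c powr Q) \<le> ennreal_powr x Q"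
proof (cases "x = \<infinity>")
  case False
  then have "c \<le> enn2real x" using assms by (cases x) auto
  then show ?thesis using False assms
    by (auto simp: ennreal_powr_def intro!: ennreal_leI powr_mono2)
qed (simp add: ennreal_powr_def)

lemma one_plus_norm_mult_gauss_le:
  "(1 + norm (z::'a::euclidean_space)) * gauss (1/2) z \<le> 6 * gauss (1/4) z"
proof -
  have "(1 + norm z) * gauss (1/2) z = (1 + norm z) * gauss (1/8) z * gauss (3/8) z"
    by (simp add: gauss_def mult_exp_exp)
  also have "\<dots> \<le> 6 * gauss (1/4) z"
  proof (intro mult_mono)
    have "(1 + norm z) * gauss (1/8) z \<le> (2 * (norm z + 1/2)) * gauss (1/8) z"
      by (intro mult_right_mono gauss_nonneg) simp
    also have "\<dots> = 2 * ((norm z + 1/2) * gauss (1/8) z)" by simp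
    also have "\<dots> \<le> 2 * 3" by (intro mult_left_mono norm_mult_gauss_le) auto
    finally show "(1 + norm z) * gauss (1/8) z \<le> 6" by simp
    show "gauss (3/8) z \<le> gauss (1/4) z" by (simp add: gauss_def)
  qed (auto simp: gauss_nonneg)
  finally show ?thesis .
qed

lemma norm_gtest [simp]: "cmod (gtest \<sigma> e j x) = gauss (1/2) (x - (\<sigma> * 2 ^ j) *\<^sub>R e)"
  by (simp add: gtest_def)

context lacunary
begin

lemma integrable_F: "integrable lborel (F m)"
  unfolding F_def[abs_def] by (intro Bochner_Integration.integrable_mult_right Bochner_Integration.integrable_sum integrable_gwave)

section \<open>Pairing the lacunary sum with a kernel decaying along \<open>e\<close>\<close>

context
  fixes K :: "'a \<Rightarrow> complex" and C :: real
  assumes K_measurable [measurable]: "K \<in> borel_measurable borel"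
    and C: "C \<ge> 0" and K_decay: "\<And>x. cmod (K x) * (1 + \<bar>x \<bullet> e\<bar>) \<le> C"
begin

lemma K_le: "cmod (K x) \<le> C"
proof -
  have "cmod (K x) * 1 \<le> cmod (K x) * (1 + \<bar>x \<bullet> e\<bar>)" by (intro mult_left_mono) auto
  then show ?thesis using K_decay[of x] by simp
qed

lemma integrable_mult_K:
  assumes "integrable lborel g"
  shows "integrable lborel (\<lambda>x. g x * K x)"
proof (rule Bochner_Integration.integrable_bound)
  show "integrable lborel (\<lambda>x. C * cmod (g x))" using assms by simp
  have "cmod (g x) * cmod (K x) \<le> cmod (g x) * C" for x by (intro mult_left_mono K_le) auto
  then show "AE x in lborel. norm (g x * K x) \<le> norm (C * cmod (g x))"
    using C by (intro AE_I2) (simp add: norm_mult mult.commute)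
qed (use assms in measurable)

text \<open>The bound that allows sum and integral to be interchanged. For
  \<open>\<sigma> = 0\<close> the \<open>L_1\<close> norms of \<open>F m\<close> obey the same
  estimate as the \<open>L_p\<close> norms, and boundedness of \<open>K\<close> suffices. For
  \<open>\<sigma> = 1\<close> they may fail to be summable, but packet \<open>j\<close> sits at
  distance \<open>2 ^ j\<close> along \<open>e\<close>, where \<open>K\<close> is of size
  \<open>2 powr (- j)\<close>.\<close>

lemma F_mult_K_le:
  "\<exists>D. \<forall>m. (LINT x|lborel. cmod (F m x * K x)) \<le> D * 2 powr (- \<beta> * real m)"
proof (cases "\<sigma> = 0")
  case True
  then have r: "r = 2" using adm by (simp add: admissible_def)
  \<comment> \<open>The estimate for sums of packets, taken at exponent 1 instead of
    \<open>p\<close>.\<close>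
  obtain C1 where C1: "C1 > 0" "\<And>J. finite J \<Longrightarrow> J \<noteq> {} \<Longrightarrow>
      (\<integral>\<^sup>+x. ennreal (cmod (\<Sum>j\<in>J. gwave \<sigma> e j x) powr 1) \<partial>lborel) \<le> ennreal ((C1 * real (card J) powr (1 / r)) powr 1)"
    using gwave_sum_Lp_le[of 1 e \<sigma> r] norm_e True r by (auto simp: admissible_def)
  have "(LINT x|lborel. cmod (F m x * K x)) \<le> (C * C1) * 2 powr (- \<beta> * real m)" for m
  proof -
    let ?S = "\<lambda>x. \<Sum>j\<in>J m. gwave \<sigma> e j x"
    have intS: "integrable lborel ?S" by (intro Bochner_Integration.integrable_sum integrable_gwave)
    have "ennreal (LINT x|lborel. cmod (?S x)) = (\<integral>\<^sup>+x. ennreal (cmod (?S x)) \<partial>lborel)"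
      using intS by (intro nn_integral_eq_integral[symmetric]) auto
    also have "\<dots> \<le> ennreal (C1 * real (card (J m)) powr (1 / r))"
      using C1(2)[of "J m"] J(2)[of m] C1(1) by simp
    finally have S: "(LINT x|lborel. cmod (?S x)) \<le> C1 * real (card (J m)) powr (1 / r)"
      using C1(1) by simp
    have "(LINT x|lborel. cmod (F m x * K x)) \<le> (LINT x|lborel. C * coef m * cmod (?S x))"
    proof (intro integral_mono Bochner_Integration.integrable_norm integrable_mult_K integrable_F)
      fix x
      have "cmod (F m x * K x) = coef m * cmod (?S x) * cmod (K x)"
        using coef_pos[of m] by (simp add: F_def norm_mult)
      also have "\<dots> \<le> coef m * cmod (?S x) * C"
        using coef_pos[of m] by (intro mult_left_mono K_le) auto
      finally show "cmod (F m x * K x) \<le> C * coef m * cmod (?S x)" by (simp add: mult_ac)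
    qed (use intS in simp)
    also have "\<dots> = C * coef m * (LINT x|lborel. cmod (?S x))" by simp
    also have "\<dots> \<le> C * coef m * (C1 * real (card (J m)) powr (1 / r))"
      using S C coef_pos[of m] by (intro mult_left_mono) auto
    also have "\<dots> = C * C1 * 2 powr (- \<beta> * real m)"
      using J(2)[of m] by (simp add: coef_def powr_minus field_simps)
    finally show ?thesis .
  qed
  then show ?thesis by blast
next
  case False
  then have \<sigma>: "\<sigma> = 1" using adm by (simp add: admissible_def)
  define G where "G = (LINT x::'a|lborel. gauss (1/4) x)"
  have G: "G \<ge> 0" by (simp add: G_def gauss_nonneg)
  have wave: "(LINT x|lborel. cmod (gwave \<sigma> e j x * K x)) \<le> 6 * C * G * (1/2) ^ j" for j
  proof -
    have "(LINT x|lborel. cmod (gwave \<sigma> e j x * K x)) \<le> (LINT x|lborel. 6 * C * (1/2) ^ j * gauss (1/4) (x - 2 ^ j *\<^sub>R e))"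
    proof (intro integral_mono Bochner_Integration.integrable_norm integrable_mult_K integrable_gwave)
      fix x
      let ?z = "x - 2 ^ j *\<^sub>R e"
      have "?z \<bullet> e = x \<bullet> e - 2 ^ j" using norm_e by (simp add: inner_diff_left dot_square_norm)
      \<comment> \<open>Either \<open>x\<close> is far out along \<open>e\<close>, or it is far from
        the centre of the packet; the decay of \<open>K\<close> or of the Gaussian pays for
        \<open>2 ^ j\<close>.\<close>
      then have "2 ^ j \<le> \<bar>x \<bullet> e\<bar> + norm ?z"
        using Cauchy_Schwarz_ineq2[of ?z e] norm_e by simp
      also have "\<dots> \<le> (1 + \<bar>x \<bullet> e\<bar>) * (1 + norm ?z)"
      proof -
        have "0 \<le> \<bar>x \<bullet> e\<bar> * norm ?z" by simp
        then show ?thesis unfolding distrib_left distrib_right by linarith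
      qed
      finally have "cmod (K x) * 2 ^ j \<le> cmod (K x) * ((1 + \<bar>x \<bullet> e\<bar>) * (1 + norm ?z))"
        by (intro mult_left_mono) auto
      also have "\<dots> \<le> C * (1 + norm ?z)"
        using mult_right_mono[OF K_decay[of x], of "1 + norm ?z"] by (simp add: mult.assoc)
      finally have Kz: "cmod (K x) \<le> (1/2) ^ j * (C * (1 + norm ?z))"
        by (simp add: power_one_over field_simps)
      have "cmod (gwave \<sigma> e j x * K x) = gauss (1/2) ?z * cmod (K x)"
        by (simp add: gwave_def norm_mult \<sigma>)
      also have "\<dots> \<le> gauss (1/2) ?z * ((1/2) ^ j * (C * (1 + norm ?z)))"
        by (intro mult_left_mono Kz gauss_nonneg)
      also have "\<dots> = C * (1/2) ^ j * ((1 + norm ?z) * gauss (1/2) ?z)" by simp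
      also have "\<dots> \<le> C * (1/2) ^ j * (6 * gauss (1/4) ?z)"
        using C by (intro mult_left_mono one_plus_norm_mult_gauss_le) auto
      finally show "cmod (gwave \<sigma> e j x * K x) \<le> 6 * C * (1/2) ^ j * gauss (1/4) ?z" by (simp add: mult_ac)
    qed simp
    then show ?thesis by (simp add: G_def mult_ac)
  qed
  have "(LINT x|lborel. cmod (F m x * K x)) \<le> (12 * C * G) * 2 powr (- \<beta> * real m)" for m
  proof -
    have "(LINT x|lborel. cmod (F m x * K x)) \<le> (LINT x|lborel. coef m * (\<Sum>j\<in>J m. cmod (gwave \<sigma> e j x * K x)))"
    proof (intro integral_mono Bochner_Integration.integrable_norm integrable_mult_K integrable_F
           Bochner_Integration.integrable_mult_right Bochner_Integration.integrable_sum integrable_gwave)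
      fix x
      have "cmod (F m x * K x) = coef m * cmod (\<Sum>j\<in>J m. gwave \<sigma> e j x * K x)"
        using coef_pos[of m] by (simp add: F_def norm_mult sum_distrib_right[symmetric])
      also have "\<dots> \<le> coef m * (\<Sum>j\<in>J m. cmod (gwave \<sigma> e j x * K x))"
        using coef_pos[of m] by (intro mult_left_mono norm_sum) auto
      finally show "cmod (F m x * K x) \<le> coef m * (\<Sum>j\<in>J m. cmod (gwave \<sigma> e j x * K x))" .
    qed
    also have "\<dots> = coef m * (\<Sum>j\<in>J m. LINT x|lborel. cmod (gwave \<sigma> e j x * K x))"
      by (subst integral_mult_right_zero, subst Bochner_Integration.integral_sum)
         (auto intro!: Bochner_Integration.integrable_norm integrable_mult_K)
    also have "\<dots> \<le> coef m * (\<Sum>j\<in>J m. 6 * C * G * (1/2) ^ j)"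
      using coef_pos[of m] by (intro mult_left_mono sum_mono wave) auto
    also have "\<dots> = coef m * (6 * C * G * (\<Sum>j\<in>J m. (1/2) ^ j))" by (simp add: sum_distrib_left)
    also have "\<dots> \<le> 2 powr (- \<beta> * real m) * (6 * C * G * 2)"
      using C G by (intro mult_mono coef_le mult_left_mono sum_half_power_le) (auto intro!: mult_nonneg_nonneg sum_nonneg)
    finally show ?thesis by (simp add: mult_ac)
  qed
  then show ?thesis by blast
qed

lemma sums_pairing: "(\<lambda>m. LINT x|lborel. F m x * K x) sums (LINT x|lborel. f x * K x)"
proof -
  obtain D where D: "\<And>m. (LINT x|lborel. cmod (F m x * K x)) \<le> D * 2 powr (- \<beta> * real m)"
    using F_mult_K_le by blast
  have "summable (\<lambda>m. D * (2 powr (- \<beta>)) ^ m)"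
    using \<beta> by (intro summable_mult summable_geometric) (auto simp: powr_minus_divide)
  then have "summable (\<lambda>m. LINT x|lborel. norm (F m x * K x))"
    by (rule summable_comparison_test[rotated])
       (use D in \<open>auto simp: powr_realpow[symmetric] powr_powr intro!: exI[of _ 0]\<close>)
  moreover have "AE x in lborel. summable (\<lambda>m. norm (F m x * K x))"
    using f_Lp(2) by eventually_elim (simp add: norm_mult summable_mult2)
  ultimately have "(\<lambda>m. LINT x|lborel. F m x * K x) sums (LINT x|lborel. (\<Sum>m. F m x * K x))"
    by (intro sums_integral integrable_mult_K integrable_F)
  also have "(LINT x|lborel. (\<Sum>m. F m x * K x)) = (LINT x|lborel. f x * K x)"
  proof (rule integral_cong_AE)
    show "AE x in lborel. (\<Sum>m. F m x * K x) = f x * K x"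
      using f_Lp(2)
    proof eventually_elim
      case (elim x)
      show ?case unfolding f_def by (rule suminf_mult2[OF summable_norm_cancel[OF elim], symmetric])
    qed
  qed measurable
  finally show ?thesis .
qed

lemma F_pairing: "(LINT x|lborel. F m x * K x) = of_real (coef m) * (\<Sum>j\<in>J m. LINT x|lborel. gwave \<sigma> e j x * K x)"
proof -
  have "(LINT x|lborel. F m x * K x) = (LINT x|lborel. of_real (coef m) * (\<Sum>j\<in>J m. gwave \<sigma> e j x * K x))"
    by (simp add: F_def sum_distrib_right mult.assoc)
  also have "\<dots> = of_real (coef m) * (\<Sum>j\<in>J m. LINT x|lborel. gwave \<sigma> e j x * K x)"
    by (subst integral_mult_right_zero, subst Bochner_Integration.integral_sum)
       (auto intro!: integrable_mult_K)
  finally show ?thesis .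
qed

end

lemma coef_ge: "2 powr (- (\<beta> + 1 / r) * real m) \<le> coef m"
proof -
  have "real (card (J m)) \<le> 2 ^ m" using card_J(2)[of m] by (simp flip: of_nat_le_iff)
  then have "(2 ^ m) powr (- (1 / r)) \<le> real (card (J m)) powr (- (1 / r))"
    using card_J(1)[of m] r_pos by (intro powr_mono2') auto
  then have "(2 ^ m) powr (- (1 / r)) * 2 powr (- \<beta> * real m) \<le> coef m"
    unfolding coef_def by (intro mult_right_mono) auto
  also have "(2 ^ m) powr (- (1 / r)) * 2 powr (- \<beta> * real m) = 2 powr (- (\<beta> + 1 / r) * real m)"
    by (simp add: powr_realpow[symmetric] powr_powr powr_add[symmetric] algebra_simps)
  finally show ?thesis .
qed

lemma J_unique: "j \<in> J m \<Longrightarrow> j \<in> J n \<Longrightarrow> m = n"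
proof (induction m n rule: linorder_wlog)
  case (le m n)
  show ?case
  proof (rule ccontr)
    assume "m \<noteq> n"
    then have "(2::nat) ^ Suc m \<le> 2 ^ n" using le by (intro power_increasing) auto
    then show False using le J(1)[of m] J(1)[of n] by fastforce
  qed
qed auto

section \<open>From pairings to an infinite Besov norm\<close>

context
  fixes \<phi>0 :: "'a \<Rightarrow> complex"
  assumes LP: "LP_generator \<phi>0"
begin

text \<open>Packet \<open>j\<close> occurs in group \<open>n\<close> only, so the pairing is
  \<open>coef n\<close> times the diagonal value plus the tails of all other packets. The tails add
  up to at most \<open>M * (1/2) ^ j\<close> with \<open>j \<ge> 2 ^ n\<close>, doubly exponentially
  small in \<open>n\<close>, whereas \<open>coef n\<close> decays only exponentially. The diagonal
  value eventually exceeds \<open>D / 2\<close>, and the tails take at most half of that.\<close>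

lemma f_pairing_ge:
  "\<exists>\<kappa>>0. \<exists>N. \<forall>n\<ge>N. \<forall>j\<in>J n.
     \<kappa> * coef n \<le> cmod (LINT x|lborel. f x * fourier (gsymbol \<phi>0 \<sigma> e j) x)"
proof -
  define D where "D = (LINT \<xi>::'a|lborel. gauss 1 \<xi>)"
  have D: "D > 0" unfolding D_def by (intro integral_gauss_pos) simp
  obtain B where B: "B \<ge> 0" "\<And>j x. cmod (LP_function \<phi>0 j x) \<le> B"
    using LP_function_bounded[OF LP] by blast
  define \<rho> where "\<rho> = 2 powr (- \<beta>)"
  have \<rho>: "0 < \<rho>" "\<rho> < 1" using \<beta> by (auto simp: \<rho>_def powr_minus_divide)
  define M where "M = 32 * B * D / (1 - \<rho>)"
  have M: "M \<ge> 0" using B D \<rho> by (simp add: M_def)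
  let ?I = "\<lambda>i j. LINT x|lborel. gwave \<sigma> e i x * fourier (gsymbol \<phi>0 \<sigma> e j) x"
  have main: "cmod ((LINT x|lborel. f x * fourier (gsymbol \<phi>0 \<sigma> e j) x) - of_real (coef n) * ?I j j) \<le> M * (1/2) ^ j"
    if j: "j \<in> J n" for j n
  proof -
    obtain C where C: "C \<ge> 0" "\<And>x. cmod (fourier (gsymbol \<phi>0 \<sigma> e j) x) * (1 + \<bar>x \<bullet> e\<bar>) \<le> C"
      using gsymbol_decay[OF LP norm_e] by blast
    note K = fourier_measurable[OF gsymbol_measurable[OF LP norm_e]] C
    \<comment> \<open>The series of pairings with the diagonal term taken out of group
      \<open>n\<close>.\<close>
    let ?d = "\<lambda>m. of_real (coef m) * (\<Sum>i\<in>J m. ?I i j) - (if m = n then of_real (coef n) * ?I j j else 0)"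
    have "(\<lambda>m. if m = n then of_real (coef n) * ?I j j else 0) sums (of_real (coef n) * ?I j j)"
      by (rule sums_single)
    from sums_diff[OF sums_pairing[OF K, unfolded F_pairing[OF K]] this]
    have d: "?d sums ((LINT x|lborel. f x * fourier (gsymbol \<phi>0 \<sigma> e j) x) - of_real (coef n) * ?I j j)" .
    have le: "cmod (?d m) \<le> 32 * B * D * (1/2) ^ j * \<rho> ^ m" for m
    proof -
      have "?d m = of_real (coef m) * (\<Sum>i\<in>J m - {j}. ?I i j)"
      proof (cases "m = n")
        case True
        then have "(\<Sum>i\<in>J m. ?I i j) = ?I j j + (\<Sum>i\<in>J m - {j}. ?I i j)"
          using j by (intro sum.remove) auto
        then show ?thesis using True by (simp add: algebra_simps)
      next
        case False
        then have "J m - {j} = J m" using J_unique j by blast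
        then show ?thesis using False by simp
      qed
      then have "cmod (?d m) = coef m * cmod (\<Sum>i\<in>J m - {j}. ?I i j)"
        using coef_pos[of m] by (simp only: norm_mult norm_of_real abs_of_pos)
      also have "\<dots> \<le> 2 powr (- \<beta> * real m) * (\<Sum>i\<in>J m - {j}. B * D * (16 * (1/2) ^ i * (1/2) ^ j))"
        unfolding D_def
        by (intro mult_mono coef_le sum_norm_le gwave_pairing_off_diagonal[OF LP norm_e B(2,1)]) auto
      also have "(\<Sum>i\<in>J m - {j}. B * D * (16 * (1/2) ^ i * (1/2) ^ j)) = 16 * B * D * (1/2) ^ j * (\<Sum>i\<in>J m - {j}. (1/2) ^ i)"
        by (simp add: sum_distrib_left mult_ac)
      also have "2 powr (- \<beta> * real m) = \<rho> ^ m"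
        by (simp add: \<rho>_def powr_realpow[symmetric] powr_powr)
      also have "\<rho> ^ m * (16 * B * D * (1/2) ^ j * (\<Sum>i\<in>J m - {j}. (1/2) ^ i)) \<le> \<rho> ^ m * (16 * B * D * (1/2) ^ j * 2)"
        using \<rho> B(1) D by (intro mult_left_mono sum_half_power_le) auto
      finally show ?thesis by (simp add: mult_ac)
    qed
    have sm: "(\<lambda>m. 32 * B * D * (1/2) ^ j * \<rho> ^ m) sums (32 * B * D * (1/2) ^ j * (1 / (1 - \<rho>)))"
      using \<rho> by (intro sums_mult geometric_sums) auto
    have "cmod (suminf ?d) \<le> (\<Sum>m. 32 * B * D * (1/2) ^ j * \<rho> ^ m)"
      by (intro norm_suminf_le le sums_summable[OF sm])
    then show ?thesis
      unfolding sums_unique[OF d, symmetric] sums_unique[OF sm, symmetric] by (simp add: M_def)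
  qed
  have "(\<lambda>j. ?I j j) \<longlonglongrightarrow> of_real D"
    unfolding gwave_pairing_diagonal[OF LP norm_e] D_def by (rule LP_function_diagonal_limit[OF LP norm_e])
  then have "(\<lambda>j. cmod (?I j j)) \<longlonglongrightarrow> cmod (of_real D)" by (rule tendsto_norm)
  then have "eventually (\<lambda>j. cmod (?I j j) > D / 2) sequentially"
    using D by (intro order_tendstoD(1)) auto
  then obtain N1 where N1: "\<And>j. j \<ge> N1 \<Longrightarrow> cmod (?I j j) > D / 2"
    unfolding eventually_sequentially by blast
  define a where "a = \<beta> + 1 / r"
  have a: "a > 0" using \<beta> r_pos by (simp add: a_def add_pos_pos)
  \<comment> \<open>Compares the tails with the lower bound \<open>2 powr (- a * n)\<close> for
    \<open>coef n\<close> from \<open>coef_ge\<close>.\<close>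
  have "(\<lambda>n::nat. (1/2) powr (2 powr real n) * 2 powr (a * real n)) \<longlonglongrightarrow> 0"
    using a by real_asymp
  then have "eventually (\<lambda>n::nat. (1/2) powr (2 powr real n) * 2 powr (a * real n) < D / (4 * (M + 1))) sequentially"
    using D M by (intro order_tendstoD(2)) auto
  then obtain N2 where N2: "\<And>n. n \<ge> N2 \<Longrightarrow> (1/2) powr (2 powr real n) * 2 powr (a * real n) < D / (4 * (M + 1))"
    unfolding eventually_sequentially by blast
  show ?thesis
  proof (intro exI[of _ "D / 4"] exI[of _ "max N1 N2"] conjI allI impI ballI)
    fix n j assume n: "max N1 N2 \<le> n" and j: "j \<in> J n"
    have nj: "2 ^ n \<le> j" using j J(1) by fastforce
    \<comment> \<open>Turns the threshold for \<open>j\<close> into one for \<open>n\<close>: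
      \<open>j \<ge> 2 ^ n > n \<ge> N1\<close>.\<close>
    have "n < 2 ^ n" by (rule less_exp)
    then have "N1 \<le> j" using n nj by linarith
    have "M * (1/2) ^ j \<le> (M + 1) * (1/2) ^ 2 ^ n"
      using nj M by (intro mult_mono power_decreasing) auto
    also have "(1/2) ^ 2 ^ n = ((1/2) powr (2 powr real n) * 2 powr (a * real n)) * 2 powr (- a * real n)"
    proof -
      have "(1/2::real) ^ 2 ^ n = (1/2) powr real (2 ^ n)" by (rule powr_realpow[symmetric]) simp
      also have "real (2 ^ n) = 2 powr real n" by (simp add: powr_realpow)
      finally show ?thesis by (simp add: powr_add[symmetric])
    qed
    also have "(M + 1) * \<dots> \<le> (M + 1) * (D / (4 * (M + 1)) * coef n)"
      using N2[of n] n M coef_ge[of n] D unfolding a_def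
      by (intro mult_left_mono mult_mono) (auto simp: less_imp_le)
    also have "\<dots> = D / 4 * coef n" using M by (simp add: field_simps)
    finally have small: "M * (1/2) ^ j \<le> D / 4 * coef n" .
    have "coef n * (D / 2) \<le> coef n * cmod (?I j j)"
      using N1[OF \<open>N1 \<le> j\<close>] coef_pos[of n] by (intro mult_left_mono) auto
    also have "\<dots> = cmod (of_real (coef n) * ?I j j)" using coef_pos[of n] by (simp add: norm_mult)
    also have "\<dots> \<le> cmod (LINT x|lborel. f x * fourier (gsymbol \<phi>0 \<sigma> e j) x) + M * (1/2) ^ j"
      using main[OF j] norm_triangle_ineq2[of "of_real (coef n) * ?I j j" "LINT x|lborel. f x * fourier (gsymbol \<phi>0 \<sigma> e j) x"]
      by (simp add: norm_minus_commute)
    finally show "D / 4 * coef n \<le> cmod (LINT x|lborel. f x * fourier (gsymbol \<phi>0 \<sigma> e j) x)"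
      using small by (simp add: mult.commute)
  qed (use D in simp)
qed

text \<open>All representing functions give the same value at \<open>gtest\<close>, so the duality
  bound holds for each of them and passes to the infimum. In modulus the tests are translates of one
  Gaussian, so \<open>E\<close>, and with it the constant, is independent of
  \<open>j\<close>.\<close>

lemma dist_Lp_norm_LP_block_ge:
  "\<exists>\<kappa>>0. \<exists>N. \<forall>n\<ge>N. \<forall>j\<in>J n. ennreal (\<kappa> * coef n) \<le> dist_Lp_norm p (LP_block \<phi>0 j (distribution_of f))"
proof -
  obtain \<kappa> N where \<kappa>: "\<kappa> > 0" "\<And>n j. n \<ge> N \<Longrightarrow> j \<in> J n \<Longrightarrow>
     \<kappa> * coef n \<le> cmod (LINT x|lborel. f x * fourier (gsymbol \<phi>0 \<sigma> e j) x)"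
    using f_pairing_ge by blast
  define E where "E = (LINT x::'a|lborel. gauss (1/2) x)"
  have E: "E \<ge> 0" by (simp add: E_def gauss_nonneg)
  show ?thesis
  proof (intro exI[of _ "\<kappa> / (1 + E)"] exI[of _ N] conjI allI impI ballI)
    fix n j assume n: "N \<le> n" and j: "j \<in> J n"
    show "ennreal (\<kappa> / (1 + E) * coef n) \<le> dist_Lp_norm p (LP_block \<phi>0 j (distribution_of f))"
      unfolding dist_Lp_norm_def
    proof (rule INF_greatest)
      fix g assume "g \<in> {g. represented_by (LP_block \<phi>0 j (distribution_of f)) g}"
      moreover have "gtest \<sigma> e j \<in> Schwartz" unfolding gtest_def by (rule mgauss_Schwartz)
      ultimately have g: "g \<in> borel_measurable borel" "integrable lborel (\<lambda>x. g x * gtest \<sigma> e j x)"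
          "LP_block \<phi>0 j (distribution_of f) (gtest \<sigma> e j) = (LINT x|lborel. g x * gtest \<sigma> e j x)"
        unfolding represented_by_def distribution_of_def by auto
      have "ennreal (\<kappa> * coef n / (1 + (LINT x|lborel. cmod (gtest \<sigma> e j x)))) \<le> Lp_norm p g"
        using p g(1,2) \<kappa>(1) \<kappa>(2)[OF n j] coef_pos[of n] g(3)[unfolded LP_block_gtest]
        by (intro Lp_norm_ge) (auto simp: gauss_le_1 gtest_def)
      then show "ennreal (\<kappa> / (1 + E) * coef n) \<le> Lp_norm p g" by (simp add: E_def)
    qed
  qed (use \<kappa> E in simp)
qed

lemma LP_block_weighted_ge:
  fixes b :: real
  shows "\<exists>\<kappa>>0. \<exists>N. \<forall>n\<ge>N. \<forall>j\<in>J n. ennreal (\<kappa> * (2 powr (b * real n) * coef n))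
     \<le> ennreal (2 powr (real j * 0) * (1 + real j) powr b) * dist_Lp_norm p (LP_block \<phi>0 j (distribution_of f))"
proof -
  obtain \<kappa> N where \<kappa>: "\<kappa> > 0" "\<And>n j. n \<ge> N \<Longrightarrow> j \<in> J n \<Longrightarrow>
     ennreal (\<kappa> * coef n) \<le> dist_Lp_norm p (LP_block \<phi>0 j (distribution_of f))"
    using dist_Lp_norm_LP_block_ge by blast
  show ?thesis
  proof (intro exI[of _ "2 powr (- \<bar>b\<bar>) * \<kappa>"] exI[of _ N] conjI allI impI ballI)
    fix n j assume n: "N \<le> n" and j: "j \<in> J n"
    have j': "2 ^ n \<le> real j" "1 + real j \<le> 2 * 2 ^ n"
    proof -
      have "2 ^ n \<le> j" "1 + j \<le> 2 * 2 ^ n" using j J(1)[of n] by auto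
      then have "real (2 ^ n) \<le> real j" "real (1 + j) \<le> real (2 * 2 ^ n)"
        by (simp_all only: of_nat_le_iff)
      then show "2 ^ n \<le> real j" "1 + real j \<le> 2 * 2 ^ n" by simp_all
    qed
    \<comment> \<open>Which end of the range of \<open>1 + real j\<close> is relevant depends on the
      sign of \<open>b\<close>; the factor \<open>2 powr (- \<bar>b\<bar>)\<close> covers both
      cases.\<close>
    have "2 powr (- \<bar>b\<bar>) * 2 powr (b * real n) \<le> (1 + real j) powr b"
    proof (cases "b \<ge> 0")
      case True
      have "2 powr (- \<bar>b\<bar>) * 2 powr (b * real n) \<le> 1 * 2 powr (b * real n)"
        by (intro mult_right_mono) (auto simp: powr_minus_divide ge_one_powr_ge_zero)
      also have "\<dots> = (2 ^ n) powr b" by (simp add: powr_realpow[symmetric] powr_powr mult.commute)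
      also have "\<dots> \<le> (1 + real j) powr b" using j'(1) by (intro powr_mono2[OF True]) (simp, linarith)
      finally show ?thesis .
    next
      case False
      then have "2 powr (- \<bar>b\<bar>) * 2 powr (b * real n) = (2 * 2 ^ n) powr b"
        by (simp add: powr_mult powr_realpow[symmetric] powr_powr mult.commute)
      also have "\<dots> \<le> (1 + real j) powr b" using False j' by (intro powr_mono2') auto
      finally show ?thesis .
    qed
    then have "(2 powr (- \<bar>b\<bar>) * 2 powr (b * real n)) * (\<kappa> * coef n) \<le> (1 + real j) powr b * (\<kappa> * coef n)"
      using \<kappa>(1) coef_pos[of n] by (intro mult_right_mono) auto
    then have "ennreal (2 powr (- \<bar>b\<bar>) * \<kappa> * (2 powr (b * real n) * coef n)) \<le> ennreal ((1 + real j) powr b * (\<kappa> * coef n))"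
      by (intro ennreal_leI) (simp add: mult_ac)
    also have "\<dots> = ennreal ((1 + real j) powr b) * ennreal (\<kappa> * coef n)"
      using \<kappa>(1) coef_pos[of n] by (intro ennreal_mult) auto
    also have "\<dots> \<le> ennreal ((1 + real j) powr b) * dist_Lp_norm p (LP_block \<phi>0 j (distribution_of f))"
      by (intro mult_left_mono \<kappa>(2)[OF n j]) auto
    finally show "ennreal (2 powr (- \<bar>b\<bar>) * \<kappa> * (2 powr (b * real n) * coef n))
       \<le> ennreal (2 powr (real j * 0) * (1 + real j) powr b) * dist_Lp_norm p (LP_block \<phi>0 j (distribution_of f))"
      by simp
  qed (use \<kappa> in simp)
qed

text \<open>By \<open>big\<close>, each group from \<open>N\<close> on adds at least
  \<open>\<kappa> powr Q\<close>, and the groups are disjoint, so the partial sums are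
  unbounded.\<close>

lemma Besov_norm_f_infinite:
  fixes b Q :: real
  assumes q: "q = ennreal Q" "Q > 0"
    and big: "\<And>n. 1 \<le> real (card (J n)) * (2 powr (b * real n) * coef n) powr Q"
  shows "Besov_norm \<phi>0 p q 0 b (distribution_of f) = \<infinity>"
proof -
  obtain \<kappa> N where \<kappa>: "\<kappa> > 0" "\<And>n j. n \<ge> N \<Longrightarrow> j \<in> J n \<Longrightarrow> ennreal (\<kappa> * (2 powr (b * real n) * coef n))
     \<le> ennreal (2 powr (real j * 0) * (1 + real j) powr b) * dist_Lp_norm p (LP_block \<phi>0 j (distribution_of f))"
    using LP_block_weighted_ge by blast
  define t where "t j = ennreal_powr (ennreal (2 powr (real j * 0) * (1 + real j) powr b) *
      dist_Lp_norm p (LP_block \<phi>0 j (distribution_of f))) Q" for j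
  have block: "ennreal (\<kappa> powr Q) \<le> (\<Sum>j\<in>J n. t j)" if n: "n \<ge> N" for n
  proof -
    let ?y = "2 powr (b * real n) * coef n"
    have y: "?y \<ge> 0" using coef_pos[of n] by simp
    have "\<kappa> powr Q * 1 \<le> \<kappa> powr Q * (real (card (J n)) * ?y powr Q)"
      by (intro mult_left_mono big) auto
    then have "ennreal (\<kappa> powr Q) \<le> ennreal (real (card (J n)) * (\<kappa> * ?y) powr Q)"
      by (intro ennreal_leI) (simp add: powr_mult mult_ac)
    also have "\<dots> = (\<Sum>j\<in>J n. ennreal ((\<kappa> * ?y) powr Q))"
      by (simp add: ennreal_mult ennreal_of_nat_eq_real_of_nat)
    also have "\<dots> \<le> (\<Sum>j\<in>J n. t j)"
      unfolding t_def using y \<kappa>(1) q(2) by (intro sum_mono ennreal_powr_ge \<kappa>(2) n) auto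
    finally show ?thesis .
  qed
  have sums: "ennreal (real M * \<kappa> powr Q) \<le> (\<Sum>j<2 ^ (N + M). t j)" for M
  proof (induction M)
    case (Suc M)
    let ?n = "N + M"
    have "ennreal (real (Suc M) * \<kappa> powr Q) = ennreal (real M * \<kappa> powr Q) + ennreal (\<kappa> powr Q)"
      by (subst ennreal_plus[symmetric]) (auto simp: algebra_simps)
    also have "\<dots> \<le> (\<Sum>j<2 ^ ?n. t j) + (\<Sum>j\<in>J ?n. t j)"
      by (intro add_mono Suc.IH block) simp
    also have "\<dots> = (\<Sum>j\<in>{..<2 ^ ?n} \<union> J ?n. t j)"
      using J(1)[of ?n] by (intro sum.union_disjoint[symmetric]) fastforce+
    also have "\<dots> \<le> (\<Sum>j<2 ^ (N + Suc M). t j)"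
      using J(1)[of ?n] by (intro sum_mono2) fastforce+
    finally show ?case .
  qed simp
  have "(\<Sum>j. t j) = \<infinity>"
  proof (rule ccontr)
    assume "(\<Sum>j. t j) \<noteq> \<infinity>"
    then obtain s where s: "(\<Sum>j. t j) = ennreal s" "s \<ge> 0" by (cases "\<Sum>j. t j") auto
    obtain M :: nat where M: "s < real M * \<kappa> powr Q"
      using ex_less_of_nat_mult[of "\<kappa> powr Q" s] \<kappa>(1) by auto
    have "ennreal (real M * \<kappa> powr Q) \<le> (\<Sum>j. t j)"
      using sums[of M] sum_le_suminf[of t "{..<2 ^ (N + M)}"] by (meson finite_lessThan order_trans summableI zero_le)
    then show False using s M by simp
  qed
  then show ?thesis using q
    by (simp add: Besov_norm_def t_def ennreal_powr_def)
qed

text \<open>For a supremum, one index from each group is enough, as its term is at least of order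
  \<open>2 powr (\<delta> * n)\<close>.\<close>

lemma Besov_norm_f_infinite_sup:
  fixes b \<delta> :: real
  assumes \<delta>: "\<delta> > 0" and big: "\<And>n. 2 powr (\<delta> * real n) \<le> 2 powr (b * real n) * coef n"
  shows "Besov_norm \<phi>0 p \<infinity> 0 b (distribution_of f) = \<infinity>"
proof (rule ccontr)
  let ?a = "\<lambda>j. ennreal (2 powr (real j * 0) * (1 + real j) powr b) * dist_Lp_norm p (LP_block \<phi>0 j (distribution_of f))"
  assume "Besov_norm \<phi>0 p \<infinity> 0 b (distribution_of f) \<noteq> \<infinity>"
  then have "(SUP j. ?a j) \<noteq> \<infinity>" by (simp add: Besov_norm_def)
  then obtain s where s: "(SUP j. ?a j) = ennreal s" "s \<ge> 0" by (cases "SUP j. ?a j") auto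
  obtain \<kappa> N where \<kappa>: "\<kappa> > 0" "\<And>n j. n \<ge> N \<Longrightarrow> j \<in> J n \<Longrightarrow> ennreal (\<kappa> * (2 powr (b * real n) * coef n)) \<le> ?a j"
    using LP_block_weighted_ge by blast
  have "filterlim (\<lambda>n::nat. 2 powr (\<delta> * real n)) at_top sequentially"
    using \<delta> by real_asymp
  then have "eventually (\<lambda>n::nat. 2 powr (\<delta> * real n) > s / \<kappa>) sequentially"
    by (simp add: filterlim_at_top_dense)
  then obtain n where n: "n \<ge> N" "2 powr (\<delta> * real n) > s / \<kappa>"
    using eventually_happens[OF eventually_conj[OF eventually_ge_at_top[of N]]] by auto
  obtain j where "j \<in> J n" using J(2) by blast
  then have "ennreal (\<kappa> * (2 powr (b * real n) * coef n)) \<le> (SUP j. ?a j)"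
    using \<kappa>(2)[OF n(1)] by (meson SUP_upper2 UNIV_I)
  then have "\<kappa> * (2 powr (b * real n) * coef n) \<le> s" using s by simp
  moreover have "s < \<kappa> * 2 powr (\<delta> * real n)" using n(2) \<kappa>(1) by (simp add: field_simps)
  moreover have "\<kappa> * 2 powr (\<delta> * real n) \<le> \<kappa> * (2 powr (b * real n) * coef n)"
    using big \<kappa>(1) by (intro mult_left_mono) auto
  ultimately show False by linarith
qed

end

end

section \<open>Choice of the parameters\<close>

theorem proposition9p2:
  fixes \<phi>0 :: "real ^ 'd \<Rightarrow> complex"
    and k :: nat
    and p b \<epsilon> :: real
    and q :: ennreal
  assumes "LP_generator \<phi>0"
    and "k \<ge> 1"
    and "1 < p"
    and "0 < q"
    and "b > - enn2real (1 / q)"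
    and "\<epsilon> > 0"
  shows "\<exists>f \<in> diff_Besov_space k p q b.
           distribution_of f \<notin>
             Besov_space \<phi>0 p q 0 (b + enn2real (1 / max (max 2 (ennreal p)) q) + \<epsilon>)"
proof -
  obtain e :: "real ^ 'd" where "e \<in> Basis" using nonempty_Basis by blast
  then have e: "norm e = 1" by (rule norm_Basis)
  define r where "r = max 2 p"
  define \<sigma> :: real where "\<sigma> = (if p \<le> 2 then 0 else 1)"
  \<comment> \<open>Half of \<open>\<epsilon>\<close> puts \<open>\<beta>\<close> above the critical
    value \<open>b + 1 / q\<close> of the difference space; the other half is left for
    divergence.\<close>
  define \<beta> where "\<beta> = b + enn2real (1 / q) + \<epsilon> / 2"
  define J where "J m = (if q \<le> ennreal r then {2 ^ m..<2 ^ Suc m} else {2 ^ m :: nat})" for m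
  define b' where "b' = b + enn2real (1 / max (max 2 (ennreal p)) q) + \<epsilon>"
  have r: "r > 0" "max 2 (ennreal p) = ennreal r"
    using \<open>1 < p\<close> by (auto simp: r_def max_def ennreal_le_iff2 simp flip: ennreal_numeral)
  interpret lacunary \<sigma> p r \<beta> e J
    using assms e by unfold_locales (auto simp: \<sigma>_def r_def \<beta>_def J_def admissible_def)
  have inv: "enn2real (1 / ennreal x) = 1 / x" if "x > 0" for x :: real
    using that by (simp add: divide_ennreal flip: ennreal_1)
  have "Besov_norm \<phi>0 p q 0 b' (distribution_of f) = \<infinity>"
  proof (cases "q = \<infinity>")
    case True
    have card: "card (J n) = 1" for n using True by (simp add: J_def top_unique)
    \<comment> \<open>For \<open>q = \<infinity>\<close> the reciprocals in \<open>b'\<close> and in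
      \<open>\<beta>\<close> are both 0, so only \<open>\<epsilon> / 2\<close> remains.\<close>
    have exps: "b' * real n + - \<beta> * real n = \<epsilon> / 2 * real n" for n
      using True by (simp add: b'_def \<beta>_def max_def top_unique algebra_simps)
    have "2 powr (b' * real n) * coef n = 2 powr (\<epsilon> / 2 * real n)" for n
      unfolding coef_def card exps[symmetric] by (subst powr_add) simp
    then have "2 powr (\<epsilon> / 2 * real n) \<le> 2 powr (b' * real n) * coef n" for n by simp
    then show ?thesis
      using Besov_norm_f_infinite_sup[OF assms(1), of "\<epsilon> / 2"] \<open>\<epsilon> > 0\<close> True by auto
  next
    case False
    then obtain Q where Q: "q = ennreal Q" "Q > 0"
      using \<open>0 < q\<close> by (cases q) auto
    have \<beta>: "\<beta> = b + 1 / Q + \<epsilon> / 2" using Q inv by (simp add: \<beta>_def)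
    have "1 \<le> real (card (J n)) * (2 powr (b' * real n) * coef n) powr Q" for n
    proof (cases "Q \<le> r")
      case True
      then have "b' = b + 1 / r + \<epsilon>"
        using Q r inv by (simp add: b'_def max_def)
      have "card (J n) = 2 ^ n" using True Q r by (simp add: J_def)
      then have "real (card (J n)) * (2 powr (b' * real n) * coef n) powr Q
          = 2 powr (real n + (b' * real n - real n / r - \<beta> * real n) * Q)"
        by (simp add: coef_def powr_realpow[symmetric] powr_powr flip: powr_add) (simp add: algebra_simps)
      \<comment> \<open>The leading \<open>real n\<close>, from the \<open>2 ^ n\<close> members,
        cancels the \<open>1 / Q\<close> in \<open>\<beta>\<close>, and the normalisation of
        \<open>coef n\<close> cancels the \<open>1 / r\<close> in \<open>b'\<close>.\<close>
      also have "real n + (b' * real n - real n / r - \<beta> * real n) * Q = \<epsilon> / 2 * Q * real n"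
        using Q(2) r(1) unfolding \<open>b' = b + 1 / r + \<epsilon>\<close> \<beta> by (simp add: field_simps)
      finally show ?thesis using Q(2) \<open>\<epsilon> > 0\<close> by (simp add: ge_one_powr_ge_zero)
    next
      case False
      then have b': "b' = b + 1 / Q + \<epsilon>"
        using Q r inv by (simp add: b'_def max_def ennreal_le_iff2)
      have "card (J n) = 1" using False Q r by (simp add: J_def)
      then have "real (card (J n)) * (2 powr (b' * real n) * coef n) powr Q
          = 2 powr ((b' * real n - \<beta> * real n) * Q)"
        by (simp add: coef_def powr_powr flip: powr_add)
      \<comment> \<open>A single member provides nothing to cancel the \<open>1 / Q\<close> in
        \<open>\<beta>\<close>, but here \<open>b'\<close> contains the same
        \<open>1 / Q\<close>.\<close>
      also have "(b' * real n - \<beta> * real n) * Q = \<epsilon> / 2 * Q * real n"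
        unfolding b' \<beta> by (simp add: algebra_simps)
      finally show ?thesis using Q(2) \<open>\<epsilon> > 0\<close> by (simp add: ge_one_powr_ge_zero)
    qed
    then show ?thesis using Besov_norm_f_infinite[OF assms(1) Q] by blast
  qed
  then have "distribution_of f \<notin> Besov_space \<phi>0 p q 0 b'"
    by (simp add: Besov_space_def)
  moreover have "f \<in> diff_Besov_space k p q b"
    using assms by (intro f_in_diff_Besov_space) (auto simp: \<beta>_def)
  ultimately show ?thesis unfolding b'_def by blast
qed

end
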